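(* Assume the model accuracy, preconditioner, regularity, local Lipschitz and quadratic growth conditions given in the context, and assume $\mathcal{X}^*$ is nonempty. Let $\{x_k\}$ be generated by the model-based ispPPA algorithm with stepsizes $\{\alpha_k\}$ and parameters $\{\epsilon_k\}$. Put $\eta=L_\infty^2\overline{\eta}$, $\tau=L_\infty^2\overline{\tau}$, $c_1=\mu_\infty^2\overline{c}_1$. Suppose there exist $\gamma\in\mathbb{R}_+$ and $\overline{\rho}>\eta+\tau$ such that $$\alpha_{l0}k^{-\beta}\le\alpha_k\le\alpha_{u0}k^{-\beta}\quad\text{and}\quad\epsilon_k=\gamma\alpha_k^{3/2}\quad\text{for all }k\in\mathbb{Z}_+,$$ where $\alpha_{l0},\alpha_{u0}\in(0,(\overline{\rho})^{-1})$ and $\beta\in(0,1]$. Set $c_{\tau,\eta}=c_1-\frac{\tau+\eta}2$, $\tilde{c}_1=\frac{\overline{\rho}c_{\tau,\eta}}{\overline{\rho}+\eta}$, $\delta_1=\mathrm{dist}(x_1,\mathcal{X}^* )^2$, and let $s\in(0,2)$ be an arbitrary scalar. Define, for $\alpha\in\mathbb{R}_+$, $$\tilde{C}(\alpha)=\rho_{f,m,U}L_F(U)^2+\frac{(1+(2c_1-\tau)\alpha)\left(2(1+\eta\alpha)+s(2c_1-\tau-\eta)\alpha\right)}{(2-s)(2c_1-\tau-\eta)(1+\eta\alpha)}\gamma^2.$$ If $c_1>\frac{\tau+\eta}2$, then on the event that $\sup_{k\in\mathbb{Z}_+}\|x_k\|_2<\infty$, the following hold. 1. If $\beta\in(0,1)$,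 then for all $k\in\mathbb{Z}_+$, $$\begin{aligned}\mathbb{E}\left[\mathrm{dist}(x_k,\mathcal{X}^* )^2\right]\le(\nu_\infty L_\infty)^2\Big[&\exp\Big(-\tfrac{s\tilde{c}_1\alpha_{l0}}{1+s\tilde{c}_1\alpha_{u0}}\varsigma_{1-\beta}(k)\Big)\delta_1+\tilde{C}(\alpha_{u0})\,4^\beta\frac{\alpha_{u0}^2}{1-\exp\big(-\frac{s\tilde{c}_1\alpha_{u0}}{1+s\tilde{c}_1\alpha_{u0}}\big)}\cdot\frac1{k^\beta}\\&+\tilde{C}(\alpha_{u0})\,4^\beta\alpha_{u0}^2\exp\Big(-\tfrac{s\tilde{c}_1\alpha_{l0}}{2(1+s\tilde{c}_1\alpha_{u0})}k^{1-\beta}\Big)\varsigma_{1-2\beta}\big(\tfrac k2\big)\Big].\end{aligned}$$ 2. If $\beta=1$, then for all $k\in\mathbb{Z}_+$, $\mathbb{E}\left[\mathrm{dist}(x_k,\mathcal{X}^* )^2\right]\le(\nu_\infty L_\infty)^2\cdot R_k$, where $$R_k=\begin{cases}\left[\frac{4\delta_1}{1+s\tilde{c}_1\alpha_{l0}}+\frac{4\tilde{C}(\alpha_{u0})(2+s\tilde{c}_1\alpha_{l0})\alpha_{u0}^2}{2-s\tilde{c}_1\alpha_{l0}}\right]\left(\frac1k\right)^{\frac{2s\tilde{c}_1\alpha_{l0}}{2+s\tilde{c}_1\alpha_{l0}}}&\text{if }c_{\tau,\eta}\alpha_{l0}<\frac2s\left(1+\frac{\eta}{\overline{\rho}}\right),\\[2mm]\frac{4\delta_1}3\cdot\frac1k+4\tilde{C}(\alpha_{u0})\alpha_{u0}^2\cdot\frac{\ln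 k}k&\text{if }c_{\tau,\eta}\alpha_{l0}=\frac2s\left(1+\frac{\eta}{\overline{\rho}}\right),\\[2mm]\frac{4\delta_1}{1+s\tilde{c}_1\alpha_{l0}}\left(\frac1k\right)^{\frac{2s\tilde{c}_1\alpha_{l0}}{2+s\tilde{c}_1\alpha_{l0}}}+\frac{4\tilde{C}(\alpha_{u0})(2+s\tilde{c}_1\alpha_{l0})\alpha_{u0}^2}{s\tilde{c}_1\alpha_{l0}-2}\cdot\frac1k&\text{if }c_{\tau,\eta}\alpha_{l0}>\frac2s\left(1+\frac{\eta}{\overline{\rho}}\right).\end{cases}$$
   Context: Notation: $\mathbb{Z}_+=\{1,2,\dots\}$, $\mathbb{R}_+=[0,\infty)$, $\mathbb{R}_{++}=(0,\infty)$. For $b\in\mathbb{R}$ and $t>0$: $\varsigma_b(t)=(t^b-1)/b$ if $b\ne0$ and $\varsigma_0(t)=\ln t$. For a self-adjoint positive-definite linear map $M$ on $\mathbb{R}^d$: $\|x\|_M^2=\langle x,Mx\rangle$, $\mathrm{dist}_M(x,X)=\inf_{y\in X}\|x-y\|_M$ (subscript omitted when $M=I_d$); for $p:\mathbb{R}^d\to(-\infty,+\infty]$ proper closed and $\alpha>0$, $\mathrm{prox}^M_{\alpha p}(x)=\arg\min_y\{p(y)+\frac1{2\alpha}\|y-x\|_M^2\}$. A proper closed $p$ is $\overline{\tau}$-weakly convex if $p+\frac{\overline{\tau}}2\|\cdot\|_2^2$ is convex; $\partial p$ is the regular (Fréchet) subdifferential. (The scalar $s\in(0,2)$ in the claim is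 unrelated to the sample variable $s\in\mathcal{S}$ below.) Problem: minimize $\phi(x)=F(x)+r(x)$ over $\mathbb{R}^d$, $F(x)=\mathbb{E}_{s\sim P}[f(x;s)]$, $P$ a distribution on a sample space $\mathcal{S}$, $r:\mathbb{R}^d\to(-\infty,+\infty]$. $\phi^*=\inf\phi$, $\mathcal{X}^*=\arg\min\phi$. Model functions: $V$ is an open convex set containing $\mathrm{dom}(r)$, and $(x,y,s)\mapsto f_x(y;s)$ is a measurable function on $V\times V\times\mathcal{S}$; $\varphi_x(y;s)=f_x(y;s)+r(y)$, with value $+\infty$ for $y\notin\mathrm{dom}(r)$. For a minibatch $S_k^{1:m}=\{S_k^i\}_{i=1}^m$: $\overline{f}_{x_k}(x;S_k^{1:m})=\frac1m\sum_{i=1}^m f_{x_k}(x;S_k^i)$, $\overline{\varphi}_{x_k}(x;S_k^{1:m})=\overline{f}_{x_k}(x;S_k^{1:m})+r(x)$. Model-based ispPPA algorithm: given $x_1$, stepsizes $\alpha_k>0$, accuracies $\epsilon_k\ge0$, minibatch size $m$ and self-adjoint positive-definite linear maps (preconditioners) $M_k$, which may depend on the sampled minibatches, at iteration $k=1,2,\dots$ draw $S_k^1,\dots,S_k^m$ i.i.d. from $P$ and let $x_{k+1}$ be an approximate minimizer of $\Phi_k(x)=\overline{\varphi}_{x_k}(x;S_k^{1:m})+\frac1{2\alpha_k}\|x-x_k\|_{M_k}^2$ satisfying one of: (a) $\|x_{k+1}-\tilde{x}_{k+1}\|_{M_k}\le\epsilon_k$, where $\tilde{x}_{k+1}=\mathrm{prox}^{M_k}_{\alpha_k\overline{\varphi}_{x_k}(\cdot;S_k^{1:m})}(x_k)$;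 (b) $\Phi_k(x_{k+1})-\min\Phi_k\le\frac{1-\tau\alpha_k}{2\alpha_k}\epsilon_k^2$; (c) $\mathrm{dist}_{M_k^{-1}}(0,\partial\Phi_k(x_{k+1}))\le\frac{1-\tau\alpha_k}{\alpha_k}\epsilon_k$; here $\tau=L_\infty^2\overline{\tau}$. $\mathcal{F}_k=\sigma(S_1^{1:m},\dots,S_k^{1:m})$ and $\mathbb{E}_k[\cdot]=\mathbb{E}[\cdot\mid\mathcal{F}_{k-1}]$. Model accuracy condition: there is a scalar $\overline{\eta}\in\mathbb{R}$ such that for $P$-almost all $s$, $f_x(x;s)=f(x;s)$ and $|f_x(y;s)-f(y;s)|\le\frac{\overline{\eta}}2\|y-x\|_2^2$ for all $x,y\in V$. Preconditioner condition: there are $\mu_\infty\in(0,1]$, $L_\infty\in[1,\infty)$ such that for every $k\in\mathbb{Z}_+$, $\mu_k\|x\|_{M_k}\le\|x\|_2\le L_k\|x\|_{M_k}$ for all $x\in\mathbb{R}^d$, with $\mu_k\in[\mu_\infty,\infty)$, $L_k\in(0,L_\infty]$; and $\rho_k^{-2}\le\mathbb{E}_k\big[\|x\|_{M_k}^2/\|x\|_{M_{k-1}}^2\big]\le\rho_k^2$ for all $x\ne0$, with $\rho_k\in[1,\infty)$ and $\nu_k=\prod_{i=0}^{k-1}\rho_i\nearrow\nu_\infty=\prod_{i=0}^\infty\rho_i<\infty$; by definition $M_0=I_d$, $\mu_0=L_0=\rho_0=1$. Regularity condition: $F:\mathbb{R}^d\to\mathbb{R}$ is locally Lipschitz, $r$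 is proper closed, and for $P$-almost all $s$, $f(\cdot;s):\mathbb{R}^d\to(-\infty,+\infty]$ is proper closed with $\mathrm{dom}(f(\cdot;s))\supset\mathrm{dom}(r)$, and $\varphi_x(\cdot;s)$ is $\overline{\tau}$-weakly convex for all $x\in V$, where $\overline{\tau}\in\mathbb{R}_+$ is a constant. Local Lipschitz condition: for any bounded subset $U\subset V$ there is a measurable $\overline{L}_{f,U}:\mathcal{S}\to\mathbb{R}_+$ with $\sqrt{\mathbb{E}_{s\sim P}[\overline{L}_{f,U}(s)^2]}\le\overline{L}_F(U)$ for some constant $\overline{L}_F(U)\in\mathbb{R}_+$ depending on $U$ such that for $P$-almost all $s$, $|f_x(x;s)-f_x(y;s)|\le\overline{L}_{f,U}(s)\|x-y\|_2$ for all $x,y\in U$. Quadratic growth condition: there is $\overline{c}_1>0$ with $\phi(x)\ge\phi^*+\overline{c}_1\,\mathrm{dist}(x,\mathcal{X}^* )^2$ for all $x\in\mathbb{R}^d$. The set $U$ in the constants of the claim: on the event that $\sup_{k\in\mathbb{Z}_+}\|x_k\|_2<\infty$, $U$ denotes a bounded open convex subset of $V$ that contains both $\{x_k\}$ and $\{\tilde{x}_k\}$. Constants: $L_{f,U}(s)=L_\infty\overline{L}_{f,U}(s)$, $L_F(U)=L_\infty\overline{L}_F(U)$, and, assuming without loss of generality $\mathbb{E}_{s\sim P}[L_{f,U}(s)^2]>0$, $\omega_{f,U}=1-\mathrm{Var}(L_{f,U}(s))/\mathbb{E}_{s\sim P}[L_{f,U}(s)^2]$, $\rho_{f,m,U}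=\Big(\sqrt{\tfrac{1+(m-1)\omega_{f,U}}{m}}+1\Big)^2$.
   Formalization: In part 2 the bound is claimed for k=1 only if s·c̃₁·α_{l0} ≤ 3 (otherwise R_1 can be smaller than δ_1, so the claim fails); the event sup‖x_k‖<∞ is taken to hold almost surely, with one fixed set U containing all x_k and x̃_k almost surely. *)

theory Defs
  imports "HOL-Probability.Probability"
begin

section \<open>Extended-valued functions on a Euclidean space\<close>

definition effdom :: "('a \<Rightarrow> ereal) \<Rightarrow> 'a set" where
  "effdom p = {x. p x < \<infinity>}"

definition epi :: "('a \<Rightarrow> ereal) \<Rightarrow> ('a \<times> real) set" where
  "epi p = {(x, t). p x \<le> ereal t}"

definition proper_closed :: "('a::euclidean_space \<Rightarrow> ereal) \<Rightarrow> bool" where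
  "proper_closed p \<longleftrightarrow> effdom p \<noteq> {} \<and> (\<forall>x. p x \<noteq> -\<infinity>) \<and> closed (epi p)"

definition weakly_convex :: "real \<Rightarrow> ('a::euclidean_space \<Rightarrow> ereal) \<Rightarrow> bool" where
  "weakly_convex t p \<longleftrightarrow>
     proper_closed p \<and> convex (epi (\<lambda>x. p x + ereal (t / 2 * (norm x)\<^sup>2)))"

definition argmin_set :: "('a \<Rightarrow> ereal) \<Rightarrow> 'a set" where
  "argmin_set p = {x. is_arg_min p (\<lambda>_. True) x}"

text \<open>Regular (Frechet) subdifferential: the vectors \<open>v\<close> with
  \<open>p y \<ge> p x + v \<bullet> (y - x) - o(norm (y - x))\<close> as \<open>y\<close> tends to \<open>x\<close>; it is empty where \<open>p\<close> is
  not finite.\<close>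

definition frechet_subdiff :: "('a::euclidean_space \<Rightarrow> ereal) \<Rightarrow> 'a \<Rightarrow> 'a set" where
  "frechet_subdiff p x =
     {v. \<bar>p x\<bar> \<noteq> \<infinity> \<and>
         (\<forall>e>0. \<forall>\<^sub>F y in at x. p x + ereal (v \<bullet> (y - x) - e * norm (y - x)) \<le> p y)}"

definition locally_lipschitz :: "('a::euclidean_space \<Rightarrow> real) \<Rightarrow> bool" where
  "locally_lipschitz F \<longleftrightarrow> (\<forall>x. \<exists>e>0. \<exists>C. C-lipschitz_on (ball x e) F)"

definition varsigma :: "real \<Rightarrow> real \<Rightarrow> real" where
  "varsigma b t = (if b = 0 then ln t else (t powr b - 1) / b)"


section \<open>Preconditioned norms and proximal steps\<close>

definition spd_map :: "('a::euclidean_space \<Rightarrow> 'a) \<Rightarrow> bool" where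
  "spd_map A \<longleftrightarrow>
     linear A \<and> (\<forall>x y. A x \<bullet> y = x \<bullet> A y) \<and> (\<forall>x. x \<noteq> 0 \<longrightarrow> 0 < x \<bullet> A x)"

definition wnorm :: "('a::euclidean_space \<Rightarrow> 'a) \<Rightarrow> 'a \<Rightarrow> real" where
  "wnorm A x = sqrt (x \<bullet> A x)"

text \<open>The distance is extended-valued so that the distance to the empty set is \<open>\<infinity>\<close>
  (\<^const>\<open>infdist\<close> would give \<open>0\<close>); this matters for the subdifferential stopping test.\<close>

definition wdist :: "('a::euclidean_space \<Rightarrow> 'a) \<Rightarrow> 'a \<Rightarrow> 'a set \<Rightarrow> ereal" where
  "wdist A x X = (INF y\<in>X. ereal (wnorm A (x - y)))"

definition prox_objective ::
  "('a::euclidean_space \<Rightarrow> 'a) \<Rightarrow> real \<Rightarrow> ('a \<Rightarrow> ereal) \<Rightarrow> 'a \<Rightarrow> 'a \<Rightarrow> ereal" where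
  "prox_objective A a p x y = p y + ereal (1 / (2 * a) * (wnorm A (y - x))\<^sup>2)"

definition prox ::
  "('a::euclidean_space \<Rightarrow> 'a) \<Rightarrow> real \<Rightarrow> ('a \<Rightarrow> ereal) \<Rightarrow> 'a \<Rightarrow> 'a" where
  "prox A a p x = arg_min (prox_objective A a p x) (\<lambda>_. True)"

definition inexact_prox_step ::
  "('a::euclidean_space \<Rightarrow> 'a) \<Rightarrow> real \<Rightarrow> real \<Rightarrow> real \<Rightarrow> ('a \<Rightarrow> ereal) \<Rightarrow> 'a \<Rightarrow> 'a \<Rightarrow> bool" where
  "inexact_prox_step A a e t p x x' \<longleftrightarrow>
     (let \<Phi> = prox_objective A a p x in
       wnorm A (x' - prox A a p x) \<le> e \<or>
       \<Phi> x' - (INF y. \<Phi> y) \<le> ereal ((1 - t * a) / (2 * a) * e\<^sup>2) \<or>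
       wdist (inv A) 0 (frechet_subdiff \<Phi> x') \<le> ereal ((1 - t * a) / a * e))"


section \<open>The stochastic problem and its models\<close>

text \<open>\<open>P\<close> is the sample distribution and \<open>f x s\<close> the sample objective, which may be \<open>\<infinity>\<close>.
  \<open>finite_mean P f\<close> says that the expectation is a well-defined real number at every point.\<close>

definition finite_mean :: "'s measure \<Rightarrow> ('a \<Rightarrow> 's \<Rightarrow> ereal) \<Rightarrow> bool" where
  "finite_mean P f \<longleftrightarrow>
     (\<forall>x. f x \<in> borel_measurable P \<and> (AE s in P. \<bar>f x s\<bar> \<noteq> \<infinity>) \<and>
          integrable P (\<lambda>s. real_of_ereal (f x s)))"

definition mean_loss :: "'s measure \<Rightarrow> ('a \<Rightarrow> 's \<Rightarrow> ereal) \<Rightarrow> 'a \<Rightarrow> real" where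
  "mean_loss P f x = (LINT s|P. real_of_ereal (f x s))"

definition total_objective ::
  "'s measure \<Rightarrow> ('a \<Rightarrow> 's \<Rightarrow> ereal) \<Rightarrow> ('a \<Rightarrow> ereal) \<Rightarrow> 'a \<Rightarrow> ereal" where
  "total_objective P f r x = ereal (mean_loss P f x) + r x"

text \<open>\<open>g x y s\<close> is the model \<open>f_x(y;s)\<close>. It is only meaningful for \<open>x, y \<in> V\<close>; its values
  elsewhere are never used because \<open>r y = \<infinity>\<close> outside \<open>V\<close>.\<close>

definition model_functions ::
  "'s measure \<Rightarrow> 'a::euclidean_space set \<Rightarrow> ('a \<Rightarrow> ereal) \<Rightarrow> ('a \<Rightarrow> 'a \<Rightarrow> 's \<Rightarrow> real) \<Rightarrow> bool" where
  "model_functions P V r g \<longleftrightarrow>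
     open V \<and> convex V \<and> effdom r \<subseteq> V \<and>
     (\<lambda>(x, y, s). g x y s) \<in>
       borel_measurable (restrict_space borel V \<Otimes>\<^sub>M (restrict_space borel V \<Otimes>\<^sub>M P))"

definition minibatch_model ::
  "('a \<Rightarrow> 'a \<Rightarrow> 's \<Rightarrow> real) \<Rightarrow> ('a \<Rightarrow> ereal) \<Rightarrow> nat \<Rightarrow> (nat \<Rightarrow> 's) \<Rightarrow> 'a \<Rightarrow> 'a \<Rightarrow> ereal" where
  "minibatch_model g r m S x y = ereal (1 / real m * (\<Sum>i=1..m. g x y (S i))) + r y"

definition model_accuracy ::
  "'s measure \<Rightarrow> 'a::euclidean_space set \<Rightarrow> ('a \<Rightarrow> 's \<Rightarrow> ereal) \<Rightarrow> ('a \<Rightarrow> 'a \<Rightarrow> 's \<Rightarrow> real) \<Rightarrow>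
     real \<Rightarrow> bool" where
  "model_accuracy P V f g eta \<longleftrightarrow>
     (AE s in P. \<forall>x\<in>V. \<forall>y\<in>V.
        ereal (g x x s) = f x s \<and>
        \<bar>ereal (g x y s) - f y s\<bar> \<le> ereal (eta / 2 * (norm (y - x))\<^sup>2))"

definition regularity ::
  "'s measure \<Rightarrow> 'a::euclidean_space set \<Rightarrow> ('a \<Rightarrow> 's \<Rightarrow> ereal) \<Rightarrow> ('a \<Rightarrow> ereal) \<Rightarrow>
     ('a \<Rightarrow> 'a \<Rightarrow> 's \<Rightarrow> real) \<Rightarrow> real \<Rightarrow> bool" where
  "regularity P V f r g tau \<longleftrightarrow>
     finite_mean P f \<and> locally_lipschitz (mean_loss P f) \<and> proper_closed r \<and> 0 \<le> tau \<and>
     (AE s in P.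
        proper_closed (\<lambda>x. f x s) \<and> effdom r \<subseteq> effdom (\<lambda>x. f x s) \<and>
        (\<forall>x\<in>V. weakly_convex tau (\<lambda>y. ereal (g x y s) + r y)))"

text \<open>\<open>Lf U s\<close> and \<open>LF U\<close> are the Lipschitz constants attached to a bounded set \<open>U\<close>. The
  inequality is anchored at the base point \<open>x\<close> of the model.\<close>

definition local_lipschitz_models ::
  "'s measure \<Rightarrow> 'a::euclidean_space set \<Rightarrow> ('a \<Rightarrow> 'a \<Rightarrow> 's \<Rightarrow> real) \<Rightarrow>
     ('a set \<Rightarrow> 's \<Rightarrow> real) \<Rightarrow> ('a set \<Rightarrow> real) \<Rightarrow> bool" where
  "local_lipschitz_models P V g Lf LF \<longleftrightarrow>
     (\<forall>U. bounded U \<and> U \<subseteq> V \<longrightarrow>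
        Lf U \<in> borel_measurable P \<and> (\<forall>s\<in>space P. 0 \<le> Lf U s) \<and> 0 \<le> LF U \<and>
        integrable P (\<lambda>s. (Lf U s)\<^sup>2) \<and> sqrt (LINT s|P. (Lf U s)\<^sup>2) \<le> LF U \<and>
        (AE s in P. \<forall>x\<in>U. \<forall>y\<in>U. \<bar>g x x s - g x y s\<bar> \<le> Lf U s * norm (x - y)))"

definition quadratic_growth ::
  "('a::euclidean_space \<Rightarrow> ereal) \<Rightarrow> real \<Rightarrow> bool" where
  "quadratic_growth p c \<longleftrightarrow>
     0 < c \<and> (\<forall>x. (INF y. p y) + ereal (c * (infdist x (argmin_set p))\<^sup>2) \<le> p x)"


section \<open>The algorithm\<close>

text \<open>Samples are random variables \<open>S k i\<close> on a probability space \<open>\<Omega>\<close>, with iteration index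
  \<open>k \<ge> 1\<close> and minibatch index \<open>i \<in> {1..m}\<close>. \<open>sample_filtration \<Omega> P S m k\<close> is the sigma-algebra
  generated by the minibatches of iterations \<open>1, \<dots>, k\<close> (trivial for \<open>k = 0\<close>).\<close>

definition sample_filtration ::
  "'w measure \<Rightarrow> 's measure \<Rightarrow> (nat \<Rightarrow> nat \<Rightarrow> 'w \<Rightarrow> 's) \<Rightarrow> nat \<Rightarrow> nat \<Rightarrow> 'w measure" where
  "sample_filtration \<Omega> P S m k =
     sigma (space \<Omega>)
       {S j i -` A \<inter> space \<Omega> | j i A. j \<in> {1..k} \<and> i \<in> {1..m} \<and> A \<in> sets P}"

definition iid_samples ::
  "'w measure \<Rightarrow> 's measure \<Rightarrow> (nat \<Rightarrow> nat \<Rightarrow> 'w \<Rightarrow> 's) \<Rightarrow> nat \<Rightarrow> bool" where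
  "iid_samples \<Omega> P S m \<longleftrightarrow>
     prob_space.indep_vars \<Omega> (\<lambda>_. P) (\<lambda>(k, i). S k i) ({1..} \<times> {1..m}) \<and>
     (\<forall>k\<ge>1. \<forall>i\<in>{1..m}. distr \<Omega> P (S k i) = P)"

definition exact_iterate ::
  "(nat \<Rightarrow> nat \<Rightarrow> 'w \<Rightarrow> 's) \<Rightarrow> nat \<Rightarrow> ('a::euclidean_space \<Rightarrow> 'a \<Rightarrow> 's \<Rightarrow> real) \<Rightarrow> ('a \<Rightarrow> ereal) \<Rightarrow>
     (nat \<Rightarrow> 'w \<Rightarrow> 'a \<Rightarrow> 'a) \<Rightarrow> (nat \<Rightarrow> real) \<Rightarrow> (nat \<Rightarrow> 'w \<Rightarrow> 'a) \<Rightarrow> nat \<Rightarrow> 'w \<Rightarrow> 'a" where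
  "exact_iterate S m g r M \<alpha> x k \<omega> =
     prox (M k \<omega>) (\<alpha> k) (minibatch_model g r m (\<lambda>i. S k i \<omega>) (x k \<omega>)) (x k \<omega>)"

text \<open>\<open>exact_iterate \<dots> k\<close> is the exact proximal point approximated by \<open>x (Suc k)\<close>. A run is
  non-anticipating: \<open>M k\<close> and \<open>x (Suc k)\<close> are determined by the minibatches up to iteration \<open>k\<close>.
  Which of the three accuracy tests is met may vary with the iteration and the outcome.\<close>

definition ispPPA_run ::
  "'w measure \<Rightarrow> 's measure \<Rightarrow> (nat \<Rightarrow> nat \<Rightarrow> 'w \<Rightarrow> 's) \<Rightarrow> nat \<Rightarrow> 'a::euclidean_space set \<Rightarrow>
     ('a \<Rightarrow> 'a \<Rightarrow> 's \<Rightarrow> real) \<Rightarrow> ('a \<Rightarrow> ereal) \<Rightarrow> real \<Rightarrow> (nat \<Rightarrow> 'w \<Rightarrow> 'a \<Rightarrow> 'a) \<Rightarrow>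
     (nat \<Rightarrow> real) \<Rightarrow> (nat \<Rightarrow> real) \<Rightarrow> 'a \<Rightarrow> (nat \<Rightarrow> 'w \<Rightarrow> 'a) \<Rightarrow> bool" where
  "ispPPA_run \<Omega> P S m V g r \<tau> M \<alpha> \<epsilon> x1 x \<longleftrightarrow>
     1 \<le> m \<and> iid_samples \<Omega> P S m \<and>
     (\<forall>k\<ge>1. 0 < \<alpha> k \<and> 0 \<le> \<epsilon> k) \<and>
     (\<forall>k\<ge>1. (\<forall>\<omega>\<in>space \<Omega>. spd_map (M k \<omega>)) \<and>
            (\<forall>v. (\<lambda>\<omega>. M k \<omega> v) \<in> borel_measurable (sample_filtration \<Omega> P S m k))) \<and>
     (\<forall>\<omega>\<in>space \<Omega>. x 1 \<omega> = x1) \<and>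
     (\<forall>k\<ge>1. x (Suc k) \<in> borel_measurable (sample_filtration \<Omega> P S m k)) \<and>
     (AE \<omega> in \<Omega>. \<forall>k\<ge>1. x k \<omega> \<in> V \<and>
        inexact_prox_step (M k \<omega>) (\<alpha> k) (\<epsilon> k) \<tau>
          (minibatch_model g r m (\<lambda>i. S k i \<omega>) (x k \<omega>)) (x k \<omega>) (x (Suc k) \<omega>))"

text \<open>The limit \<open>\<nu>inf\<close> of the partial products is automatically an increasing limit, since
  \<open>\<rho> k \<ge> 1\<close>.\<close>

definition preconditioner_condition ::
  "'w measure \<Rightarrow> (nat \<Rightarrow> 'w measure) \<Rightarrow> (nat \<Rightarrow> 'w \<Rightarrow> 'a::euclidean_space \<Rightarrow> 'a) \<Rightarrow>
     (nat \<Rightarrow> real) \<Rightarrow> (nat \<Rightarrow> real) \<Rightarrow> (nat \<Rightarrow> real) \<Rightarrow> real \<Rightarrow> real \<Rightarrow> real \<Rightarrow> bool" where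
  "preconditioner_condition \<Omega> Fil M \<mu> L \<rho> \<mu>inf Linf \<nu>inf \<longleftrightarrow>
     0 < \<mu>inf \<and> \<mu>inf \<le> 1 \<and> 1 \<le> Linf \<and>
     (\<forall>\<omega>. M 0 \<omega> = id) \<and> \<mu> 0 = 1 \<and> L 0 = 1 \<and> \<rho> 0 = 1 \<and>
     (\<forall>k\<ge>1. \<mu>inf \<le> \<mu> k \<and> 0 < L k \<and> L k \<le> Linf \<and> 1 \<le> \<rho> k) \<and>
     (AE \<omega> in \<Omega>. \<forall>k\<ge>1. \<forall>v. \<mu> k * wnorm (M k \<omega>) v \<le> norm v \<and> norm v \<le> L k * wnorm (M k \<omega>) v) \<and>
     (\<forall>k\<ge>1. \<forall>v. v \<noteq> 0 \<longrightarrow>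
        (AE \<omega> in \<Omega>.
           (let q = real_cond_exp \<Omega> (Fil (k - 1))
                      (\<lambda>\<omega>'. (wnorm (M k \<omega>') v)\<^sup>2 / (wnorm (M (k - 1) \<omega>') v)\<^sup>2) \<omega>
            in 1 / (\<rho> k)\<^sup>2 \<le> q \<and> q \<le> (\<rho> k)\<^sup>2))) \<and>
     (\<lambda>k. \<Prod>i<k. \<rho> i) \<longlonglongrightarrow> \<nu>inf"


section \<open>Constants\<close>

definition omega_const :: "'s measure \<Rightarrow> ('s \<Rightarrow> real) \<Rightarrow> real" where
  "omega_const P l =
     1 - (LINT s|P. (l s - (LINT s'|P. l s'))\<^sup>2) / (LINT s|P. (l s)\<^sup>2)"

definition rho_const :: "'s measure \<Rightarrow> ('s \<Rightarrow> real) \<Rightarrow> nat \<Rightarrow> real" where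
  "rho_const P l m = (sqrt ((1 + (real m - 1) * omega_const P l) / real m) + 1)\<^sup>2"

end

theory Submission
  imports Defs
begin

text \<open>
  Measure progress by the squared distance to the solution set in the metric of the preconditioner
  that was chosen one iteration earlier. One iteration contracts this quantity up to a noise term of order
  \<open>(\<alpha> k)\<^sup>2\<close>; dividing by the partial products of the \<open>\<rho> k\<close> turns this into a scalar recursion
  (\<open>scaled_recursion\<close>) with contraction factor \<open>1 / (1 + s * ctilde * \<alpha> k)\<close>, and the two parts of
  the theorem are the solutions of that recursion for stepsizes of order \<open>k powr - \<beta>\<close>.

  The contraction comes from the three-point inequality of the exact proximal point \<open>w\<close>. The proximal
  objective is strongly convex in the preconditioned norm with modulus \<open>(1 - \<tau> * \<alpha> k) / \<alpha> k\<close>, because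
  weak convexity in the Euclidean norm costs at most the factor \<open>Linf\<^sup>2\<close>. Comparing \<open>w\<close> with a near-projection \<open>y\<close>
  of \<open>x k\<close> onto the solution set, the model values are replaced by sample losses: at \<open>y\<close> by the
  accuracy of the model, at \<open>w\<close> by passing through \<open>x k\<close>, where the model is exact, at the price of a Lipschitz constant
  times the step length. Sample losses and their mean are Lipschitz on the convex set \<open>U\<close>
  without any quadratic term (\<open>lipschitz_from_quadratic_error\<close>), so the two Lipschitz terms and
  the squared step length combine to \<open>(\<alpha> k)\<^sup>2\<close> times the square of an averaged Lipschitz constant plus its mean,
  whose expectation is the constant involving \<^const>\<open>rho_const\<close>. Quadratic growth at \<open>w\<close> supplies the decrease.

  What remains is the difference between sampled and expected losses at \<open>y\<close> and at \<open>x k\<close>. Both points are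
  determined by the past, so this difference should have mean zero. To see this without
  measurable selection, \<open>x k\<close> and its near-projection are replaced by points \<open>z\<close> and \<open>y\<close> that take finitely many
  values, up to an error \<open>d\<close>; on each of finitely many past events the new sample is independent, and \<open>d\<close>
  tends to zero in the end (\<open>expected_descent\<close>). The same finite decomposition lets the
  condition on the conditional expectation of the preconditioners, which is stated for fixed vectors, be applied to the
  random vector \<open>y - z\<close>.

  Each of the three accuracy tests bounds the distance from \<open>x (Suc k)\<close> to \<open>w\<close> by \<open>\<epsilon> k\<close>
  (\<open>inexact_prox_step_close\<close>). Young's inequality with a weight that gives up the fraction \<open>1 - s / 2\<close> of the
  contraction absorbs this error (\<open>young_step_arith\<close>); since \<open>(\<epsilon> k)\<^sup>2\<close> is of order \<open>(\<alpha> k) ^ 3\<close>, it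
  contributes to the noise at order \<open>(\<alpha> k)\<^sup>2\<close>.
\<close>

section \<open>Preconditioned norms\<close>

lemma spd_map_id: "spd_map (id :: 'a::euclidean_space \<Rightarrow> 'a)"
  by (auto simp: spd_map_def linear_id)

lemma wnorm_id [simp]: "wnorm id x = norm x"
  by (simp add: wnorm_def norm_eq_sqrt_inner)

lemma
  assumes "spd_map A"
  shows spd_linear: "linear A" and spd_sym: "A x \<bullet> y = x \<bullet> A y"
    and spd_nonneg: "0 \<le> x \<bullet> A x" and spd_pos: "x \<noteq> 0 \<Longrightarrow> 0 < x \<bullet> A x"
  using assms by (auto simp: spd_map_def linear_0 intro: less_imp_le) (cases "x = 0"; auto simp: less_imp_le)

lemma wnorm_power2: "spd_map A \<Longrightarrow> (wnorm A x)\<^sup>2 = x \<bullet> A x"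
  by (simp add: wnorm_def spd_nonneg)

lemma wnorm_nonneg [simp]: "spd_map A \<Longrightarrow> 0 \<le> wnorm A x"
  by (simp add: wnorm_def spd_nonneg)

lemma wnorm_zero [simp]: "wnorm A 0 = 0"
  by (simp add: wnorm_def)

lemma wnorm_pos: "spd_map A \<Longrightarrow> x \<noteq> 0 \<Longrightarrow> 0 < wnorm A x"
  by (simp add: wnorm_def spd_pos)

lemma wnorm_scaleR:
  assumes "spd_map A" shows "wnorm A (c *\<^sub>R x) = \<bar>c\<bar> * wnorm A x"
  using assms by (simp add: wnorm_def linear_scale[OF spd_linear] real_sqrt_mult mult.assoc[symmetric]
      power2_eq_square[symmetric])

lemma spd_diff: "spd_map A \<Longrightarrow> A (x - y) = A x - A y"
  and spd_add: "spd_map A \<Longrightarrow> A (x + y) = A x + A y"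
  and spd_minus: "spd_map A \<Longrightarrow> A (- x) = - A x"
  and spd_scaleR: "spd_map A \<Longrightarrow> A (c *\<^sub>R x) = c *\<^sub>R A x"
  by (simp_all add: spd_linear linear_diff linear_add linear_neg linear_scale)

lemma wnorm_minus: "spd_map A \<Longrightarrow> wnorm A (- x) = wnorm A x"
  by (simp add: wnorm_def spd_minus)

lemma wnorm_commute: "spd_map A \<Longrightarrow> wnorm A (x - y) = wnorm A (y - x)"
  by (metis minus_diff_eq wnorm_minus)

lemma wnorm_Cauchy_Schwarz:
  assumes A: "spd_map A"
  shows "x \<bullet> A y \<le> wnorm A x * wnorm A y"
proof (cases "y = 0")
  case True
  then show ?thesis using linear_0[OF spd_linear[OF A]] by simp
next
  case False
  let ?b = "y \<bullet> A y" and ?c = "x \<bullet> A y"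
  have b: "0 < ?b" using spd_pos[OF A False] .
  have "0 \<le> (?b *\<^sub>R x - ?c *\<^sub>R y) \<bullet> A (?b *\<^sub>R x - ?c *\<^sub>R y)"
    by (rule spd_nonneg[OF A])
  also have "\<dots> = ?b * (?b * (x \<bullet> A x) - ?c\<^sup>2)"
    using spd_sym[OF A, of y x]
    by (simp add: spd_diff[OF A] spd_scaleR[OF A] inner_diff_left inner_diff_right inner_commute
        power2_eq_square algebra_simps)
  finally have "?c\<^sup>2 \<le> ?b * (x \<bullet> A x)"
    using b by (simp add: zero_le_mult_iff)
  then have "?c\<^sup>2 \<le> (wnorm A x * wnorm A y)\<^sup>2"
    by (simp add: power_mult_distrib wnorm_power2[OF A] mult.commute)
  then show ?thesis
    by (rule power2_le_imp_le) (simp add: A)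
qed

lemma wnorm_add_power2:
  assumes "spd_map A"
  shows "(wnorm A (x + y))\<^sup>2 = (wnorm A x)\<^sup>2 + 2 * (x \<bullet> A y) + (wnorm A y)\<^sup>2"
  using spd_sym[OF assms, of y x]
  by (simp add: wnorm_power2[OF assms] spd_add[OF assms] inner_add_left inner_add_right inner_commute)

lemma wnorm_triangle:
  assumes A: "spd_map A"
  shows "wnorm A (x + y) \<le> wnorm A x + wnorm A y"
proof (rule power2_le_imp_le)
  show "(wnorm A (x + y))\<^sup>2 \<le> (wnorm A x + wnorm A y)\<^sup>2"
    unfolding wnorm_add_power2[OF A] power2_sum using wnorm_Cauchy_Schwarz[OF A, of x y] by simp
qed (simp add: A)

lemma wnorm_triangle_diff:
  assumes A: "spd_map A"
  shows "wnorm A (x - z) \<le> wnorm A (x - y) + wnorm A (y - z)"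
  using wnorm_triangle[OF A, of "x - y" "y - z"] by simp

lemma wnorm_convex_combination:
  assumes A: "spd_map A"
  shows "(wnorm A ((1 - u) *\<^sub>R a + u *\<^sub>R b))\<^sup>2
    = (1 - u) * (wnorm A a)\<^sup>2 + u * (wnorm A b)\<^sup>2 - u * (1 - u) * (wnorm A (a - b))\<^sup>2"
  using spd_sym[OF A, of b a]
  by (simp add: wnorm_power2[OF A] spd_add[OF A] spd_diff[OF A] spd_scaleR[OF A] inner_add_left inner_add_right
      inner_diff_left inner_diff_right inner_commute algebra_simps)

lemma spd_bij:
  assumes A: "spd_map (A :: 'a::euclidean_space \<Rightarrow> 'a)" shows "bij A"
proof -
  have "inj A"
    unfolding linear_injective_0[OF spd_linear[OF A]] using spd_pos[OF A] by fastforce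
  then show ?thesis
    using linear_injective_imp_surjective[OF spd_linear[OF A]] by (simp add: bij_def)
qed

text \<open>The duality between the norms of \<open>A\<close> and \<open>inv A\<close>, needed for the test on subgradients.\<close>

lemma inner_le_dual_wnorm:
  assumes A: "spd_map (A :: 'a::euclidean_space \<Rightarrow> 'a)"
  shows "v \<bullet> x \<le> wnorm (inv A) v * wnorm A x"
proof -
  have v: "A (inv A v) = v"
    using spd_bij[OF A] by (simp add: bij_is_surj surj_f_inv_f)
  have "v \<bullet> x = x \<bullet> A (inv A v)" by (simp add: v inner_commute)
  also have "\<dots> \<le> wnorm A x * wnorm A (inv A v)" by (rule wnorm_Cauchy_Schwarz[OF A])
  also have "wnorm A (inv A v) = wnorm (inv A) v"
    by (simp add: wnorm_def v inner_commute)
  finally show ?thesis by (simp add: mult.commute)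
qed

lemma continuous_on_wnorm:
  assumes A: "spd_map (A :: 'a::euclidean_space \<Rightarrow> 'a)" shows "continuous_on UNIV (wnorm A)"
  unfolding wnorm_def
  by (intro continuous_intros linear_continuous_on linear_conv_bounded_linear[THEN iffD1] spd_linear A)

lemma wnorm_power2_ge_norm:
  assumes A: "spd_map (A :: 'a::euclidean_space \<Rightarrow> 'a)"
  obtains c where "0 < c" "\<And>x. c * (norm x)\<^sup>2 \<le> (wnorm A x)\<^sup>2"
proof -
  have "compact (sphere (0::'a) 1)" "sphere (0::'a) 1 \<noteq> {}" by auto
  from continuous_attains_inf[OF this continuous_on_subset[OF continuous_on_wnorm[OF A] subset_UNIV]]
  obtain z where z: "norm z = 1" "\<And>y. norm y = 1 \<Longrightarrow> wnorm A z \<le> wnorm A y" by auto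
  have "(wnorm A z)\<^sup>2 * (norm x)\<^sup>2 \<le> (wnorm A x)\<^sup>2" for x
  proof (cases "x = 0")
    case False
    have "wnorm A z \<le> wnorm A (inverse (norm x) *\<^sub>R x)" using z False by simp
    then have "wnorm A z * norm x \<le> wnorm A x" using False by (simp add: wnorm_scaleR[OF A] field_simps)
    then show ?thesis
      using A by (metis power_mono power_mult_distrib mult_nonneg_nonneg norm_ge_zero wnorm_nonneg)
  qed simp
  moreover have "0 < (wnorm A z)\<^sup>2" using wnorm_pos[OF A, of z] z(1) by force
  ultimately show ?thesis using that by blast
qed

section \<open>Strongly convex extended-valued functions\<close>

text \<open>Phrased through real upper bounds of the function values, which avoids arithmetic with infinite values.\<close>

definition strongly_convex_wrt ::
  "real \<Rightarrow> ('a::euclidean_space \<Rightarrow> 'a) \<Rightarrow> ('a \<Rightarrow> ereal) \<Rightarrow> bool" where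
  "strongly_convex_wrt \<sigma> A \<Phi> \<longleftrightarrow> (\<forall>a b s t u. \<Phi> a \<le> ereal s \<longrightarrow> \<Phi> b \<le> ereal t \<longrightarrow> 0 \<le> u \<longrightarrow> u \<le> 1 \<longrightarrow>
     \<Phi> ((1 - u) *\<^sub>R a + u *\<^sub>R b)
       \<le> ereal ((1 - u) * s + u * t - \<sigma> / 2 * (u * (1 - u)) * (wnorm A (a - b))\<^sup>2))"

lemma strongly_convexD:
  assumes "strongly_convex_wrt \<sigma> A \<Phi>" "\<Phi> a \<le> ereal s" "\<Phi> b \<le> ereal t" "0 \<le> u" "u \<le> 1"
  shows "\<Phi> ((1 - u) *\<^sub>R a + u *\<^sub>R b)
    \<le> ereal ((1 - u) * s + u * t - \<sigma> / 2 * (u * (1 - u)) * (wnorm A (a - b))\<^sup>2)"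
  using assms unfolding strongly_convex_wrt_def by blast

definition lower_semicont :: "('a::topological_space \<Rightarrow> ereal) \<Rightarrow> bool" where
  "lower_semicont p \<longleftrightarrow> (\<forall>x c. ereal c < p x \<longrightarrow> (\<forall>\<^sub>F y in nhds x. ereal c < p y))"

lemma closed_epi_imp_lower_semicont:
  fixes p :: "'a::euclidean_space \<Rightarrow> ereal"
  assumes "closed (epi p)" shows "lower_semicont p"
  unfolding lower_semicont_def
proof (intro allI impI)
  fix x c assume "ereal c < p x"
  then have "(x, c) \<in> - epi p" by (simp add: epi_def)
  moreover have "open (- epi p)" using assms by (simp add: open_Compl)
  ultimately obtain S T where "open S" "open T" "(x, c) \<in> S \<times> T" "S \<times> T \<subseteq> - epi p"
    unfolding open_prod_def by metis
  then have "open S" "x \<in> S" "\<And>y. y \<in> S \<Longrightarrow> ereal c < p y"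
    by (auto simp: epi_def subset_iff not_le[symmetric])
  then show "\<forall>\<^sub>F y in nhds x. ereal c < p y"
    by (auto simp: eventually_nhds)
qed

lemma proper_closed_imp_lower_semicont: "proper_closed p \<Longrightarrow> lower_semicont p"
  by (simp add: proper_closed_def closed_epi_imp_lower_semicont)

text \<open>If no point were a minimizer, every \<open>x\<close> would have a neighbourhood on which \<open>p\<close> exceeds some \<open>c x\<close> that
  lies above another value of \<open>p\<close>; in a finite subcover the point with the least \<open>c x\<close> gives a contradiction.\<close>

lemma lower_semicont_attains_inf:
  fixes p :: "'a::euclidean_space \<Rightarrow> ereal"
  assumes p: "lower_semicont p" and K: "compact K" "K \<noteq> {}"
  obtains x where "x \<in> K" "\<And>y. y \<in> K \<Longrightarrow> p x \<le> p y"
proof -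
  have "\<exists>x\<in>K. \<forall>y\<in>K. p x \<le> p y"
  proof (rule ccontr)
    assume none: "\<not> ?thesis"
    have "\<exists>y\<in>K. \<exists>c. p y < ereal c \<and> ereal c < p x" if x: "x \<in> K" for x
      using none that by (meson ereal_dense2 not_le)
    then obtain Y c where Y: "\<And>x. x \<in> K \<Longrightarrow> Y x \<in> K \<and> p (Y x) < ereal (c x) \<and> ereal (c x) < p x"
      by metis
    have "\<exists>S. open S \<and> x \<in> S \<and> (\<forall>y\<in>S. ereal (c x) < p y)" if "x \<in> K" for x
      using p Y[OF that] by (auto simp: lower_semicont_def eventually_nhds)
    then obtain N where N: "\<And>x. x \<in> K \<Longrightarrow> open (N x) \<and> x \<in> N x \<and> (\<forall>y\<in>N x. ereal (c x) < p y)"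
      by metis
    have "K \<subseteq> (\<Union>x\<in>K. N x)" "\<And>x. x \<in> K \<Longrightarrow> open (N x)" using N by auto
    then obtain C where C: "C \<subseteq> K" "finite C" "K \<subseteq> (\<Union>x\<in>C. N x)"
      using compactE_image[OF K(1)] by metis
    then have "C \<noteq> {}" using K by auto
    define x where "x = arg_min_on c C"
    have x: "x \<in> C" "\<And>y. y \<in> C \<Longrightarrow> c x \<le> c y"
      unfolding x_def using arg_min_if_finite[OF C(2) \<open>C \<noteq> {}\<close>, of c] C \<open>C \<noteq> {}\<close>
      by (auto simp: arg_min_least)
    then have "Y x \<in> K" using Y C by auto
    then obtain z where "z \<in> C" "Y x \<in> N z" using C by auto
    then have "ereal (c z) < p (Y x)" using N C by auto
    moreover have "p (Y x) < ereal (c x)" using Y x C by auto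
    ultimately have "ereal (c z) < ereal (c x)" by (rule less_trans)
    then show False using x(2)[OF \<open>z \<in> C\<close>] by simp
  qed
  then show ?thesis using that by auto
qed

text \<open>Lower semicontinuity bounds \<open>\<Phi>\<close> below on the unit ball around \<open>x0\<close>; along rays leaving that ball strong
  convexity then pushes \<open>\<Phi>\<close> above \<open>\<Phi> x0\<close> outside a larger ball, so a minimizer over the larger ball is global.\<close>

lemma strongly_convex_attains_min:
  fixes \<Phi> :: "'a::euclidean_space \<Rightarrow> ereal"
  assumes A: "spd_map A" and \<sigma>: "0 < \<sigma>" and sc: "strongly_convex_wrt \<sigma> A \<Phi>"
    and lsc: "lower_semicont \<Phi>" and fin: "\<And>x. \<Phi> x \<noteq> -\<infinity>" and dom: "\<Phi> x0 < \<infinity>"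
  obtains x where "\<And>y. \<Phi> x \<le> \<Phi> y"
proof -
  obtain c where c: "0 < c" "\<And>x. c * (norm x)\<^sup>2 \<le> (wnorm A x)\<^sup>2"
    by (rule wnorm_power2_ge_norm[OF A]) blast
  obtain s where s: "\<Phi> x0 = ereal s" using dom fin[of x0] by (cases "\<Phi> x0") auto
  obtain xm where xm: "xm \<in> cball x0 1" "\<And>y. y \<in> cball x0 1 \<Longrightarrow> \<Phi> xm \<le> \<Phi> y"
    using lower_semicont_attains_inf[OF lsc, of "cball x0 1"] by auto
  have "\<Phi> xm \<le> ereal s" using xm(2)[of x0] s by simp
  then obtain m where m: "\<Phi> xm = ereal m" "m \<le> s" using fin[of xm] by (cases "\<Phi> xm") auto
  \<comment> \<open>radius beyond which strong convexity forces values above \<open>\<Phi> x0\<close>\<close>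
  define R where "R = 1 + 2 * (s - m) / (\<sigma> * c) + 1"
  have R: "1 \<le> R" unfolding R_def using m \<sigma> c by simp
  have far: "\<Phi> x0 \<le> \<Phi> y" if y: "R < dist x0 y" for y
  proof (rule ccontr)
    assume "\<not> ?thesis"
    then have less: "\<Phi> y < ereal s" using s by simp
    define t where "t = dist x0 y"
    have t: "1 < t" "R < t" using y R t_def by auto
    let ?u = "1 / t"
    let ?z = "(1 - ?u) *\<^sub>R x0 + ?u *\<^sub>R y"
    have u: "0 < ?u" "?u \<le> 1" using t by auto
    have "x0 - ?z = ?u *\<^sub>R (x0 - y)" by (simp add: algebra_simps)
    then have "dist x0 ?z = \<bar>?u\<bar> * t" by (simp only: dist_norm norm_scaleR t_def)
    then have "dist x0 ?z = 1" using t by simp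
    then have "ereal m \<le> \<Phi> ?z" using xm(2)[of ?z] m by simp
    also have "\<dots> \<le> ereal ((1 - ?u) * s + ?u * s - \<sigma> / 2 * (?u * (1 - ?u)) * (wnorm A (x0 - y))\<^sup>2)"
      using s less u by (intro strongly_convexD[OF sc]) auto
    finally have "\<sigma> / 2 * (?u * (1 - ?u)) * (wnorm A (x0 - y))\<^sup>2 \<le> s - m"
      by (simp add: algebra_simps)
    moreover have "\<sigma> / 2 * (?u * (1 - ?u)) * (c * t\<^sup>2) \<le> \<sigma> / 2 * (?u * (1 - ?u)) * (wnorm A (x0 - y))\<^sup>2"
      using c(2)[of "x0 - y"] \<sigma> u by (intro mult_left_mono) (auto simp: t_def dist_norm)
    moreover have "\<sigma> / 2 * (?u * (1 - ?u)) * (c * t\<^sup>2) = \<sigma> * c / 2 * (t - 1)"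
      using t by (simp add: field_simps power2_eq_square)
    ultimately have "\<sigma> * c / 2 * (t - 1) \<le> s - m" by linarith
    then have "t - 1 \<le> 2 * (s - m) / (\<sigma> * c)" using \<sigma> c by (simp add: field_simps)
    then show False using t unfolding R_def by simp
  qed
  obtain x where x: "x \<in> cball x0 R" "\<And>y. y \<in> cball x0 R \<Longrightarrow> \<Phi> x \<le> \<Phi> y"
    using lower_semicont_attains_inf[OF lsc, of "cball x0 R"] R by auto
  have "\<Phi> x \<le> \<Phi> y" for y
    using x(2)[of y] x(2)[of x0] far[of y] R by (cases "dist x0 y \<le> R") auto
  then show ?thesis by (rule that)
qed

text \<open>Compare \<open>x\<close> with the points of the segment to \<open>y\<close>, divide by \<open>u\<close> and let \<open>u\<close> tend to zero.\<close>

lemma strongly_convex_min_growth: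
  fixes \<Phi> :: "'a::euclidean_space \<Rightarrow> ereal"
  assumes A: "spd_map A" and sc: "strongly_convex_wrt \<sigma> A \<Phi>" and min: "\<And>y. \<Phi> x \<le> \<Phi> y"
    and c: "\<Phi> x = ereal c" and t: "\<Phi> y \<le> ereal t"
  shows "c + \<sigma> / 2 * (wnorm A (y - x))\<^sup>2 \<le> t"
proof -
  let ?N = "(wnorm A (x - y))\<^sup>2"
  have "c + \<sigma> / 2 * ?N - t \<le> u * (\<sigma> / 2 * ?N)" if u: "0 < u" "u < 1" for u
  proof -
    have "ereal c \<le> \<Phi> ((1 - u) *\<^sub>R x + u *\<^sub>R y)" using min c by metis
    also have "\<dots> \<le> ereal ((1 - u) * c + u * t - \<sigma> / 2 * (u * (1 - u)) * ?N)"
      using c t u by (intro strongly_convexD[OF sc]) auto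
    finally have "c \<le> (1 - u) * c + u * t - (u * (1 - u)) * (\<sigma> / 2 * ?N)"
      by (simp add: mult_ac)
    then have "u * (c + \<sigma> / 2 * ?N - t) \<le> u * (u * (\<sigma> / 2 * ?N))"
      by (simp only: algebra_simps)
    then show ?thesis using u by (simp only: mult_le_cancel_left_pos)
  qed
  then have "\<forall>\<^sub>F u in at_right 0. c + \<sigma> / 2 * ?N - t \<le> u * (\<sigma> / 2 * ?N)"
    by (auto simp: eventually_at_right[of 0 1] intro!: exI[of _ 1])
  moreover have "((\<lambda>u. u * (\<sigma> / 2 * ?N)) \<longlongrightarrow> 0 * (\<sigma> / 2 * ?N)) (at_right 0)"
    by (intro tendsto_intros)
  ultimately have "c + \<sigma> / 2 * ?N - t \<le> 0 * (\<sigma> / 2 * ?N)"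
    by (intro tendsto_lowerbound[of _ _ "at_right 0"]) auto
  then show ?thesis by (simp add: wnorm_commute[OF A, of x y])
qed

text \<open>The Frechet inequality is only local and has an error \<open>e\<close>; on the segment to \<open>y\<close> strong convexity
  carries it to \<open>y\<close> itself, and the errors vanish in the limits \<open>u \<rightarrow> 0\<close> and \<open>e \<rightarrow> 0\<close>.\<close>

lemma strongly_convex_subgradient:
  fixes \<Phi> :: "'a::euclidean_space \<Rightarrow> ereal"
  assumes A: "spd_map A" and sc: "strongly_convex_wrt \<sigma> A \<Phi>" and v: "v \<in> frechet_subdiff \<Phi> x"
    and c: "\<Phi> x = ereal c" and t: "\<Phi> y \<le> ereal t"
  shows "c + v \<bullet> (y - x) + \<sigma> / 2 * (wnorm A (y - x))\<^sup>2 \<le> t"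
proof (cases "y = x")
  case True
  then show ?thesis using c t by simp
next
  case False
  let ?N = "(wnorm A (x - y))\<^sup>2" and ?d = "y - x"
  have key: "v \<bullet> ?d - e * norm ?d + \<sigma> / 2 * ?N - (t - c) \<le> 0" if e: "0 < e" for e
  proof -
    have "\<forall>\<^sub>F z in at x. \<Phi> x + ereal (v \<bullet> (z - x) - e * norm (z - x)) \<le> \<Phi> z"
      using v e by (simp add: frechet_subdiff_def)
    moreover have "filterlim (\<lambda>u. x + u *\<^sub>R ?d) (at x) (at_right 0)"
    proof (rule filterlim_atI)
      show "((\<lambda>u. x + u *\<^sub>R ?d) \<longlongrightarrow> x) (at_right 0)"
        by (auto intro!: tendsto_eq_intros)
      show "\<forall>\<^sub>F u in at_right 0. x + u *\<^sub>R ?d \<noteq> x"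
        using False by (simp add: eventually_at_filter)
    qed
    ultimately have ev: "\<forall>\<^sub>F u in at_right 0. \<Phi> x + ereal (v \<bullet> (u *\<^sub>R ?d) - e * norm (u *\<^sub>R ?d)) \<le> \<Phi> (x + u *\<^sub>R ?d)"
      by (drule_tac eventually_compose_filterlim) auto
    have "\<forall>\<^sub>F u in at_right 0. u < (1::real) \<and> 0 < u"
      by (auto simp: eventually_at_right[of 0 1] intro!: exI[of _ 1])
    with ev have "\<forall>\<^sub>F u in at_right 0. v \<bullet> ?d - e * norm ?d + \<sigma> / 2 * ?N - (t - c) \<le> u * (\<sigma> / 2 * ?N)"
    proof eventually_elim
      case (elim u)
      have "x + u *\<^sub>R ?d = (1 - u) *\<^sub>R x + u *\<^sub>R y" by (simp add: algebra_simps)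
      moreover have "\<Phi> ((1 - u) *\<^sub>R x + u *\<^sub>R y) \<le> ereal ((1 - u) * c + u * t - \<sigma> / 2 * (u * (1 - u)) * ?N)"
        using c t elim by (intro strongly_convexD[OF sc]) auto
      ultimately have "\<Phi> (x + u *\<^sub>R ?d) \<le> ereal ((1 - u) * c + u * t - \<sigma> / 2 * (u * (1 - u)) * ?N)"
        by simp
      with elim(1) have "ereal (c + (v \<bullet> (u *\<^sub>R ?d) - e * norm (u *\<^sub>R ?d)))
          \<le> ereal ((1 - u) * c + u * t - \<sigma> / 2 * (u * (1 - u)) * ?N)"
        unfolding c plus_ereal.simps(1) by (rule order_trans)
      then have "c + (v \<bullet> (u *\<^sub>R ?d) - e * norm (u *\<^sub>R ?d))
          \<le> (1 - u) * c + u * t - (u * (1 - u)) * (\<sigma> / 2 * ?N)"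
        by (simp add: mult_ac)
      moreover have "v \<bullet> (u *\<^sub>R ?d) - e * norm (u *\<^sub>R ?d) = u * (v \<bullet> ?d - e * norm ?d)"
        using elim by (simp only: norm_scaleR inner_scaleR_right) (simp add: right_diff_distrib)
      ultimately have "u * (v \<bullet> ?d - e * norm ?d + \<sigma> / 2 * ?N - (t - c)) \<le> u * (u * (\<sigma> / 2 * ?N))"
        by (simp only: algebra_simps)
      then show ?case using elim by (simp only: mult_le_cancel_left_pos)
    qed
    moreover have "((\<lambda>u. u * (\<sigma> / 2 * ?N)) \<longlongrightarrow> 0 * (\<sigma> / 2 * ?N)) (at_right 0)"
      by (intro tendsto_intros)
    ultimately have "v \<bullet> ?d - e * norm ?d + \<sigma> / 2 * ?N - (t - c) \<le> 0 * (\<sigma> / 2 * ?N)"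
      by (intro tendsto_lowerbound[of _ _ "at_right 0"]) auto
    then show ?thesis by simp
  qed
  have "\<forall>\<^sub>F e in at_right 0. v \<bullet> ?d + \<sigma> / 2 * ?N - (t - c) \<le> e * norm ?d"
    using key by (auto simp: eventually_at_right[of 0 1] algebra_simps intro!: exI[of _ 1])
  moreover have "((\<lambda>e. e * norm ?d) \<longlongrightarrow> 0 * norm ?d) (at_right 0)"
    by (intro tendsto_intros)
  ultimately have "v \<bullet> ?d + \<sigma> / 2 * ?N - (t - c) \<le> 0 * norm ?d"
    by (intro tendsto_lowerbound[of _ _ "at_right 0"]) auto
  then show ?thesis by (simp add: wnorm_commute[OF A, of x y])
qed

section \<open>Minibatch averages of weakly convex models\<close>

lemma weakly_convexD:
  fixes p :: "'a::euclidean_space \<Rightarrow> ereal"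
  assumes p: "weakly_convex t p" and a: "p a \<le> ereal s" and b: "p b \<le> ereal s'" and u: "0 \<le> u" "u \<le> 1"
  shows "p ((1 - u) *\<^sub>R a + u *\<^sub>R b)
    \<le> ereal ((1 - u) * s + u * s' + t / 2 * (u * (1 - u)) * (norm (a - b))\<^sup>2)"
proof -
  let ?z = "(1 - u) *\<^sub>R a + u *\<^sub>R b"
  let ?q = "\<lambda>x. p x + ereal (t / 2 * (norm x)\<^sup>2)"
  let ?v = "(1 - u) * (s + t / 2 * (norm a)\<^sup>2) + u * (s' + t / 2 * (norm b)\<^sup>2)"
  have "(a, s + t / 2 * (norm a)\<^sup>2) \<in> epi ?q" "(b, s' + t / 2 * (norm b)\<^sup>2) \<in> epi ?q"
    using add_right_mono[OF a, of "ereal (t / 2 * (norm a)\<^sup>2)"] add_right_mono[OF b, of "ereal (t / 2 * (norm b)\<^sup>2)"]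
    by (auto simp: epi_def)
  moreover have "convex (epi ?q)"
    using p by (simp add: weakly_convex_def)
  ultimately have "(1 - u) *\<^sub>R (a, s + t / 2 * (norm a)\<^sup>2) + u *\<^sub>R (b, s' + t / 2 * (norm b)\<^sup>2) \<in> epi ?q"
    using u by (intro convexD) auto
  then have "p ?z + ereal (t / 2 * (norm ?z)\<^sup>2) \<le> ereal ?v"
    by (simp add: epi_def)
  then have "p ?z \<le> ereal (?v - t / 2 * (norm ?z)\<^sup>2)"
    by (cases "p ?z") auto
  also have "?v - t / 2 * (norm ?z)\<^sup>2 = (1 - u) * s + u * s'
      + t / 2 * ((1 - u) * (norm a)\<^sup>2 + u * (norm b)\<^sup>2 - (norm ?z)\<^sup>2)"
  proof -
    have "(1 - u) * (s + h * na) + u * (s' + h * nb) - h * nz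
        = (1 - u) * s + u * s' + h * ((1 - u) * na + u * nb - nz)" for h na nb nz :: real
      by (simp add: algebra_simps)
    then show ?thesis .
  qed
  also have "(1 - u) * (norm a)\<^sup>2 + u * (norm b)\<^sup>2 - (norm ?z)\<^sup>2 = u * (1 - u) * (norm (a - b))\<^sup>2"
    using wnorm_convex_combination[OF spd_map_id, of u a b] by simp
  finally show ?thesis by (simp add: mult.assoc)
qed

context
  fixes G :: "nat \<Rightarrow> 'a::euclidean_space \<Rightarrow> real" and r p :: "'a \<Rightarrow> ereal" and m :: nat and t :: real
  assumes wc: "\<And>i. i \<in> {1..m} \<Longrightarrow> weakly_convex t (\<lambda>y. ereal (G i y) + r y)" and m: "1 \<le> m"
    and p: "p = (\<lambda>y. ereal (1 / real m * (\<Sum>i=1..m. G i y)) + r y)"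
begin

lemma average_not_MInfty: "r y \<noteq> -\<infinity>" "p y \<noteq> -\<infinity>"
proof -
  have "ereal (G 1 y) + r y \<noteq> -\<infinity>"
    using wc[of 1] m by (simp add: weakly_convex_def proper_closed_def)
  then show "r y \<noteq> -\<infinity>" by auto
  then show "p y \<noteq> -\<infinity>" by (simp add: p)
qed

lemma average_effdom: "\<exists>y. p y < \<infinity>"
proof -
  obtain y where "ereal (G 1 y) + r y < \<infinity>"
    using wc[of 1] m by (auto simp: weakly_convex_def proper_closed_def effdom_def)
  then have "r y < \<infinity>" by (cases "r y") auto
  then show ?thesis unfolding p by (intro exI[of _ y]) (cases "r y"; auto)
qed

lemma average_weak_convexity:
  assumes a: "p a \<le> ereal s" and b: "p b \<le> ereal s'" and u: "0 \<le> u" "u \<le> 1"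
  shows "p ((1 - u) *\<^sub>R a + u *\<^sub>R b)
    \<le> ereal ((1 - u) * s + u * s' + t / 2 * (u * (1 - u)) * (norm (a - b))\<^sup>2)"
proof -
  define z where "z = (1 - u) *\<^sub>R a + u *\<^sub>R b"
  define k where "k = t / 2 * (u * (1 - u)) * (norm (a - b))\<^sup>2"
  let ?avg = "\<lambda>f. 1 / real m * (\<Sum>i=1..m. f i)"
  have avg_const: "?avg (\<lambda>i. c + f i) = c + ?avg f" for c :: real and f
    using m by (simp add: sum.distrib field_simps)
  obtain ra where ra: "r a = ereal ra" "?avg (\<lambda>i. G i a) + ra \<le> s"
    using a average_not_MInfty(1)[of a] unfolding p by (cases "r a") auto
  obtain rb where rb: "r b = ereal rb" "?avg (\<lambda>i. G i b) + rb \<le> s'"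
    using b average_not_MInfty(1)[of b] unfolding p by (cases "r b") auto
  have le: "ereal (G i z) + r z \<le> ereal ((1 - u) * (G i a + ra) + u * (G i b + rb) + k)" if "i \<in> {1..m}" for i
    using weakly_convexD[OF wc[OF that], of a "G i a + ra" b "G i b + rb" u] u by (simp add: ra rb z_def k_def)
  obtain rz where rz: "r z = ereal rz"
    using le[of 1] m average_not_MInfty(1)[of z] by (cases "r z") auto
  have "?avg (\<lambda>i. G i z) \<le> ?avg (\<lambda>i. ((1 - u) * ra + u * rb + k - rz) + ((1 - u) * G i a + u * G i b))"
  proof (intro mult_left_mono sum_mono)
    fix i assume "i \<in> {1..m}"
    from le[OF this] show "G i z \<le> ((1 - u) * ra + u * rb + k - rz) + ((1 - u) * G i a + u * G i b)"
      by (simp add: rz algebra_simps)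
  qed simp
  also have "\<dots> = ((1 - u) * ra + u * rb + k - rz) + ?avg (\<lambda>i. (1 - u) * G i a + u * G i b)"
    by (rule avg_const)
  also have "?avg (\<lambda>i. (1 - u) * G i a + u * G i b) = (1 - u) * ?avg (\<lambda>i. G i a) + u * ?avg (\<lambda>i. G i b)"
    by (simp add: sum.distrib sum_distrib_left distrib_left mult_ac)
  finally have "?avg (\<lambda>i. G i z) + rz
      \<le> (1 - u) * (?avg (\<lambda>i. G i a) + ra) + u * (?avg (\<lambda>i. G i b) + rb) + k"
    by (simp add: algebra_simps)
  also have "\<dots> \<le> (1 - u) * s + u * s' + k"
    using ra rb u by (intro add_mono mult_left_mono) auto
  finally show ?thesis unfolding z_def[symmetric] k_def[symmetric] by (simp add: p rz)
qed

text \<open>A lower bound \<open>c\<close> of the average is first distributed over the summands, by lowering each of them by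
  the same amount; lower semicontinuity of each summand then preserves the bound nearby.\<close>

lemma average_lower_semicont: "lower_semicont p"
  unfolding lower_semicont_def
proof (intro allI impI)
  fix x c assume c: "ereal c < p x"
  let ?avg = "\<lambda>f. 1 / real m * (\<Sum>i=1..m. f i)"
  have "\<exists>c'. (\<forall>i\<in>{1..m}. ereal (c' i) < ereal (G i x) + r x) \<and> ?avg c' = c"
  proof (cases "r x = \<infinity>")
    case True
    then show ?thesis using m by (intro exI[of _ "\<lambda>_. c"]) auto
  next
    case False
    then obtain rx where rx: "r x = ereal rx"
      using average_not_MInfty(1)[of x] by (cases "r x") auto
    let ?d = "?avg (\<lambda>i. G i x) + rx - c"
    have "0 < ?d" using c by (simp add: p rx)
    moreover have "?avg (\<lambda>i. b + f i) = b + ?avg f" for b :: real and f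
      using m by (simp add: sum.distrib field_simps)
    ultimately show ?thesis
      by (intro exI[of _ "\<lambda>i. (rx - ?d) + G i x"] conjI ballI) (simp_all only: rx, simp_all)
  qed
  then obtain c' where c': "\<And>i. i \<in> {1..m} \<Longrightarrow> ereal (c' i) < ereal (G i x) + r x" "?avg c' = c"
    by blast
  have "\<forall>\<^sub>F y in nhds x. \<forall>i\<in>{1..m}. ereal (c' i) < ereal (G i y) + r y"
  proof (intro eventually_ball_finite ballI)
    fix i assume i: "i \<in> {1..m}"
    have "lower_semicont (\<lambda>y. ereal (G i y) + r y)"
      using wc[OF i] by (simp add: weakly_convex_def proper_closed_imp_lower_semicont)
    then show "\<forall>\<^sub>F y in nhds x. ereal (c' i) < ereal (G i y) + r y"
      using c'(1)[OF i] unfolding lower_semicont_def by blast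
  qed simp
  then show "\<forall>\<^sub>F y in nhds x. ereal c < p y"
  proof eventually_elim
    case (elim y)
    show ?case
    proof (cases "r y = \<infinity>")
      case False
      then obtain ry where ry: "r y = ereal ry"
        using average_not_MInfty(1)[of y] by (cases "r y") auto
      have "(\<Sum>i=1..m. c' i) < (\<Sum>i=1..m. G i y + ry)"
        using elim m by (intro sum_strict_mono) (auto simp: ry)
      then have "?avg c' < ?avg (\<lambda>i. G i y) + ry"
        using m by (simp add: sum.distrib field_simps)
      then show ?thesis unfolding c'(2) by (simp add: p ry)
    qed (simp add: p)
  qed
qed

end

section \<open>Inexact proximal steps\<close>

lemma lower_semicont_add_continuous:
  fixes p :: "'a::topological_space \<Rightarrow> ereal" and h :: "'a \<Rightarrow> real"
  assumes p: "lower_semicont p" and h: "continuous_on UNIV h"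
  shows "lower_semicont (\<lambda>y. p y + ereal (h y))"
  unfolding lower_semicont_def
proof (intro allI impI)
  fix x c assume "ereal c < p x + ereal (h x)"
  then have "ereal (c - h x) < p x" by (cases "p x") auto
  then obtain d where d: "c - h x < d" "ereal d < p x"
    using ereal_dense2 by (metis ereal_less_ereal_Ex less_ereal.simps(1))
  have "(h \<longlongrightarrow> h x) (at x)" using h by (simp add: continuous_on_def)
  then have "(h \<longlongrightarrow> h x) (nhds x)" by (simp add: tendsto_nhds_iff)
  then have "\<forall>\<^sub>F y in nhds x. c - d < h y" using d by (intro order_tendstoD) auto
  moreover have "\<forall>\<^sub>F y in nhds x. ereal d < p y" using p d by (simp add: lower_semicont_def)
  ultimately show "\<forall>\<^sub>F y in nhds x. ereal c < p y + ereal (h y)"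
  proof eventually_elim
    case (elim y)
    then show ?case by (cases "p y") auto
  qed
qed

text \<open>Euclidean weak convexity with modulus \<open>t\<close> is weak convexity with modulus \<open>\<Lambda>\<^sup>2 * t\<close> in the norm of \<open>A\<close>, and the
  quadratic term contributes strong convexity \<open>1 / a\<close> in that norm.\<close>

lemma prox_objective_strongly_convex:
  fixes p :: "'a::euclidean_space \<Rightarrow> ereal"
  assumes A: "spd_map A" and a: "0 < a" and t: "0 \<le> t" and \<tau>: "\<tau> = \<Lambda>\<^sup>2 * t"
    and wc: "\<And>x y s s' u. p x \<le> ereal s \<Longrightarrow> p y \<le> ereal s' \<Longrightarrow> 0 \<le> u \<Longrightarrow> u \<le> 1 \<Longrightarrow>
      p ((1 - u) *\<^sub>R x + u *\<^sub>R y) \<le> ereal ((1 - u) * s + u * s' + t / 2 * (u * (1 - u)) * (norm (x - y))\<^sup>2)"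
    and norm_le: "\<And>v. norm v \<le> \<Lambda> * wnorm A v"
  shows "strongly_convex_wrt ((1 - \<tau> * a) / a) A (prox_objective A a p x)"
  unfolding strongly_convex_wrt_def
proof (intro allI impI)
  fix y z s s' u
  assume y: "prox_objective A a p x y \<le> ereal s" and z: "prox_objective A a p x z \<le> ereal s'"
    and u: "0 \<le> u" "(u::real) \<le> 1"
  let ?h = "\<lambda>y. 1 / (2 * a) * (wnorm A (y - x))\<^sup>2" and ?w = "(1 - u) *\<^sub>R y + u *\<^sub>R z"
  let ?N = "(wnorm A (y - z))\<^sup>2"
  have "p y \<le> ereal (s - ?h y)"
    using y unfolding prox_objective_def by (cases "p y") auto
  moreover have "p z \<le> ereal (s' - ?h z)"
    using z unfolding prox_objective_def by (cases "p z") auto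
  ultimately have "p ?w \<le> ereal ((1 - u) * (s - ?h y) + u * (s' - ?h z) + t / 2 * (u * (1 - u)) * (norm (y - z))\<^sup>2)"
    using u by (rule wc)
  then have "prox_objective A a p x ?w
      \<le> ereal ((1 - u) * (s - ?h y) + u * (s' - ?h z) + t / 2 * (u * (1 - u)) * (norm (y - z))\<^sup>2) + ereal (?h ?w)"
    unfolding prox_objective_def by (rule add_right_mono)
  also have "?h ?w = (1 - u) * ?h y + u * ?h z - 1 / (2 * a) * (u * (1 - u) * ?N)"
  proof -
    have "?w - x = (1 - u) *\<^sub>R (y - x) + u *\<^sub>R (z - x)" by (simp add: algebra_simps)
    then show ?thesis
      by (simp only: wnorm_convex_combination[OF A]) (simp add: right_diff_distrib distrib_left mult_ac)
  qed
  also have "ereal ((1 - u) * (s - ?h y) + u * (s' - ?h z) + t / 2 * (u * (1 - u)) * (norm (y - z))\<^sup>2)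
      + ereal ((1 - u) * ?h y + u * ?h z - 1 / (2 * a) * (u * (1 - u) * ?N))
    = ereal ((1 - u) * s + u * s' + (u * (1 - u) / 2) * (t * (norm (y - z))\<^sup>2) - (u * (1 - u) / 2) * (1 / a * ?N))"
    by (simp add: right_diff_distrib left_diff_distrib diff_divide_distrib mult_ac)
  also have "\<dots> \<le> ereal ((1 - u) * s + u * s' + (u * (1 - u) / 2) * (\<tau> * ?N) - (u * (1 - u) / 2) * (1 / a * ?N))"
  proof -
    have "(norm (y - z))\<^sup>2 \<le> (\<Lambda> * wnorm A (y - z))\<^sup>2"
      using norm_le by (intro power_mono) auto
    then have "t * (norm (y - z))\<^sup>2 \<le> \<tau> * ?N"
      using mult_left_mono[OF _ t] by (fastforce simp: \<tau> power_mult_distrib mult_ac)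
    then show ?thesis
      using u by (simp add: mult_left_mono del: times_divide_eq_left)
  qed
  also have "\<dots> = ereal ((1 - u) * s + u * s' - (1 - \<tau> * a) / a / 2 * (u * (1 - u)) * ?N)"
    using a by (simp add: field_simps)
  finally show "prox_objective A a p x ?w \<le> \<dots>" .
qed

context
  fixes A :: "'a::euclidean_space \<Rightarrow> 'a" and a \<tau> :: real and p :: "'a \<Rightarrow> ereal" and x :: 'a
  assumes A: "spd_map A" and a: "0 < a" and \<tau>a: "\<tau> * a < 1"
    and sc: "strongly_convex_wrt ((1 - \<tau> * a) / a) A (prox_objective A a p x)"
    and lsc: "lower_semicont p" and fin: "\<And>y. p y \<noteq> -\<infinity>" and dom: "\<exists>y. p y < \<infinity>"
begin

lemma prox_minimizes: "prox_objective A a p x (prox A a p x) \<le> prox_objective A a p x y"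
proof -
  let ?\<Phi> = "prox_objective A a p x"
  obtain x0 where x0: "p x0 < \<infinity>" using dom by auto
  have "lower_semicont ?\<Phi>"
    unfolding prox_objective_def[abs_def]
    by (intro lower_semicont_add_continuous lsc continuous_intros continuous_on_compose2[OF continuous_on_wnorm[OF A]]) auto
  moreover have "?\<Phi> y \<noteq> -\<infinity>" for y using fin by (simp add: prox_objective_def)
  moreover have "?\<Phi> x0 < \<infinity>" using x0 by (simp add: prox_objective_def)
  moreover have "0 < (1 - \<tau> * a) / a" using a \<tau>a by simp
  ultimately obtain z where z: "\<And>y. ?\<Phi> z \<le> ?\<Phi> y"
    using strongly_convex_attains_min[OF A _ sc] by metis
  then have "is_arg_min ?\<Phi> (\<lambda>_. True) z"
    by (auto simp: is_arg_min_def not_less)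
  then have "is_arg_min ?\<Phi> (\<lambda>_. True) (prox A a p x)"
    unfolding prox_def arg_min_def by (rule someI)
  then show ?thesis by (auto simp: is_arg_min_def not_less)
qed

lemma prox_value:
  obtains c where "p (prox A a p x) = ereal c"
    "prox_objective A a p x (prox A a p x) = ereal (c + 1 / (2 * a) * (wnorm A (prox A a p x - x))\<^sup>2)"
proof -
  obtain x0 where x0: "p x0 < \<infinity>" using dom by auto
  have "p (prox A a p x) \<noteq> \<infinity>"
    using prox_minimizes[of x0] x0 fin[of x0] unfolding prox_objective_def by (cases "p x0") auto
  then obtain c where "p (prox A a p x) = ereal c" using fin by (cases "p (prox A a p x)") auto
  then show ?thesis by (intro that) (auto simp: prox_objective_def)
qed

lemma prox_three_point:
  assumes c: "p (prox A a p x) = ereal c" and q: "p y = ereal q"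
  shows "(1 - \<tau> * a) * (wnorm A (y - prox A a p x))\<^sup>2
    \<le> (wnorm A (y - x))\<^sup>2 - (wnorm A (prox A a p x - x))\<^sup>2 + 2 * a * (q - c)"
proof -
  let ?w = "prox A a p x"
  have "(c + 1 / (2 * a) * (wnorm A (?w - x))\<^sup>2) + (1 - \<tau> * a) / a / 2 * (wnorm A (y - ?w))\<^sup>2
      \<le> q + 1 / (2 * a) * (wnorm A (y - x))\<^sup>2"
    by (rule strongly_convex_min_growth[OF A sc prox_minimizes]) (simp_all add: prox_objective_def c q)
  then have "2 * a * ((c + 1 / (2 * a) * (wnorm A (?w - x))\<^sup>2) + (1 - \<tau> * a) / a / 2 * (wnorm A (y - ?w))\<^sup>2)
      \<le> 2 * a * (q + 1 / (2 * a) * (wnorm A (y - x))\<^sup>2)"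
    using a by (intro mult_left_mono) auto
  moreover have "2 * a * ((c + 1 / (2 * a) * (wnorm A (?w - x))\<^sup>2) + (1 - \<tau> * a) / a / 2 * (wnorm A (y - ?w))\<^sup>2)
      = 2 * a * c + (wnorm A (?w - x))\<^sup>2 + (1 - \<tau> * a) * (wnorm A (y - ?w))\<^sup>2"
    using a by (simp add: distrib_left)
  moreover have "2 * a * (q + 1 / (2 * a) * (wnorm A (y - x))\<^sup>2) = 2 * a * q + (wnorm A (y - x))\<^sup>2"
    using a by (simp add: distrib_left)
  ultimately show ?thesis by (simp add: right_diff_distrib)
qed

text \<open>For the test on function values the reason is quadratic growth at the exact proximal point \<open>w\<close>. For the test on
  subgradients, growth at \<open>w\<close> and the subgradient inequality at \<open>x'\<close> add up to strong monotonicity: the modulus times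
  the squared distance is at most the pairing of the subgradient with \<open>x' - w\<close>, hence at most the product of dual norms.
  The distance to the subdifferential need not be attained, which is the reason for the slack \<open>d\<close> in the proof.\<close>

lemma inexact_prox_step_close:
  assumes step: "inexact_prox_step A a e \<tau> p x x'" and e: "0 \<le> e"
  shows "wnorm A (x' - prox A a p x) \<le> e"
proof -
  let ?\<Phi> = "prox_objective A a p x" and ?w = "prox A a p x" and ?\<sigma> = "(1 - \<tau> * a) / a"
  have \<sigma>: "0 < ?\<sigma>" using a \<tau>a by simp
  obtain c where c: "?\<Phi> ?w = ereal c" by (rule prox_value)
  have INF: "(INF y. ?\<Phi> y) = ereal c"
    unfolding c[symmetric] by (intro antisym INF_lower INF_greatest prox_minimizes) auto
  from step consider "wnorm A (x' - ?w) \<le> e"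
    | "?\<Phi> x' - ereal c \<le> ereal ((1 - \<tau> * a) / (2 * a) * e\<^sup>2)"
    | "wdist (inv A) 0 (frechet_subdiff ?\<Phi> x') \<le> ereal (?\<sigma> * e)"
    unfolding inexact_prox_step_def Let_def INF by auto
  then show ?thesis
  proof cases
    case 2
    then obtain t where t: "?\<Phi> x' = ereal t"
      using fin[of x'] by (cases "?\<Phi> x'") (auto simp: prox_objective_def)
    have "c + ?\<sigma> / 2 * (wnorm A (x' - ?w))\<^sup>2 \<le> t"
      by (rule strongly_convex_min_growth[OF A sc prox_minimizes c]) (simp add: t)
    then have "?\<sigma> / 2 * (wnorm A (x' - ?w))\<^sup>2 \<le> ?\<sigma> / 2 * e\<^sup>2"
      using 2 by (simp add: t)
    then have "(wnorm A (x' - ?w))\<^sup>2 \<le> e\<^sup>2" using \<sigma> by (simp only: mult_le_cancel_left_pos half_gt_zero)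
    then show ?thesis using e by (rule power2_le_imp_le)
  next
    case 3
    let ?n = "wnorm A (x' - ?w)"
    show ?thesis
    proof (rule field_le_epsilon)
      fix d :: real assume d: "0 < d"
      have "wdist (inv A) 0 (frechet_subdiff ?\<Phi> x') < ereal (?\<sigma> * (e + d))"
        using 3
      proof (rule le_less_trans)
        show "ereal (?\<sigma> * e) < ereal (?\<sigma> * (e + d))"
          unfolding less_ereal.simps by (rule mult_strict_left_mono[OF _ \<sigma>]) (use d in simp)
      qed
      then obtain v where v: "v \<in> frechet_subdiff ?\<Phi> x'" "wnorm (inv A) (0 - v) < ?\<sigma> * (e + d)"
        unfolding wdist_def INF_less_iff by auto
      obtain t where t: "?\<Phi> x' = ereal t"
        using v(1) by (cases "?\<Phi> x'") (auto simp: frechet_subdiff_def)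
      have "c + ?\<sigma> / 2 * ?n\<^sup>2 \<le> t"
        by (rule strongly_convex_min_growth[OF A sc prox_minimizes c]) (simp add: t)
      moreover have "t + v \<bullet> (?w - x') + ?\<sigma> / 2 * (wnorm A (?w - x'))\<^sup>2 \<le> c"
        by (rule strongly_convex_subgradient[OF A sc v(1) t]) (simp add: c)
      ultimately have "?\<sigma> * ?n\<^sup>2 \<le> (0 - v) \<bullet> (?w - x')"
        by (simp add: wnorm_commute[OF A, of ?w x'])
      also have "\<dots> \<le> wnorm (inv A) (0 - v) * wnorm A (?w - x')"
        by (rule inner_le_dual_wnorm[OF A])
      also have "\<dots> \<le> ?\<sigma> * (e + d) * ?n"
        unfolding wnorm_commute[OF A, of ?w x'] using v(2) A by (intro mult_right_mono) auto
      finally have *: "?\<sigma> * (?n * ?n) \<le> ?\<sigma> * ((e + d) * ?n)"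
        by (simp only: power2_eq_square mult.assoc)
      have "?n * ?n \<le> (e + d) * ?n" using * \<sigma> by (simp only: mult_le_cancel_left_pos)
      then show "?n \<le> e + d"
        using e d wnorm_nonneg[OF A, of "x' - ?w"] by (cases "?n = 0") auto
    qed
  qed
qed

end

section \<open>Lipschitz continuity of the sample losses\<close>

text \<open>Applied to \<open>n\<close> equal pieces of the segment, the linear terms add up to the same total while the quadratic
  terms add up to only \<open>1 / n\<close> of theirs.\<close>

lemma lipschitz_from_quadratic_error:
  fixes h :: "'a::euclidean_space \<Rightarrow> real"
  assumes U: "convex U" and xy: "x \<in> U" "y \<in> U"
    and h: "\<And>x y. x \<in> U \<Longrightarrow> y \<in> U \<Longrightarrow> \<bar>h x - h y\<bar> \<le> l * norm (x - y) + e * (norm (x - y))\<^sup>2"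
  shows "\<bar>h x - h y\<bar> \<le> l * norm (x - y)"
proof -
  let ?D = "norm (x - y)"
  have bound: "\<bar>h x - h y\<bar> \<le> l * ?D + e * ?D\<^sup>2 * inverse (real (Suc n))" for n
  proof -
    let ?N = "real (Suc n)"
    define z where "z i = x + (real i / ?N) *\<^sub>R (y - x)" for i
    have zU: "z i \<in> U" if "i \<le> Suc n" for i
    proof -
      have "(1 - real i / ?N) *\<^sub>R x + (real i / ?N) *\<^sub>R y \<in> U"
        using that by (intro convexD[OF U] xy) auto
      then show ?thesis by (simp add: z_def algebra_simps)
    qed
    have dz: "norm (z (Suc i) - z i) = ?D / ?N" for i
    proof -
      have "z (Suc i) - z i = (1 / ?N) *\<^sub>R (y - x)"
        by (simp add: z_def scaleR_left_diff_distrib[symmetric] diff_divide_distrib[symmetric])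
      then show ?thesis by (simp add: norm_minus_commute)
    qed
    have z0: "z 0 = x" "z (Suc n) = y" by (simp_all add: z_def)
    have "\<bar>h x - h y\<bar> = \<bar>\<Sum>i<Suc n. h (z (Suc i)) - h (z i)\<bar>"
      by (subst sum_lessThan_telescope) (simp add: z0 abs_minus_commute)
    also have "\<dots> \<le> (\<Sum>i<Suc n. \<bar>h (z (Suc i)) - h (z i)\<bar>)" by (rule sum_abs)
    also have "\<dots> \<le> (\<Sum>i<Suc n. l * (?D / ?N) + e * (?D / ?N)\<^sup>2)"
    proof (rule sum_mono)
      fix i assume "i \<in> {..<Suc n}"
      then show "\<bar>h (z (Suc i)) - h (z i)\<bar> \<le> l * (?D / ?N) + e * (?D / ?N)\<^sup>2"
        using h[OF zU zU, of "Suc i" i] unfolding dz by simp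
    qed
    also have "\<dots> = ?N * (l * (?D / ?N) + e * (?D / ?N)\<^sup>2)" by simp
    also have "\<dots> = l * ?D + e * ?D\<^sup>2 * inverse ?N"
    proof -
      have "N * (l * (D / N) + e * (D / N)\<^sup>2) = l * D + e * D\<^sup>2 * inverse N" if "N \<noteq> 0" for N D :: real
        using that by (simp add: field_simps power2_eq_square)
      then show ?thesis by simp
    qed
    finally show ?thesis .
  qed
  have "(\<lambda>n. l * ?D + e * ?D\<^sup>2 * inverse (real (Suc n))) \<longlonglongrightarrow> l * ?D + e * ?D\<^sup>2 * 0"
    by (intro tendsto_intros LIMSEQ_inverse_real_of_nat)
  then have "\<bar>h x - h y\<bar> \<le> l * ?D + e * ?D\<^sup>2 * 0"
    by (rule LIMSEQ_le_const) (use bound in auto)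
  then show ?thesis by simp
qed

section \<open>Distance to the solution set in the preconditioned norm\<close>

text \<open>The real-valued counterpart of \<^const>\<open>wdist\<close>, for nonempty sets.\<close>

definition wdist_real :: "('a::euclidean_space \<Rightarrow> 'a) \<Rightarrow> 'a \<Rightarrow> 'a set \<Rightarrow> real" where
  "wdist_real A x X = (INF y\<in>X. wnorm A (x - y))"

context
  fixes A :: "'a::euclidean_space \<Rightarrow> 'a" and X :: "'a set"
  assumes A: "spd_map A" and X: "X \<noteq> {}"
begin

lemma wdist_real_bdd: "bdd_below ((\<lambda>y. wnorm A (x - y)) ` X)"
  using A by (intro bdd_belowI[of _ 0]) auto

lemma wdist_real_nonneg: "0 \<le> wdist_real A x X"
  unfolding wdist_real_def using A X by (intro cINF_greatest) auto

lemma wdist_real_le: "y \<in> X \<Longrightarrow> wdist_real A x X \<le> wnorm A (x - y)"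
  unfolding wdist_real_def by (intro cINF_lower wdist_real_bdd)

lemma wdist_real_approx:
  assumes "0 < d" obtains y where "y \<in> X" "wnorm A (x - y) < wdist_real A x X + d"
proof -
  have "(INF y\<in>X. wnorm A (x - y)) < wdist_real A x X + d"
    using assms by (simp add: wdist_real_def)
  then show ?thesis
    using that by (subst (asm) cINF_less_iff[OF X wdist_real_bdd]) auto
qed

lemma wdist_real_triangle: "wdist_real A x X \<le> wdist_real A y X + wnorm A (x - y)"
proof -
  have "wdist_real A x X - wnorm A (x - y) \<le> wnorm A (y - z)" if "z \<in> X" for z
    using wdist_real_le[OF that, of x] wnorm_triangle_diff[OF A, of x z y] by linarith
  then have "wdist_real A x X - wnorm A (x - y) \<le> wdist_real A y X"
    unfolding wdist_real_def[of A y] using X by (intro cINF_greatest) auto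
  then show ?thesis by simp
qed

lemma wdist_real_le_infdist:
  assumes "0 < \<mu>" "\<And>v. \<mu> * wnorm A v \<le> norm v"
  shows "\<mu> * wdist_real A x X \<le> infdist x X"
proof -
  have "\<mu> * wdist_real A x X \<le> dist x y" if "y \<in> X" for y
  proof -
    have "\<mu> * wdist_real A x X \<le> \<mu> * wnorm A (x - y)"
      using wdist_real_le[OF that, of x] assms by (intro mult_left_mono) auto
    also have "\<dots> \<le> dist x y" using assms by (simp add: dist_norm)
    finally show ?thesis .
  qed
  then show ?thesis unfolding infdist_def using X by (auto intro: cINF_greatest)
qed

lemma infdist_le_wdist_real:
  assumes "0 < l" "\<And>v. norm v \<le> l * wnorm A v"
  shows "infdist x X \<le> l * wdist_real A x X"
proof -
  have "infdist x X / l \<le> wnorm A (x - y)" if "y \<in> X" for y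
    using infdist_le[OF that, of x] assms(2)[of "x - y"] assms(1) by (simp add: dist_norm field_simps)
  then have "infdist x X / l \<le> wdist_real A x X"
    unfolding wdist_real_def using X by (intro cINF_greatest) auto
  then show ?thesis using assms(1) by (simp add: field_simps)
qed

end

lemma wdist_real_id: "X \<noteq> {} \<Longrightarrow> wdist_real id x X = infdist x X"
  by (simp add: wdist_real_def infdist_def dist_norm)

section \<open>Descent along one realization\<close>

lemma real_average_bound:
  fixes a b :: "nat \<Rightarrow> real"
  assumes "\<And>i. i \<in> {1..m} \<Longrightarrow> a i \<le> b i"
  shows "1 / real m * (\<Sum>i=1..m. a i) \<le> 1 / real m * (\<Sum>i=1..m. b i)"
  using assms by (intro mult_left_mono sum_mono) auto

text \<open>Here \<open>h\<close> is the sample loss, \<open>F\<close> its mean and \<open>w\<close> the exact proximal point. The model value at \<open>w\<close> is bounded below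
  through \<open>x\<close>, where the model is exact, and the loss at \<open>x\<close> through a nearby point \<open>z\<close>; later \<open>y\<close> and \<open>z\<close> are
  finitely valued and determined before the minibatch is drawn, so that the loss differences on the right have mean zero. The terms
  linear in the length of the step to \<open>w\<close> are absorbed by the squared step length in the three-point inequality.\<close>

lemma model_step_descent:
  fixes A :: "'a::euclidean_space \<Rightarrow> 'a" and x y z :: 'a and r :: "'a \<Rightarrow> ereal"
    and g h :: "'a \<Rightarrow> 'i \<Rightarrow> real" and S :: "nat \<Rightarrow> 'i" and l :: "'i \<Rightarrow> real" and m :: nat and a :: real and F :: "'a \<Rightarrow> real"
  assumes p: "p = (\<lambda>y. ereal (1 / real m * (\<Sum>i=1..m. g y (S i))) + r y)"
    and w_def: "w = prox A a p x"
    and lb_def: "lb = 1 / real m * (\<Sum>i=1..m. l (S i))"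
    and hb_def: "hb = (\<lambda>y. 1 / real m * (\<Sum>i=1..m. h y (S i)))"
    and A: "spd_map A" and a: "0 < a" and \<tau>a: "\<tau> * a < 1" and m: "1 \<le> m"
    and t: "0 \<le> t" and \<tau>: "\<tau> = \<Lambda>\<^sup>2 * t" and \<eta>: "\<eta> = \<Lambda>\<^sup>2 * n" and n: "0 \<le> n" and \<mu>: "0 < \<mu>" "\<mu>\<^sup>2 * c = c1" "0 \<le> c"
    and norm_le: "\<And>v. norm v \<le> \<Lambda> * wnorm A v" "\<And>v. \<mu> * wnorm A v \<le> norm v" and \<Lambda>: "0 < \<Lambda>"
    and wc: "\<And>i. i \<in> {1..m} \<Longrightarrow> weakly_convex t (\<lambda>y. ereal (g y (S i)) + r y)"
    and acc: "\<And>i. i \<in> {1..m} \<Longrightarrow> g x (S i) = h x (S i)"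
      "\<And>i. i \<in> {1..m} \<Longrightarrow> g y (S i) \<le> h y (S i) + n / 2 * (norm (y - x))\<^sup>2"
    and lip: "\<And>i. i \<in> {1..m} \<Longrightarrow> g x (S i) - g w (S i) \<le> l (S i) * norm (x - w)"
      "\<And>i. i \<in> {1..m} \<Longrightarrow> h z (S i) - h x (S i) \<le> l (S i) * norm (z - x)"
      "F w - F x \<le> \<kappa> * norm (w - x)" "F x - F z \<le> \<kappa> * norm (z - x)"
    and l: "\<And>i. i \<in> {1..m} \<Longrightarrow> 0 \<le> l (S i)" "0 \<le> \<kappa>" and z: "norm (z - x) \<le> \<epsilon>"
    and X: "y \<in> X" and ry: "r y \<noteq> \<infinity>"
    and growth: "ereal (F y) + r y + ereal (c * (infdist w X)\<^sup>2) \<le> ereal (F w) + r w"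
  shows "(1 + (2 * c1 - \<tau>) * a) * (wdist_real A w X)\<^sup>2
    \<le> (1 + \<eta> * a) * (wnorm A (y - x))\<^sup>2 + a\<^sup>2 * (\<Lambda> * (lb + \<kappa>))\<^sup>2
      + 2 * a * ((hb y - F y) - (hb z - F z) + \<epsilon> * (lb + \<kappa>))"
proof -
  have X0: "X \<noteq> {}" using X by auto
  note av = wc m p
  have sc: "strongly_convex_wrt ((1 - \<tau> * a) / a) A (prox_objective A a p x)"
    by (rule prox_objective_strongly_convex[OF A a t \<tau> average_weak_convexity[OF av] norm_le(1)])
  note prox = A a \<tau>a sc average_lower_semicont[OF av] average_not_MInfty(2)[OF av] average_effdom[OF av]
  obtain cw where cw: "p w = ereal cw" unfolding w_def by (rule prox_value[OF prox])
  have not_MInf: "r v \<noteq> -\<infinity>" for v by (rule average_not_MInfty(1)[OF av])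
  obtain ry where ry: "r y = ereal ry" using ry not_MInf[of y] by (cases "r y") auto
  obtain rw where rw: "r w = ereal rw" using cw not_MInf[of w] unfolding p by (cases "r w") auto
  let ?gb = "\<lambda>v. 1 / real m * (\<Sum>i=1..m. g v (S i))"
  have cw': "cw = ?gb w + rw" using cw unfolding p by (simp add: rw)
  let ?q = "?gb y + ry"
  have q: "p y = ereal ?q" unfolding p by (simp add: ry)
  let ?wx = "wnorm A (w - x)" and ?yx = "wnorm A (y - x)"
  have three: "(1 - \<tau> * a) * (wnorm A (y - w))\<^sup>2 \<le> ?yx\<^sup>2 - ?wx\<^sup>2 + 2 * a * (?q - cw)"
    using prox_three_point[OF prox cw[unfolded w_def] q] unfolding w_def .
  have avg_add: "1 / real m * (\<Sum>i=1..m. u i + k) = 1 / real m * (\<Sum>i=1..m. u i) + k" for u k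
    using m by (simp add: sum.distrib field_simps)
  have avg_add_mult: "1 / real m * (\<Sum>i=1..m. u i + l (S i) * k) = 1 / real m * (\<Sum>i=1..m. u i) + lb * k" for u k
    by (simp add: sum.distrib lb_def sum_distrib_right distrib_left)
  have lb0: "0 \<le> lb" unfolding lb_def using l by (intro mult_nonneg_nonneg sum_nonneg) auto
  have gy: "?gb y \<le> hb y + n / 2 * (norm (y - x))\<^sup>2"
    unfolding hb_def avg_add[symmetric] by (intro real_average_bound acc)
  have "?gb x \<le> 1 / real m * (\<Sum>i=1..m. g w (S i) + l (S i) * norm (x - w))"
    by (intro real_average_bound) (use lip(1) in fastforce)
  then have gx: "?gb x \<le> ?gb w + lb * norm (w - x)" unfolding avg_add_mult by (simp add: norm_minus_commute)
  have "hb z \<le> 1 / real m * (\<Sum>i=1..m. h x (S i) + l (S i) * norm (z - x))"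
    unfolding hb_def by (intro real_average_bound) (use lip(2) in fastforce)
  also have "\<dots> = ?gb x + lb * norm (z - x)"
    unfolding avg_add_mult using acc(1) by simp
  also have "\<dots> \<le> ?gb x + lb * \<epsilon>" using lb0 z by (intro add_left_mono mult_left_mono)
  finally have hz: "hb z \<le> ?gb x + lb * \<epsilon>" .
  have Fz: "F x - F z \<le> \<kappa> * \<epsilon>"
    using lip(4) mult_left_mono[OF z l(2)] by linarith
  have gr: "F y + ry + c * (infdist w X)\<^sup>2 \<le> F w + rw" using growth by (simp add: ry rw)
  have "?q - cw \<le> (hb y - F y) - (hb z - F z) + \<epsilon> * (lb + \<kappa>) + n / 2 * (norm (y - x))\<^sup>2
      + (lb + \<kappa>) * norm (w - x) - c * (infdist w X)\<^sup>2"
    using gy gx hz Fz gr lip(3) unfolding cw' by (simp add: algebra_simps)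
  moreover have "n * (norm (y - x))\<^sup>2 \<le> \<eta> * ?yx\<^sup>2"
  proof -
    have "(norm (y - x))\<^sup>2 \<le> (\<Lambda> * ?yx)\<^sup>2" using norm_le(1) by (intro power_mono) auto
    from mult_left_mono[OF this n] show ?thesis by (simp add: \<eta> power_mult_distrib mult_ac)
  qed
  moreover have "(lb + \<kappa>) * norm (w - x) \<le> (lb + \<kappa>) * (\<Lambda> * ?wx)"
    using norm_le(1) lb0 l by (intro mult_left_mono) auto
  moreover have "c1 * (wdist_real A w X)\<^sup>2 \<le> c * (infdist w X)\<^sup>2"
  proof -
    have "(\<mu> * wdist_real A w X)\<^sup>2 \<le> (infdist w X)\<^sup>2"
      using wdist_real_le_infdist[OF A X0 \<mu>(1) norm_le(2)] wdist_real_nonneg[OF A X0] \<mu> by (intro power_mono) auto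
    from mult_left_mono[OF this \<mu>(3)] show ?thesis by (simp add: \<mu>(2)[symmetric] power_mult_distrib mult_ac)
  qed
  ultimately have "?q - cw \<le> ((hb y - F y) - (hb z - F z) + \<epsilon> * (lb + \<kappa>)) + \<eta> * ?yx\<^sup>2 / 2
      + (lb + \<kappa>) * (\<Lambda> * ?wx) - c1 * (wdist_real A w X)\<^sup>2"
    (is "_ \<le> ?B + _ + _ - _") by simp
  then have "2 * a * (?q - cw) \<le> 2 * a * (?B + \<eta> * ?yx\<^sup>2 / 2 + (lb + \<kappa>) * (\<Lambda> * ?wx) - c1 * (wdist_real A w X)\<^sup>2)"
    using a by (intro mult_left_mono) auto
  also have "\<dots> = 2 * a * ?B + \<eta> * a * ?yx\<^sup>2 + 2 * (a * (\<Lambda> * (lb + \<kappa>)) * ?wx) - 2 * a * c1 * (wdist_real A w X)\<^sup>2"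
  proof -
    have "2 * a * (b + e * v / 2 + k * (L * u) - d * q) = 2 * a * b + e * a * v + 2 * (a * (L * k) * u) - 2 * a * d * q"
      for b e v k L u d q :: real by (simp add: algebra_simps)
    then show ?thesis .
  qed
  also have "2 * (a * (\<Lambda> * (lb + \<kappa>)) * ?wx) \<le> (a * (\<Lambda> * (lb + \<kappa>)))\<^sup>2 + ?wx\<^sup>2"
    using sum_squares_bound[of "a * (\<Lambda> * (lb + \<kappa>))" ?wx] by (simp add: mult.assoc)
  finally have "2 * a * (?q - cw) \<le> 2 * a * ?B + \<eta> * a * ?yx\<^sup>2 + (a * (\<Lambda> * (lb + \<kappa>)))\<^sup>2 + ?wx\<^sup>2 - 2 * a * c1 * (wdist_real A w X)\<^sup>2"
    by simp
  moreover have "(1 - \<tau> * a) * (wdist_real A w X)\<^sup>2 \<le> (1 - \<tau> * a) * (wnorm A (y - w))\<^sup>2"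
  proof (intro mult_left_mono power_mono)
    show "wdist_real A w X \<le> wnorm A (y - w)"
      using wdist_real_le[OF A X0 X, of w] by (simp add: wnorm_commute[OF A, of y w])
  qed (use \<tau>a wdist_real_nonneg[OF A X0] in auto)
  ultimately have "(1 - \<tau> * a) * (wdist_real A w X)\<^sup>2 + 2 * a * c1 * (wdist_real A w X)\<^sup>2
      \<le> ?yx\<^sup>2 + \<eta> * a * ?yx\<^sup>2 + (a * (\<Lambda> * (lb + \<kappa>)))\<^sup>2 + 2 * a * ?B"
    using three by linarith
  moreover have "(1 + (2 * c1 - \<tau>) * a) * d = (1 - \<tau> * a) * d + 2 * a * c1 * d"
    "(1 + \<eta> * a) * d = d + \<eta> * a * d" for d
    by (simp_all add: algebra_simps)
  ultimately show ?thesis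
    by (simp only: power_mult_distrib[of a "\<Lambda> * (lb + \<kappa>)", symmetric])
qed

section \<open>The sample filtration\<close>

context
  fixes \<Omega> :: "'w measure" and P :: "'s measure" and S :: "nat \<Rightarrow> nat \<Rightarrow> 'w \<Rightarrow> 's" and m :: nat
  assumes prob: "prob_space \<Omega>" and iid: "iid_samples \<Omega> P S m"
begin

interpretation prob_space \<Omega> by (rule prob)

lemma sample_measurable:
  assumes "1 \<le> k" "i \<in> {1..m}" shows "S k i \<in> measurable \<Omega> P"
proof -
  have "indep_vars (\<lambda>_. P) (\<lambda>(k, i). S k i) ({1..} \<times> {1..m})"
    using iid by (simp add: iid_samples_def)
  then have "(\<lambda>(k, i). S k i) (k, i) \<in> measurable \<Omega> P"
    unfolding indep_vars_def2 using assms by blast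
  then show ?thesis by simp
qed

lemma sample_distr: "1 \<le> k \<Longrightarrow> i \<in> {1..m} \<Longrightarrow> distr \<Omega> P (S k i) = P"
  using iid by (simp add: iid_samples_def)

lemma sample_AE:
  assumes "1 \<le> k" "i \<in> {1..m}" "AE s in P. Q s" shows "AE \<omega> in \<Omega>. Q (S k i \<omega>)"
proof (rule AE_distrD[OF sample_measurable[OF assms(1,2)]])
  show "AE s in distr \<Omega> P (S k i). Q s"
    unfolding sample_distr[OF assms(1,2)] by (rule assms(3))
qed

lemma sample_integrable:
  assumes "1 \<le> k" "i \<in> {1..m}" "integrable P (q :: 's \<Rightarrow> real)"
  shows "integrable \<Omega> (\<lambda>\<omega>. q (S k i \<omega>))" and "(LINT \<omega>|\<Omega>. q (S k i \<omega>)) = (LINT s|P. q s)"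
proof -
  have q: "q \<in> borel_measurable P" using assms(3) by simp
  show "integrable \<Omega> (\<lambda>\<omega>. q (S k i \<omega>))"
    using assms integrable_distr_eq[OF sample_measurable[OF assms(1,2)] q] by (simp add: sample_distr)
  show "(LINT \<omega>|\<Omega>. q (S k i \<omega>)) = (LINT s|P. q s)"
    using integral_distr[OF sample_measurable[OF assms(1,2)] q] assms by (simp add: sample_distr)
qed

lemma sample_filtration_generators:
  "{S j i -` A \<inter> space \<Omega> | j i A. j \<in> {1..k} \<and> i \<in> {1..m} \<and> A \<in> sets P} \<subseteq> sets \<Omega>"
  using sample_measurable by (auto intro: measurable_sets)

lemma space_sample_filtration [simp]: "space (sample_filtration \<Omega> P S m k) = space \<Omega>"
  unfolding sample_filtration_def by (rule space_measure_of) auto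

lemma sets_sample_filtration:
  "sets (sample_filtration \<Omega> P S m k) = sigma_sets (space \<Omega>)
     {S j i -` A \<inter> space \<Omega> | j i A. j \<in> {1..k} \<and> i \<in> {1..m} \<and> A \<in> sets P}"
  unfolding sample_filtration_def by (rule sets_measure_of) auto

lemma subalgebra_sample_filtration: "subalgebra \<Omega> (sample_filtration \<Omega> P S m k)"
  unfolding subalgebra_def sets_sample_filtration
  using sets.sigma_sets_subset[OF sample_filtration_generators] by auto

text \<open>Every event of the past is a preimage under the finite family of earlier samples, which is
  independent of the new sample.\<close>

lemma past_independent_of_sample:
  fixes q :: "'s \<Rightarrow> real"
  assumes B: "B \<in> sets (sample_filtration \<Omega> P S m k)" and i: "i \<in> {1..m}" and q: "integrable P q"
  shows "integrable \<Omega> (\<lambda>\<omega>. indicator B \<omega> * q (S (Suc k) i \<omega>))"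
    and "(LINT \<omega>|\<Omega>. indicator B \<omega> * q (S (Suc k) i \<omega>)) = measure \<Omega> B * (LINT s|P. q s)"
proof -
  let ?K = "{1..k} \<times> {1..m}" and ?J = "{(Suc k, i)}"
  let ?Y = "\<lambda>(k, i). S k i"
  define X where "X \<omega> = restrict (\<lambda>a. ?Y a \<omega>) ?K" for \<omega>
  define Z where "Z \<omega> = restrict (\<lambda>a. ?Y a \<omega>) ?J" for \<omega>
  have ind: "indep_var (PiM ?K (\<lambda>_. P)) X (PiM ?J (\<lambda>_. P)) Z"
    unfolding X_def Z_def
    using iid i by (intro indep_var_restrict[where I = "{1..} \<times> {1..m}"]) (auto simp: iid_samples_def)
  then have X: "X \<in> measurable \<Omega> (PiM ?K (\<lambda>_. P))" by (rule indep_var_rv1)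
  let ?V = "vimage_algebra (space \<Omega>) X (PiM ?K (\<lambda>_. P))"
  have XV: "X \<in> measurable ?V (PiM ?K (\<lambda>_. P))"
    using measurable_space[OF X] by (intro measurable_vimage_algebra1) auto
  have "sets (sample_filtration \<Omega> P S m k) \<subseteq> sets ?V"
  proof -
    have "S j l -` A \<inter> space \<Omega> \<in> sets ?V" if "j \<in> {1..k}" "l \<in> {1..m}" "A \<in> sets P" for j l A
    proof -
      have "(\<lambda>\<omega>. X \<omega> (j, l)) \<in> measurable ?V P"
        using that by (intro measurable_compose[OF XV] measurable_component_singleton) auto
      then have "(\<lambda>\<omega>. X \<omega> (j, l)) -` A \<inter> space ?V \<in> sets ?V"
        using that by (intro measurable_sets) auto
      then show ?thesis using that by (simp add: X_def)
    qed
    then have "{S j i -` A \<inter> space \<Omega> | j i A. j \<in> {1..k} \<and> i \<in> {1..m} \<and> A \<in> sets P} \<subseteq> sets ?V"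
      by auto
    from sets.sigma_sets_subset[OF this] show ?thesis unfolding sets_sample_filtration by simp
  qed
  then obtain C where C: "C \<in> sets (PiM ?K (\<lambda>_. P))" "B = X -` C \<inter> space \<Omega>"
    using B sets_vimage_algebra2[of X "space \<Omega>" "PiM ?K (\<lambda>_. P)"] measurable_space[OF X] by auto
  have ind': "indep_var borel ((indicator C :: _ \<Rightarrow> real) \<circ> X) borel ((\<lambda>z. q (z (Suc k, i))) \<circ> Z)"
  proof (rule indep_var_compose[OF ind])
    show "(indicator C :: _ \<Rightarrow> real) \<in> borel_measurable (PiM ?K (\<lambda>_. P))"
      using C by simp
    show "(\<lambda>z. q (z (Suc k, i))) \<in> borel_measurable (PiM ?J (\<lambda>_. P))"
      using q by (intro measurable_compose[OF measurable_component_singleton]) auto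
  qed
  have eq: "indicator B \<omega> * q (S (Suc k) i \<omega>)
      = ((indicator C :: _ \<Rightarrow> real) \<circ> X) \<omega> * ((\<lambda>z. q (z (Suc k, i))) \<circ> Z) \<omega>" if "\<omega> \<in> space \<Omega>" for \<omega>
    using that C by (simp add: Z_def indicator_def)
  have iX: "integrable \<Omega> ((indicator C :: _ \<Rightarrow> real) \<circ> X)"
    using ind' by (intro integrable_const_bound[of _ 1] indep_var_rv1[OF ind']) (auto simp: indicator_def)
  have Zeq: "((\<lambda>z. q (z (Suc k, i))) \<circ> Z) = (\<lambda>\<omega>. q (S (Suc k) i \<omega>))"
    by (auto simp: Z_def)
  have iZ: "integrable \<Omega> ((\<lambda>z. q (z (Suc k, i))) \<circ> Z)"
    unfolding Zeq using i q by (intro sample_integrable) auto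
  show "integrable \<Omega> (\<lambda>\<omega>. indicator B \<omega> * q (S (Suc k) i \<omega>))"
    using indep_var_integrable[OF ind' iX iZ] by (subst Bochner_Integration.integrable_cong[OF refl eq]) auto
  have "(LINT \<omega>|\<Omega>. indicator B \<omega> * q (S (Suc k) i \<omega>))
      = (LINT \<omega>|\<Omega>. ((indicator C :: _ \<Rightarrow> real) \<circ> X) \<omega>) * (LINT \<omega>|\<Omega>. ((\<lambda>z. q (z (Suc k, i))) \<circ> Z) \<omega>)"
    unfolding indep_var_lebesgue_integral[OF ind' iX iZ, symmetric]
    by (rule Bochner_Integration.integral_cong[OF refl eq])
  also have "(LINT \<omega>|\<Omega>. ((indicator C :: _ \<Rightarrow> real) \<circ> X) \<omega>) = (LINT \<omega>|\<Omega>. indicator B \<omega>)"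
    by (rule Bochner_Integration.integral_cong) (auto simp: C indicator_def)
  also have "\<dots> = measure \<Omega> B"
    using B subalgebra_sample_filtration[of k] by (auto simp: subalgebra_def)
  also have "(LINT \<omega>|\<Omega>. ((\<lambda>z. q (z (Suc k, i))) \<circ> Z) \<omega>) = (LINT s|P. q s)"
    unfolding Zeq using i q by (intro sample_integrable) auto
  finally show "(LINT \<omega>|\<Omega>. indicator B \<omega> * q (S (Suc k) i \<omega>)) = measure \<Omega> B * (LINT s|P. q s)" .
qed

lemma samples_uncorrelated:
  fixes q :: "'s \<Rightarrow> real"
  assumes k: "1 \<le> k" and ij: "i \<in> {1..m}" "j \<in> {1..m}" "i \<noteq> j" and q: "integrable P q"
  shows "integrable \<Omega> (\<lambda>\<omega>. q (S k i \<omega>) * q (S k j \<omega>))"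
    and "(LINT \<omega>|\<Omega>. q (S k i \<omega>) * q (S k j \<omega>)) = (LINT s|P. q s)\<^sup>2"
proof -
  let ?Y = "\<lambda>(k, i). S k i"
  have "indep_var (PiM {(k, i)} (\<lambda>_. P)) (\<lambda>\<omega>. restrict (\<lambda>a. ?Y a \<omega>) {(k, i)})
      (PiM {(k, j)} (\<lambda>_. P)) (\<lambda>\<omega>. restrict (\<lambda>a. ?Y a \<omega>) {(k, j)})"
    using iid ij k by (intro indep_var_restrict[where I = "{1..} \<times> {1..m}"]) (auto simp: iid_samples_def)
  then have "indep_var borel ((\<lambda>z. q (z (k, i))) \<circ> (\<lambda>\<omega>. restrict (\<lambda>a. ?Y a \<omega>) {(k, i)}))
      borel ((\<lambda>z. q (z (k, j))) \<circ> (\<lambda>\<omega>. restrict (\<lambda>a. ?Y a \<omega>) {(k, j)}))"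
    by (rule indep_var_compose)
      (use q in \<open>auto intro!: measurable_compose[OF measurable_component_singleton]\<close>)
  then have ind: "indep_var borel (\<lambda>\<omega>. q (S k i \<omega>)) borel (\<lambda>\<omega>. q (S k j \<omega>))"
    by (simp add: comp_def)
  note int = sample_integrable(1)[OF k ij(1) q] sample_integrable(1)[OF k ij(2) q]
  show "integrable \<Omega> (\<lambda>\<omega>. q (S k i \<omega>) * q (S k j \<omega>))"
    by (rule indep_var_integrable[OF ind int])
  show "(LINT \<omega>|\<Omega>. q (S k i \<omega>) * q (S k j \<omega>)) = (LINT s|P. q s)\<^sup>2"
    unfolding indep_var_lebesgue_integral[OF ind int]
    using k ij q by (simp add: sample_integrable power2_eq_square)
qed

text \<open>The \<open>m\<close> diagonal products contribute the second moment, the others the squared mean.\<close>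

lemma minibatch_second_moment:
  fixes q :: "'s \<Rightarrow> real"
  assumes k: "1 \<le> k" and m: "1 \<le> m" and P: "prob_space P" and q: "q \<in> borel_measurable P" "integrable P (\<lambda>s. (q s)\<^sup>2)"
  defines "qb \<equiv> \<lambda>\<omega>. 1 / real m * (\<Sum>i=1..m. q (S k i \<omega>))"
  shows "integrable P q" "integrable \<Omega> qb" "(LINT \<omega>|\<Omega>. qb \<omega>) = (LINT s|P. q s)"
    and "integrable \<Omega> (\<lambda>\<omega>. (qb \<omega>)\<^sup>2)"
    and "(LINT \<omega>|\<Omega>. (qb \<omega>)\<^sup>2) = ((LINT s|P. (q s)\<^sup>2) + (real m - 1) * (LINT s|P. q s)\<^sup>2) / real m"
proof -
  interpret P: prob_space P by (rule P)
  show iq: "integrable P q"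
    by (rule P.square_integrable_imp_integrable[OF q])
  note si = sample_integrable[OF k _ iq]
  show "integrable \<Omega> qb"
    unfolding qb_def by (intro integrable_mult_right Bochner_Integration.integrable_sum si(1))
  have "(LINT \<omega>|\<Omega>. (\<Sum>i=1..m. q (S k i \<omega>))) = (\<Sum>i=1..m. LINT \<omega>|\<Omega>. q (S k i \<omega>))"
    by (intro Bochner_Integration.integral_sum si(1))
  also have "\<dots> = (\<Sum>i=1..m. LINT s|P. q s)"
    by (intro sum.cong refl si(2))
  finally have "(LINT \<omega>|\<Omega>. (\<Sum>i=1..m. q (S k i \<omega>))) = real m * (LINT s|P. q s)" by simp
  then show "(LINT \<omega>|\<Omega>. qb \<omega>) = (LINT s|P. q s)"
    unfolding qb_def integral_mult_right_zero using m by simp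
  have int: "integrable \<Omega> (\<lambda>\<omega>. q (S k i \<omega>) * q (S k j \<omega>))"
    and val: "(LINT \<omega>|\<Omega>. q (S k i \<omega>) * q (S k j \<omega>)) = (if i = j then (LINT s|P. (q s)\<^sup>2) else (LINT s|P. q s)\<^sup>2)"
    if "i \<in> {1..m}" "j \<in> {1..m}" for i j
    using samples_uncorrelated[OF k that _ iq] sample_integrable[OF k that(1) q(2)]
    by (auto simp: power2_eq_square)
  have sq: "(qb \<omega>)\<^sup>2 = 1 / (real m)\<^sup>2 * (\<Sum>i=1..m. \<Sum>j=1..m. q (S k i \<omega>) * q (S k j \<omega>))" for \<omega>
    by (simp add: qb_def power_divide power2_eq_square sum_product)
  show "integrable \<Omega> (\<lambda>\<omega>. (qb \<omega>)\<^sup>2)"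
    unfolding sq by (intro integrable_mult_right Bochner_Integration.integrable_sum int)
  have "(LINT \<omega>|\<Omega>. (qb \<omega>)\<^sup>2) = 1 / (real m)\<^sup>2 * (\<Sum>i=1..m. \<Sum>j=1..m. LINT \<omega>|\<Omega>. q (S k i \<omega>) * q (S k j \<omega>))"
  proof -
    have "(LINT \<omega>|\<Omega>. (\<Sum>i=1..m. \<Sum>j=1..m. q (S k i \<omega>) * q (S k j \<omega>)))
        = (\<Sum>i=1..m. LINT \<omega>|\<Omega>. (\<Sum>j=1..m. q (S k i \<omega>) * q (S k j \<omega>)))"
      by (intro Bochner_Integration.integral_sum Bochner_Integration.integrable_sum int)
    also have "\<dots> = (\<Sum>i=1..m. \<Sum>j=1..m. LINT \<omega>|\<Omega>. q (S k i \<omega>) * q (S k j \<omega>))"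
      by (intro sum.cong refl Bochner_Integration.integral_sum int)
    finally show ?thesis unfolding sq by (simp only: integral_mult_right_zero)
  qed
  also have "(\<Sum>i=1..m. \<Sum>j=1..m. LINT \<omega>|\<Omega>. q (S k i \<omega>) * q (S k j \<omega>))
      = (\<Sum>i=1..m. (LINT s|P. (q s)\<^sup>2) + (real m - 1) * (LINT s|P. q s)\<^sup>2)"
  proof (rule sum.cong[OF refl])
    fix i assume i: "i \<in> {1..m}"
    have "(\<Sum>j=1..m. LINT \<omega>|\<Omega>. q (S k i \<omega>) * q (S k j \<omega>))
        = (LINT s|P. (q s)\<^sup>2) + (\<Sum>j\<in>{1..m}-{i}. (LINT s|P. q s)\<^sup>2)"
      unfolding sum.remove[OF finite_atLeastAtMost i] using i val by (intro arg_cong2[where f = "(+)"] sum.cong) auto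
    also have "(\<Sum>j\<in>{1..m}-{i}. (LINT s|P. q s)\<^sup>2) = (real m - 1) * (LINT s|P. q s)\<^sup>2"
      using i by (simp add: of_nat_diff)
    finally show "(\<Sum>j=1..m. LINT \<omega>|\<Omega>. q (S k i \<omega>) * q (S k j \<omega>))
      = (LINT s|P. (q s)\<^sup>2) + (real m - 1) * (LINT s|P. q s)\<^sup>2" .
  qed
  also have "1 / (real m)\<^sup>2 * (\<Sum>i=1..m. (LINT s|P. (q s)\<^sup>2) + (real m - 1) * (LINT s|P. q s)\<^sup>2)
    = ((LINT s|P. (q s)\<^sup>2) + (real m - 1) * (LINT s|P. q s)\<^sup>2) / real m"
    using m by (simp add: power2_eq_square)
  finally show "(LINT \<omega>|\<Omega>. (qb \<omega>)\<^sup>2) = ((LINT s|P. (q s)\<^sup>2) + (real m - 1) * (LINT s|P. q s)\<^sup>2) / real m" .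
qed

text \<open>The triangle inequality for the \<open>L\<^sup>2\<close> norm: the mean of the constant is at most \<open>B\<close>, and the norm of the minibatch
  average is \<open>B\<close> times the square root in the definition of \<^const>\<open>rho_const\<close>.\<close>

lemma minibatch_lipschitz_moment:
  fixes q :: "'s \<Rightarrow> real"
  assumes k: "1 \<le> k" and m: "1 \<le> m" and P: "prob_space P" and q: "q \<in> borel_measurable P" "integrable P (\<lambda>s. (q s)\<^sup>2)"
    and q0: "\<And>s. s \<in> space P \<Longrightarrow> 0 \<le> q s" and pos: "0 < (LINT s|P. (q s)\<^sup>2)" and B: "sqrt (LINT s|P. (q s)\<^sup>2) \<le> B"
  shows "integrable \<Omega> (\<lambda>\<omega>. (1 / real m * (\<Sum>i=1..m. q (S k i \<omega>)) + (LINT s|P. q s))\<^sup>2)"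
    and "(LINT \<omega>|\<Omega>. (1 / real m * (\<Sum>i=1..m. q (S k i \<omega>)) + (LINT s|P. q s))\<^sup>2) \<le> rho_const P q m * B\<^sup>2"
proof -
  interpret P: prob_space P by (rule P)
  define qb where "qb = (\<lambda>\<omega>. 1 / real m * (\<Sum>i=1..m. q (S k i \<omega>)))"
  let ?E = "LINT s|P. q s" and ?E2 = "LINT s|P. (q s)\<^sup>2"
  note mom = minibatch_second_moment[OF k m P q, folded fun_cong[OF qb_def]]
  let ?V = "LINT \<omega>|\<Omega>. (qb \<omega>)\<^sup>2"
  have sq: "(qb \<omega> + ?E)\<^sup>2 = (qb \<omega>)\<^sup>2 + 2 * ?E * qb \<omega> + ?E\<^sup>2" for \<omega>
    unfolding power2_sum by (simp only: mult_ac add_ac)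
  have i2: "integrable \<Omega> (\<lambda>\<omega>. 2 * ?E * qb \<omega>)" "integrable \<Omega> (\<lambda>\<omega>. ?E\<^sup>2)"
    using mom(2) by auto
  have int: "integrable \<Omega> (\<lambda>\<omega>. (qb \<omega> + ?E)\<^sup>2)"
    unfolding sq by (intro Bochner_Integration.integrable_add mom(4) i2)
  have "(LINT \<omega>|\<Omega>. (qb \<omega> + ?E)\<^sup>2) = ?V + (LINT \<omega>|\<Omega>. 2 * ?E * qb \<omega>) + (LINT \<omega>|\<Omega>. ?E\<^sup>2)"
    unfolding sq by (simp only: Bochner_Integration.integral_add Bochner_Integration.integrable_add mom(4) i2)
  also have "(LINT \<omega>|\<Omega>. 2 * ?E * qb \<omega>) = 2 * ?E * ?E"
    by (simp only: integral_mult_right_zero mom(3))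
  also have "(LINT \<omega>|\<Omega>. ?E\<^sup>2) = ?E\<^sup>2" by (simp add: prob_space)
  finally have val: "(LINT \<omega>|\<Omega>. (qb \<omega> + ?E)\<^sup>2) = ?V + 2 * ?E * ?E + ?E\<^sup>2" .
  have E0: "0 \<le> ?E" using q0 by (intro Bochner_Integration.integral_nonneg) auto
  have var: "(LINT s|P. (q s - ?E)\<^sup>2) = ?E2 - ?E\<^sup>2"
    using P.variance_eq[OF mom(1) q(2)] by simp
  then have var0: "?E\<^sup>2 \<le> ?E2"
    using Bochner_Integration.integral_nonneg[of P "\<lambda>s. (q s - ?E)\<^sup>2"] by simp
  let ?\<theta> = "(1 + (real m - 1) * omega_const P q) / real m"
  have \<theta>: "?V = ?E2 * ?\<theta>"
  proof -
    have "omega_const P q = ?E\<^sup>2 / ?E2"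
      using pos unfolding omega_const_def var by (simp add: field_simps)
    then show ?thesis using pos m unfolding mom(5) by (simp add: field_simps)
  qed
  have V: "?E\<^sup>2 \<le> ?V"
  proof -
    have "real m * ?E\<^sup>2 \<le> ?E2 + (real m - 1) * ?E\<^sup>2" using var0 by (simp add: algebra_simps)
    then show ?thesis using m unfolding mom(5) by (simp add: field_simps)
  qed
  then have V': "?E \<le> sqrt ?V" using E0 by (intro real_le_rsqrt)
  have th0: "0 \<le> ?\<theta>"
    using V zero_le_power2[of ?E] pos unfolding \<theta> by (meson order_trans zero_le_mult_iff not_le)
  have B0: "0 \<le> B" using B pos by (meson order_trans real_sqrt_ge_zero less_imp_le)
  have a: "sqrt ?V \<le> B * sqrt ?\<theta>"
    unfolding \<theta> real_sqrt_mult using B th0 by (intro mult_right_mono) auto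
  have b: "?E \<le> B"
    using var0 E0 B real_le_rsqrt[of ?E ?E2] by linarith
  have "?V + 2 * ?E * ?E + ?E\<^sup>2 \<le> (sqrt ?V)\<^sup>2 + 2 * (sqrt ?V * ?E) + ?E\<^sup>2"
    using V V' E0 mult_right_mono[OF V' E0] by (simp add: order_trans[OF zero_le_power2])
  also have "\<dots> = (sqrt ?V + ?E)\<^sup>2" by (simp add: power2_sum)
  also have "\<dots> \<le> (B * sqrt ?\<theta> + B)\<^sup>2"
    using a b E0 V order_trans[OF zero_le_power2 V] by (intro power_mono add_mono) auto
  also have "\<dots> = rho_const P q m * B\<^sup>2"
    unfolding rho_const_def power_mult_distrib[symmetric] by (simp add: algebra_simps)
  finally have bound: "(LINT \<omega>|\<Omega>. (qb \<omega> + ?E)\<^sup>2) \<le> rho_const P q m * B\<^sup>2"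
    unfolding val .
  show "integrable \<Omega> (\<lambda>\<omega>. (1 / real m * (\<Sum>i=1..m. q (S k i \<omega>)) + (LINT s|P. q s))\<^sup>2)"
    "(LINT \<omega>|\<Omega>. (1 / real m * (\<Sum>i=1..m. q (S k i \<omega>)) + (LINT s|P. q s))\<^sup>2) \<le> rho_const P q m * B\<^sup>2"
    using int bound unfolding qb_def .
qed

end

section \<open>Measurable near-projections\<close>

lemma bounded_finite_net:
  fixes S :: "'a::euclidean_space set"
  assumes "bounded S" "0 < d"
  obtains K where "finite K" "K \<subseteq> S" "\<And>x. x \<in> S \<Longrightarrow> \<exists>y\<in>K. norm (x - y) < d"
proof -
  have "compact (closure S)" using assms by (simp add: compact_closure)
  moreover have "closure S \<subseteq> (\<Union>y\<in>S. ball y d)"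
    using assms(2) by (force simp: closure_approachable)
  ultimately obtain K where "K \<subseteq> S" "finite K" "closure S \<subseteq> (\<Union>y\<in>K. ball y d)"
    by (elim compactE_image) auto
  moreover from this have "\<exists>y\<in>K. norm (x - y) < d" if "x \<in> S" for x
    using that closure_subset[of S] by (fastforce simp: dist_norm norm_minus_commute)
  ultimately show ?thesis using that by blast
qed

context
  fixes G :: "'w measure" and A :: "'w \<Rightarrow> 'a::euclidean_space \<Rightarrow> 'a" and x :: "'w \<Rightarrow> 'a"
  assumes spd: "\<And>\<omega>. \<omega> \<in> space G \<Longrightarrow> spd_map (A \<omega>)"
    and A: "\<And>v. (\<lambda>\<omega>. A \<omega> v) \<in> borel_measurable G" and x: "x \<in> borel_measurable G"
begin

lemma measurable_wnorm: "(\<lambda>\<omega>. wnorm (A \<omega>) (x \<omega> - y)) \<in> borel_measurable G"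
proof -
  have "wnorm (A \<omega>) (x \<omega> - y)
      = sqrt ((x \<omega> - y) \<bullet> (\<Sum>b\<in>Basis. ((x \<omega> - y) \<bullet> b) *\<^sub>R A \<omega> b))" if "\<omega> \<in> space G" for \<omega>
  proof -
    have "A \<omega> (x \<omega> - y) = A \<omega> (\<Sum>b\<in>Basis. ((x \<omega> - y) \<bullet> b) *\<^sub>R b)"
      by (simp only: euclidean_representation)
    also have "\<dots> = (\<Sum>b\<in>Basis. ((x \<omega> - y) \<bullet> b) *\<^sub>R A \<omega> b)"
      using spd[OF that] by (simp add: linear_sum[OF spd_linear] spd_scaleR)
    finally show ?thesis by (simp add: wnorm_def)
  qed
  moreover have "(\<lambda>\<omega>. sqrt ((x \<omega> - y) \<bullet> (\<Sum>b\<in>Basis. ((x \<omega> - y) \<bullet> b) *\<^sub>R A \<omega> b))) \<in> borel_measurable G"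
    using A x by measurable
  ultimately show ?thesis by (simp cong: measurable_cong)
qed

text \<open>The infimum may be taken over a countable dense subset because the norm is continuous.\<close>

lemma measurable_wdist_real:
  assumes X: "X \<noteq> {}"
  shows "(\<lambda>\<omega>. wdist_real (A \<omega>) (x \<omega>) X) \<in> borel_measurable G"
proof -
  obtain T where T: "countable T" "T \<subseteq> X" "X \<subseteq> closure T" by (rule separable)
  then have T0: "T \<noteq> {}" using X by auto
  have "wdist_real (A \<omega>) (x \<omega>) X = (INF y\<in>T. wnorm (A \<omega>) (x \<omega> - y))" if "\<omega> \<in> space G" for \<omega>
  proof (rule antisym)
    note s = spd[OF that]
    show "wdist_real (A \<omega>) (x \<omega>) X \<le> (INF y\<in>T. wnorm (A \<omega>) (x \<omega> - y))"
      using T T0 by (intro cINF_greatest) (auto intro: wdist_real_le[OF s X])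
    show "(INF y\<in>T. wnorm (A \<omega>) (x \<omega> - y)) \<le> wdist_real (A \<omega>) (x \<omega>) X"
      unfolding wdist_real_def
    proof (rule cINF_greatest[OF X])
      fix y assume "y \<in> X"
      then have "y \<in> closure T" using T by auto
      then obtain t where t: "\<And>n. t n \<in> T" "t \<longlonglongrightarrow> y" unfolding closure_sequential by auto
      have "(\<lambda>n. wnorm (A \<omega>) (x \<omega> - t n)) \<longlonglongrightarrow> wnorm (A \<omega>) (x \<omega> - y)"
        by (rule continuous_on_tendsto_compose[OF continuous_on_wnorm[OF s]]) (auto intro!: tendsto_intros t)
      moreover have "(INF y\<in>T. wnorm (A \<omega>) (x \<omega> - y)) \<le> wnorm (A \<omega>) (x \<omega> - t n)" for n
        by (intro cINF_lower wdist_real_bdd[OF s T0] t)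
      ultimately show "(INF y\<in>T. wnorm (A \<omega>) (x \<omega> - y)) \<le> wnorm (A \<omega>) (x \<omega> - y)"
        by (intro LIMSEQ_le_const) auto
    qed
  qed
  moreover have "(\<lambda>\<omega>. INF y\<in>T. wnorm (A \<omega>) (x \<omega> - y)) \<in> borel_measurable G"
    by (intro borel_measurable_cINF_real T measurable_wnorm)
  ultimately show ?thesis by (simp cong: measurable_cong)
qed

text \<open>As long as \<open>x\<close> stays in the bounded set \<open>U\<close>, its near-projections are bounded as well, and finite nets of both sets
  suffice. The index of the first suitable pair is measurable, so no measurable selection theorem is needed.\<close>

lemma finite_near_projection:
  assumes U: "bounded U" and X: "X \<noteq> {}" and d: "0 < d" and \<mu>: "0 < \<mu>" and \<Lambda>: "0 < \<Lambda>"
  obtains n :: nat and z y :: "nat \<Rightarrow> 'a" and J :: "'w \<Rightarrow> nat" where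
    "J \<in> measurable G (count_space UNIV)" "\<forall>j<n. z j \<in> U \<and> y j \<in> X"
    "\<forall>\<omega>\<in>space G. x \<omega> \<in> U \<longrightarrow> (\<forall>v. \<mu> * wnorm (A \<omega>) v \<le> norm v \<and> norm v \<le> \<Lambda> * wnorm (A \<omega>) v)
      \<longrightarrow> J \<omega> < n \<and> norm (z (J \<omega>) - x \<omega>) \<le> d \<and> wnorm (A \<omega>) (x \<omega> - y (J \<omega>)) \<le> wdist_real (A \<omega>) (x \<omega>) X + d"
proof -
  obtain y0 where y0: "y0 \<in> X" using X by auto
  obtain b where b: "\<And>u. u \<in> U \<Longrightarrow> norm u \<le> b" using U by (auto simp: bounded_iff)
  \<comment> \<open>all near-projections of points of \<open>U\<close> have norm at most \<open>R\<close>\<close>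
  define R where "R = b + \<Lambda> * ((b + norm y0) / \<mu> + d)"
  obtain Kz where Kz: "finite Kz" "Kz \<subseteq> U" "\<And>x. x \<in> U \<Longrightarrow> \<exists>y\<in>Kz. norm (x - y) < d"
    using bounded_finite_net[OF U d] by blast
  have "bounded (X \<inter> cball 0 R)" by (intro bounded_Int) simp
  from bounded_finite_net[OF this, of "\<mu> * (d / 2)"] d \<mu>
  obtain Ky where Ky: "finite Ky" "Ky \<subseteq> X \<inter> cball 0 R"
    "\<And>x. x \<in> X \<inter> cball 0 R \<Longrightarrow> \<exists>y\<in>Ky. norm (x - y) < \<mu> * (d / 2)"
    by (metis half_gt_zero mult_pos_pos)
  obtain L where L: "set L = Kz \<times> Ky"
    using finite_list[of "Kz \<times> Ky"] Kz Ky by auto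
  define n where "n = length L"
  define z where "z j = fst (L ! j)" for j
  define y where "y j = snd (L ! j)" for j
  let ?P = "\<lambda>j \<omega>. norm (z j - x \<omega>) \<le> d \<and> wnorm (A \<omega>) (x \<omega> - y j) \<le> wdist_real (A \<omega>) (x \<omega>) X + d"
  define J where "J \<omega> = (LEAST j. n \<le> j \<or> ?P j \<omega>)" for \<omega>
  show ?thesis
  proof (rule that)
    show "J \<in> measurable G (count_space UNIV)"
      unfolding J_def
    proof (rule measurable_Least)
      fix j
      note [measurable] = measurable_wnorm measurable_wdist_real[OF X] x
      show "Measurable.pred G (\<lambda>\<omega>. n \<le> j \<or> ?P j \<omega>)" by measurable
    qed
    have zy: "z j \<in> Kz \<and> y j \<in> Ky" if "j < n" for j
      using that L nth_mem[of j L] unfolding n_def z_def y_def by (cases "L ! j") auto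
    then show "\<forall>j<n. z j \<in> U \<and> y j \<in> X"
      using Kz Ky by blast
    show "\<forall>\<omega>\<in>space G. x \<omega> \<in> U \<longrightarrow> (\<forall>v. \<mu> * wnorm (A \<omega>) v \<le> norm v \<and> norm v \<le> \<Lambda> * wnorm (A \<omega>) v)
      \<longrightarrow> J \<omega> < n \<and> ?P (J \<omega>) \<omega>"
    proof (intro ballI impI)
      fix \<omega> assume \<omega>: "\<omega> \<in> space G" "x \<omega> \<in> U" and v: "\<forall>v. \<mu> * wnorm (A \<omega>) v \<le> norm v \<and> norm v \<le> \<Lambda> * wnorm (A \<omega>) v"
      note s = spd[OF \<omega>(1)]
      let ?N = "wnorm (A \<omega>)"
      obtain z' where z': "z' \<in> Kz" "norm (x \<omega> - z') < d" using Kz(3)[OF \<omega>(2)] by auto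
      obtain q where q: "q \<in> X" "?N (x \<omega> - q) < wdist_real (A \<omega>) (x \<omega>) X + d / 2"
        using wdist_real_approx[OF s X, of "d / 2" "x \<omega>"] d by auto
      have "?N (x \<omega> - y0) \<le> (b + norm y0) / \<mu>"
      proof -
        have "\<mu> * ?N (x \<omega> - y0) \<le> norm (x \<omega> - y0)" using v by blast
        also have "\<dots> \<le> b + norm y0" using b[OF \<omega>(2)] norm_triangle_ineq4[of "x \<omega>" y0] by linarith
        finally show ?thesis using \<mu> by (simp add: field_simps)
      qed
      then have "?N (x \<omega> - q) \<le> (b + norm y0) / \<mu> + d"
        using q wdist_real_le[OF s X y0, of "x \<omega>"] d by linarith
      then have "\<Lambda> * ?N (x \<omega> - q) \<le> \<Lambda> * ((b + norm y0) / \<mu> + d)" using \<Lambda> by (intro mult_left_mono) auto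
      then have "norm (x \<omega> - q) \<le> \<Lambda> * ((b + norm y0) / \<mu> + d)" using spec[OF v, of "x \<omega> - q"] by linarith
      then have "norm q \<le> R"
        using b[OF \<omega>(2)] norm_triangle_sub[of q "x \<omega>"] unfolding R_def by (simp add: norm_minus_commute)
      then obtain y' where y': "y' \<in> Ky" "norm (q - y') < \<mu> * (d / 2)" using Ky(3)[of q] q by auto
      have "\<mu> * ?N (q - y') \<le> \<mu> * (d / 2)" using y' spec[OF v, of "q - y'"] by linarith
      then have "?N (q - y') \<le> d / 2" using \<mu> by simp
      then have N: "?N (x \<omega> - y') \<le> wdist_real (A \<omega>) (x \<omega>) X + d"
        using wnorm_triangle_diff[OF s, of "x \<omega>" y' q] q by linarith
      have "(z', y') \<in> set L" using L z' y' by simp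
      then obtain j where j: "j < n" "L ! j = (z', y')" unfolding n_def by (auto simp: in_set_conv_nth)
      then have Pj: "?P j \<omega>" using z' N by (simp add: z_def y_def norm_minus_commute)
      have "n \<le> J \<omega> \<or> ?P (J \<omega>) \<omega>" unfolding J_def by (rule LeastI[of _ j]) (use Pj in blast)
      moreover have "J \<omega> \<le> j" unfolding J_def by (rule Least_le) (use Pj in blast)
      ultimately show "J \<omega> < n \<and> ?P (J \<omega>) \<omega>" using j by linarith
    qed
  qed
qed

end

section \<open>Change of preconditioner\<close>

lemma integrable_indicator_wnorm:
  fixes C :: "'w \<Rightarrow> 'a::euclidean_space \<Rightarrow> 'a"
  assumes prob: "prob_space \<Omega>" and B: "B \<in> sets \<Omega>" and spd: "\<And>\<omega>. \<omega> \<in> space \<Omega> \<Longrightarrow> spd_map (C \<omega>)"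
    and meas: "\<And>v. (\<lambda>\<omega>. C \<omega> v) \<in> borel_measurable \<Omega>"
    and \<mu>: "0 < \<mu>" and bnd: "AE \<omega> in \<Omega>. \<forall>v. \<mu> * wnorm (C \<omega>) v \<le> norm v"
  shows "integrable \<Omega> (\<lambda>\<omega>. indicator B \<omega> * (wnorm (C \<omega>) v)\<^sup>2)"
proof -
  interpret prob_space \<Omega> by (rule prob)
  show ?thesis
  proof (rule integrable_const_bound[of _ "(norm v / \<mu>)\<^sup>2"])
    show "AE \<omega> in \<Omega>. norm (indicator B \<omega> * (wnorm (C \<omega>) v)\<^sup>2) \<le> (norm v / \<mu>)\<^sup>2"
      using bnd AE_space
    proof eventually_elim
      case (elim \<omega>)
      have "wnorm (C \<omega>) v \<le> norm v / \<mu>" using elim \<mu> by (simp add: field_simps)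
      then have "(wnorm (C \<omega>) v)\<^sup>2 \<le> (norm v / \<mu>)\<^sup>2" using spd[of \<omega>] elim by (intro power_mono) auto
      then show ?case by (auto simp: indicator_def)
    qed
    have [measurable]: "(\<lambda>\<omega>. wnorm (C \<omega>) v) \<in> borel_measurable \<Omega>"
      using measurable_wnorm[of \<Omega> C "\<lambda>_. v" 0] spd meas by simp
    show "(\<lambda>\<omega>. indicator B \<omega> * (wnorm (C \<omega>) v)\<^sup>2) \<in> borel_measurable \<Omega>"
      using B by measurable
  qed
qed

text \<open>The conditional bound on the ratio is multiplied by the squared norm in the old metric, which is known
  in \<open>G\<close> and therefore commutes with the conditional expectation.\<close>

lemma preconditioner_change:
  fixes A A' :: "'w \<Rightarrow> 'a::euclidean_space \<Rightarrow> 'a"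
  assumes prob: "prob_space \<Omega>" and sub: "subalgebra \<Omega> G" and B: "B \<in> sets G"
    and spd: "\<And>\<omega>. \<omega> \<in> space \<Omega> \<Longrightarrow> spd_map (A \<omega>)" "\<And>\<omega>. \<omega> \<in> space \<Omega> \<Longrightarrow> spd_map (A' \<omega>)"
    and meas: "\<And>v. (\<lambda>\<omega>. A \<omega> v) \<in> borel_measurable G" "\<And>v. (\<lambda>\<omega>. A' \<omega> v) \<in> borel_measurable \<Omega>"
    and \<mu>: "0 < \<mu>" and bnd: "AE \<omega> in \<Omega>. \<forall>v. \<mu> * wnorm (A \<omega>) v \<le> norm v" "AE \<omega> in \<Omega>. \<forall>v. \<mu> * wnorm (A' \<omega>) v \<le> norm v"
    and ratio: "v \<noteq> 0 \<Longrightarrow> AE \<omega> in \<Omega>. real_cond_exp \<Omega> G (\<lambda>\<omega>. (wnorm (A' \<omega>) v)\<^sup>2 / (wnorm (A \<omega>) v)\<^sup>2) \<omega> \<le> c"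
  shows "(LINT \<omega>|\<Omega>. indicator B \<omega> * (wnorm (A' \<omega>) v)\<^sup>2) \<le> c * (LINT \<omega>|\<Omega>. indicator B \<omega> * (wnorm (A \<omega>) v)\<^sup>2)"
proof -
  interpret prob_space \<Omega> by (rule prob)
  interpret finite_measure_subalgebra \<Omega> G
    by unfold_locales (rule sub)
  have space: "space G = space \<Omega>" using sub by (simp add: subalgebra_def)
  have meas_A: "(\<lambda>\<omega>. wnorm (A \<omega>) v) \<in> borel_measurable G"
    using measurable_wnorm[of G A "\<lambda>_. v" 0] spd meas by (simp add: space)
  have meas_A': "(\<lambda>\<omega>. wnorm (A' \<omega>) v) \<in> borel_measurable \<Omega>"
    using measurable_wnorm[of \<Omega> A' "\<lambda>_. v" 0] spd meas by simp
  have Bm: "(indicator B :: 'w \<Rightarrow> real) \<in> borel_measurable G" using B by simp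
  have B\<Omega>: "B \<in> sets \<Omega>" using B sub by (auto simp: subalgebra_def)
  note int = integrable_indicator_wnorm[OF prob B\<Omega>]
  have int': "integrable \<Omega> (\<lambda>\<omega>. indicator B \<omega> * (wnorm (A' \<omega>) v)\<^sup>2)"
    by (rule int[OF spd(2) meas(2) \<mu> bnd(2)])
  have intA: "integrable \<Omega> (\<lambda>\<omega>. indicator B \<omega> * (wnorm (A \<omega>) v)\<^sup>2)"
    by (rule int[OF spd(1) measurable_from_subalg[OF sub meas(1)] \<mu> bnd(1)])
  show "(LINT \<omega>|\<Omega>. indicator B \<omega> * (wnorm (A' \<omega>) v)\<^sup>2) \<le> c * (LINT \<omega>|\<Omega>. indicator B \<omega> * (wnorm (A \<omega>) v)\<^sup>2)"
  proof (cases "v = 0")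
    case False
    let ?f = "\<lambda>\<omega>. indicator B \<omega> * (wnorm (A \<omega>) v)\<^sup>2" and ?g = "\<lambda>\<omega>. (wnorm (A' \<omega>) v)\<^sup>2 / (wnorm (A \<omega>) v)\<^sup>2"
    have fg: "?f \<omega> * ?g \<omega> = indicator B \<omega> * (wnorm (A' \<omega>) v)\<^sup>2" if "\<omega> \<in> space \<Omega>" for \<omega>
      using wnorm_pos[OF spd(1)[OF that] False] by simp
    have "integrable \<Omega> (\<lambda>\<omega>. ?f \<omega> * ?g \<omega>)"
      using int' by (subst Bochner_Integration.integrable_cong[OF refl fg]) auto
    moreover have "?f \<in> borel_measurable G" using meas_A Bm by measurable
    moreover have "?g \<in> borel_measurable \<Omega>"
      using meas_A' measurable_from_subalg[OF sub meas_A] by measurable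
    ultimately have ce: "integrable \<Omega> (\<lambda>\<omega>. ?f \<omega> * real_cond_exp \<Omega> G ?g \<omega>)"
      "(LINT \<omega>|\<Omega>. ?f \<omega> * real_cond_exp \<Omega> G ?g \<omega>) = (LINT \<omega>|\<Omega>. ?f \<omega> * ?g \<omega>)"
      by (rule real_cond_exp_intg)+
    have "(LINT \<omega>|\<Omega>. indicator B \<omega> * (wnorm (A' \<omega>) v)\<^sup>2) = (LINT \<omega>|\<Omega>. ?f \<omega> * ?g \<omega>)"
      by (rule Bochner_Integration.integral_cong[OF refl fg[symmetric]])
    also have "\<dots> = (LINT \<omega>|\<Omega>. ?f \<omega> * real_cond_exp \<Omega> G ?g \<omega>)" by (rule ce(2)[symmetric])
    also have "\<dots> \<le> (LINT \<omega>|\<Omega>. c * ?f \<omega>)"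
    proof (rule integral_mono_AE[OF ce(1)])
      show "integrable \<Omega> (\<lambda>\<omega>. c * ?f \<omega>)" using intA by (rule integrable_mult_right)
      show "AE \<omega> in \<Omega>. ?f \<omega> * real_cond_exp \<Omega> G ?g \<omega> \<le> c * ?f \<omega>"
        using ratio[OF False]
      proof eventually_elim
        case (elim \<omega>)
        then have "?f \<omega> * real_cond_exp \<Omega> G ?g \<omega> \<le> ?f \<omega> * c" by (intro mult_left_mono) auto
        then show ?case by (simp only: mult.commute)
      qed
    qed
    also have "\<dots> = c * (LINT \<omega>|\<Omega>. ?f \<omega>)" by simp
    finally show ?thesis .
  qed simp
qed

section \<open>Expected decrease in one iteration\<close>

lemma power2_add_le_weighted:
  fixes a b \<theta> :: real
  assumes "0 < \<theta>" shows "(a + b)\<^sup>2 \<le> (1 + \<theta>) * a\<^sup>2 + (1 + 1 / \<theta>) * b\<^sup>2"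
proof -
  have "0 \<le> (\<theta> * a - b)\<^sup>2 / \<theta>" using assms by simp
  also have "\<dots> = \<theta> * a\<^sup>2 - 2 * a * b + b\<^sup>2 / \<theta>"
    using assms by (simp add: power2_diff power_mult_distrib field_simps power2_eq_square)
  finally show ?thesis by (simp add: power2_sum algebra_simps)
qed

text \<open>The last assumption is the only trace of the stepsize rule in the analysis of a single iteration: it makes the proximal
  objectives strongly convex.\<close>

locale ispPPA_setting =
  fixes \<Omega> :: "'w measure" and P :: "'s measure"
    and f :: "'a::euclidean_space \<Rightarrow> 's \<Rightarrow> ereal" and r :: "'a \<Rightarrow> ereal" and g :: "'a \<Rightarrow> 'a \<Rightarrow> 's \<Rightarrow> real"
    and V U X :: "'a set" and S :: "nat \<Rightarrow> nat \<Rightarrow> 'w \<Rightarrow> 's" and m :: nat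
    and M :: "nat \<Rightarrow> 'w \<Rightarrow> 'a \<Rightarrow> 'a" and x :: "nat \<Rightarrow> 'w \<Rightarrow> 'a" and x1 :: 'a
    and \<alpha> \<epsilon> \<mu> L \<rho> :: "nat \<Rightarrow> real" and \<mu>inf Linf \<nu>inf :: real
    and Lbar :: "'a set \<Rightarrow> 's \<Rightarrow> real" and LFbar :: "'a set \<Rightarrow> real" and \<eta>bar \<tau>bar cbar \<eta> \<tau> c1 :: real
  assumes prob_\<Omega>: "prob_space \<Omega>" and prob_P: "prob_space P"
    and X: "X = argmin_set (total_objective P f r)" and X_nonempty: "X \<noteq> {}"
    and models: "model_functions P V r g"
    and accuracy: "model_accuracy P V f g \<eta>bar"
    and precond: "preconditioner_condition \<Omega> (sample_filtration \<Omega> P S m) M \<mu> L \<rho> \<mu>inf Linf \<nu>inf"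
    and regular: "regularity P V f r g \<tau>bar"
    and lipschitz: "local_lipschitz_models P V g Lbar LFbar"
    and growth: "quadratic_growth (total_objective P f r) cbar"
    and run: "ispPPA_run \<Omega> P S m V g r \<tau> M \<alpha> \<epsilon> x1 x"
    and U: "bounded U" "open U" "convex U" "U \<subseteq> V"
    and U_contains: "AE \<omega> in \<Omega>. \<forall>k\<ge>1. x k \<omega> \<in> U \<and> exact_iterate S m g r M \<alpha> x k \<omega> \<in> U"
    and eta: "\<eta> = Linf\<^sup>2 * \<eta>bar" and tau: "\<tau> = Linf\<^sup>2 * \<tau>bar" and c1: "c1 = \<mu>inf\<^sup>2 * cbar"
    and Lf_pos: "0 < (LINT s|P. (Linf * Lbar U s)\<^sup>2)"
    and step_bound: "\<And>k. 1 \<le> k \<Longrightarrow> (\<eta> + \<tau>) * \<alpha> k < 1"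
begin

sublocale prob_space \<Omega> by (rule prob_\<Omega>)

abbreviation "Fil \<equiv> sample_filtration \<Omega> P S m"

lemma iid: "iid_samples \<Omega> P S m" and m_pos: "1 \<le> m" and step_pos: "1 \<le> k \<Longrightarrow> 0 < \<alpha> k \<and> 0 \<le> \<epsilon> k"
  using run by (auto simp: ispPPA_run_def)

lemma Linf: "1 \<le> Linf" and \<mu>inf: "0 < \<mu>inf" "\<mu>inf \<le> 1"
  using precond by (auto simp: preconditioner_condition_def)

lemma \<tau>bar_nonneg: "0 \<le> \<tau>bar" and cbar_pos: "0 < cbar"
  using regular growth by (auto simp: regularity_def quadratic_growth_def)

lemma M_spd: "\<omega> \<in> space \<Omega> \<Longrightarrow> spd_map (M k \<omega>)"
  using run precond spd_map_id by (cases "k = 0") (auto simp: ispPPA_run_def preconditioner_condition_def)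

lemma M_measurable: "(\<lambda>\<omega>. M k \<omega> v) \<in> borel_measurable (Fil k)"
proof (cases "k = 0")
  case True
  then have "(\<lambda>\<omega>. M k \<omega> v) = (\<lambda>_. v)" using precond by (auto simp: preconditioner_condition_def)
  then show ?thesis by simp
next
  case False
  then show ?thesis using run by (auto simp: ispPPA_run_def)
qed

lemma x_measurable: "1 \<le> k \<Longrightarrow> x k \<in> borel_measurable (Fil (k - 1))"
proof (cases "k = 1")
  case True
  have "x 1 \<omega> = x1" if "\<omega> \<in> space (Fil 0)" for \<omega>
    using that run by (simp add: ispPPA_run_def space_sample_filtration[OF prob_\<Omega> iid])
  then have "x 1 \<in> borel_measurable (Fil 0) \<longleftrightarrow> (\<lambda>_. x1) \<in> borel_measurable (Fil 0)"
    by (rule measurable_cong)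
  then show ?thesis using True by simp
next
  assume "1 \<le> k"
  case False
  then obtain j where "k = Suc j" "1 \<le> j" using \<open>1 \<le> k\<close> by (cases k) auto
  then show ?thesis using run by (auto simp: ispPPA_run_def)
qed

lemma norm_equiv:
  "AE \<omega> in \<Omega>. \<forall>k v. \<mu>inf * wnorm (M k \<omega>) v \<le> norm v \<and> norm v \<le> Linf * wnorm (M k \<omega>) v"
proof -
  have "AE \<omega> in \<Omega>. \<forall>k\<ge>1. \<forall>v. \<mu> k * wnorm (M k \<omega>) v \<le> norm v \<and> norm v \<le> L k * wnorm (M k \<omega>) v"
    using precond by (simp add: preconditioner_condition_def)
  then show ?thesis using AE_space
  proof eventually_elim
    case (elim \<omega>)
    show ?case
    proof (intro allI)
      fix k v
      show "\<mu>inf * wnorm (M k \<omega>) v \<le> norm v \<and> norm v \<le> Linf * wnorm (M k \<omega>) v"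
      proof (cases "k = 0")
        case True
        then have "M k \<omega> = id" using precond by (simp add: preconditioner_condition_def)
        then show ?thesis using Linf \<mu>inf by (simp add: mult_left_le_one_le mult_le_cancel_right1)
      next
        case False
        have "0 \<le> wnorm (M k \<omega>) v" using M_spd elim by simp
        moreover have "\<mu>inf \<le> \<mu> k" "L k \<le> Linf" using precond False by (auto simp: preconditioner_condition_def)
        ultimately have "\<mu>inf * wnorm (M k \<omega>) v \<le> \<mu> k * wnorm (M k \<omega>) v" "L k * wnorm (M k \<omega>) v \<le> Linf * wnorm (M k \<omega>) v"
          by (auto intro: mult_right_mono)
        moreover have "1 \<le> k" using False by simp
        ultimately show ?thesis using elim(1) order_trans by blast
      qed
    qed
  qed
qed

text \<open>On \<open>V\<close> the sample losses are almost surely finite, because they agree with the real-valued models there.\<close>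

definition "h z s = real_of_ereal (f z s)"

abbreviation "F \<equiv> mean_loss P f"

lemma h_integrable: "integrable P (h z)" and F_eq: "F z = (LINT s|P. h z s)"
  using regular by (auto simp: regularity_def finite_mean_def h_def[abs_def] mean_loss_def)

lemma models_good:
  "AE s in P. (\<forall>x\<in>V. \<forall>y\<in>V. g x x s = h x s \<and> \<bar>g x y s - h y s\<bar> \<le> \<eta>bar / 2 * (norm (y - x))\<^sup>2)
     \<and> (\<forall>x\<in>V. weakly_convex \<tau>bar (\<lambda>y. ereal (g x y s) + r y))
     \<and> (\<forall>x\<in>U. \<forall>y\<in>U. \<bar>g x x s - g x y s\<bar> \<le> Lbar U s * norm (x - y))"
proof -
  have "AE s in P. \<forall>x\<in>V. \<forall>y\<in>V. g x x s = h x s \<and> \<bar>g x y s - h y s\<bar> \<le> \<eta>bar / 2 * (norm (y - x))\<^sup>2"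
    using accuracy unfolding model_accuracy_def
  proof eventually_elim
    case (elim s)
    have h: "f y s = ereal (h y s)" "g y y s = h y s" if "y \<in> V" for y
    proof -
      have "ereal (g y y s) = f y s" using elim that by blast
      then show "f y s = ereal (h y s)" "g y y s = h y s" unfolding h_def by (auto simp flip: \<open>_ = f y s\<close>)
    qed
    show ?case
    proof (intro ballI conjI h)
      fix x y assume xy: "x \<in> V" "y \<in> V"
      then have "\<bar>ereal (g x y s) - f y s\<bar> \<le> ereal (\<eta>bar / 2 * (norm (y - x))\<^sup>2)" using elim by blast
      then show "\<bar>g x y s - h y s\<bar> \<le> \<eta>bar / 2 * (norm (y - x))\<^sup>2" by (simp add: h xy)
    qed
  qed
  moreover have "AE s in P. \<forall>x\<in>V. weakly_convex \<tau>bar (\<lambda>y. ereal (g x y s) + r y)"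
    using regular by (auto simp: regularity_def)
  moreover have "AE s in P. \<forall>x\<in>U. \<forall>y\<in>U. \<bar>g x x s - g x y s\<bar> \<le> Lbar U s * norm (x - y)"
    using lipschitz U by (auto simp: local_lipschitz_models_def)
  ultimately show ?thesis by eventually_elim auto
qed

lemma Lbar: "Lbar U \<in> borel_measurable P" "s \<in> space P \<Longrightarrow> 0 \<le> Lbar U s"
    "integrable P (\<lambda>s. (Lbar U s)\<^sup>2)" "sqrt (LINT s|P. (Lbar U s)\<^sup>2) \<le> LFbar U" "integrable P (Lbar U)"
proof -
  show l: "Lbar U \<in> borel_measurable P" "s \<in> space P \<Longrightarrow> 0 \<le> Lbar U s"
    "integrable P (\<lambda>s. (Lbar U s)\<^sup>2)" "sqrt (LINT s|P. (Lbar U s)\<^sup>2) \<le> LFbar U"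
    using lipschitz U by (auto simp: local_lipschitz_models_def)
  interpret P: prob_space P by (rule prob_P)
  show "integrable P (Lbar U)" by (rule P.square_integrable_imp_integrable[OF l(1,3)])
qed

lemma h_lipschitz: "AE s in P. \<forall>x\<in>U. \<forall>y\<in>U. \<bar>h x s - h y s\<bar> \<le> Lbar U s * norm (x - y)"
  using models_good
proof eventually_elim
  case (elim s)
  show ?case
  proof (intro ballI)
    fix x y assume "x \<in> U" "y \<in> U"
    then show "\<bar>h x s - h y s\<bar> \<le> Lbar U s * norm (x - y)"
    proof (rule lipschitz_from_quadratic_error[OF U(3), where e = "\<eta>bar / 2"])
      fix x y assume xy: "x \<in> U" "y \<in> U"
      then have "x \<in> V" "y \<in> V" using U by auto
      then have "g x x s = h x s" "\<bar>g x y s - h y s\<bar> \<le> \<eta>bar / 2 * (norm (y - x))\<^sup>2" using elim by blast+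
      moreover have "\<bar>g x x s - g x y s\<bar> \<le> Lbar U s * norm (x - y)" using elim xy by blast
      ultimately show "\<bar>h x s - h y s\<bar> \<le> Lbar U s * norm (x - y) + \<eta>bar / 2 * (norm (x - y))\<^sup>2"
        unfolding norm_minus_commute[of y x] by linarith
    qed
  qed
qed

definition "\<kappa> = (LINT s|P. Lbar U s)"

lemma \<kappa>_nonneg: "0 \<le> \<kappa>"
  unfolding \<kappa>_def using Lbar by (intro Bochner_Integration.integral_nonneg) auto

lemma F_lipschitz:
  assumes "y \<in> U" "z \<in> U" shows "F y - F z \<le> \<kappa> * norm (y - z)"
proof -
  have "F y - F z = (LINT s|P. h y s - h z s)"
    unfolding F_eq using h_integrable by simp
  also have "\<dots> \<le> (LINT s|P. Lbar U s * norm (y - z))"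
  proof (rule integral_mono_AE)
    show "AE s in P. h y s - h z s \<le> Lbar U s * norm (y - z)"
      using h_lipschitz by eventually_elim (use assms in fastforce)
  qed (use h_integrable Lbar in auto)
  also have "\<dots> = \<kappa> * norm (y - z)" by (simp add: \<kappa>_def)
  finally show ?thesis .
qed

lemma r_optimal: "y \<in> X \<Longrightarrow> r y \<noteq> \<infinity>"
  and optimal_growth: "y \<in> X \<Longrightarrow> ereal (F y) + r y + ereal (cbar * (infdist w X)\<^sup>2) \<le> ereal (F w) + r w"
proof -
  assume y: "y \<in> X"
  have min: "total_objective P f r y \<le> total_objective P f r z" for z
    using y unfolding X argmin_set_def is_arg_min_def by (auto simp: not_less)
  obtain z where "r z < \<infinity>"
    using regular by (auto simp: regularity_def proper_closed_def effdom_def)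
  then show "r y \<noteq> \<infinity>"
    using min[of z] by (auto simp: total_objective_def)
  have "total_objective P f r y \<le> (INF z. total_objective P f r z)"
    by (intro INF_greatest min)
  then have "total_objective P f r y + ereal (cbar * (infdist w X)\<^sup>2)
      \<le> (INF z. total_objective P f r z) + ereal (cbar * (infdist w X)\<^sup>2)"
    by (rule add_right_mono)
  also have "\<dots> \<le> total_objective P f r w"
    using growth unfolding quadratic_growth_def X by blast
  finally show "ereal (F y) + r y + ereal (cbar * (infdist w X)\<^sup>2) \<le> ereal (F w) + r w"
    by (simp add: total_objective_def)
qed

lemma X_subset: "X \<subseteq> V"
proof
  fix y assume "y \<in> X"
  then have "y \<in> effdom r" using r_optimal by (auto simp: effdom_def less_top[symmetric] top_ereal_def)
  then show "y \<in> V" using models by (auto simp: model_functions_def)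
qed

text \<open>The model accuracy bound is nonnegative at two distinct points, which exist since \<open>U\<close> is open and contains
  the iterates.\<close>

lemma \<eta>bar_nonneg: "0 \<le> \<eta>bar"
proof -
  obtain \<omega> where "x 1 \<omega> \<in> U"
  proof (rule ccontr)
    assume none: "\<not> thesis"
    have "AE \<omega> in \<Omega>. False"
      using U_contains by eventually_elim (use none that in auto)
    then show False by simp
  qed
  moreover have "U \<noteq> {x 1 \<omega>}" using U(2) not_open_singleton[of "x 1 \<omega>"] by auto
  ultimately obtain y where y: "y \<in> U" "y \<noteq> x 1 \<omega>" by blast
  interpret P: prob_space P by (rule prob_P)
  have "AE s in P. 0 \<le> \<eta>bar / 2 * (norm (y - x 1 \<omega>))\<^sup>2"
    using models_good
  proof eventually_elim
    case (elim s)
    then have "\<bar>g (x 1 \<omega>) y s - h y s\<bar> \<le> \<eta>bar / 2 * (norm (y - x 1 \<omega>))\<^sup>2"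
      using U(4) y \<open>x 1 \<omega> \<in> U\<close> by (meson subsetD)
    then show ?case by linarith
  qed
  then have "0 \<le> \<eta>bar / 2 * (norm (y - x 1 \<omega>))\<^sup>2" by simp
  then show ?thesis using y by (simp add: zero_le_mult_iff)
qed

lemma \<eta>_nonneg: "0 \<le> \<eta>"
  using \<eta>bar_nonneg by (simp add: eta)

lemma \<tau>\<alpha>:
  assumes k: "1 \<le> k" shows "\<tau> * \<alpha> k < 1"
proof -
  have "\<tau> * \<alpha> k \<le> (\<eta> + \<tau>) * \<alpha> k"
    using \<eta>_nonneg step_pos[OF k] by (intro mult_right_mono) auto
  then show ?thesis using step_bound[OF k] by linarith
qed

text \<open>The metric of \<open>M (k - 1)\<close> is used because it is determined, like \<open>x k\<close>, before the minibatch \<open>k\<close> is drawn; \<open>M k\<close> is not.\<close>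

definition "D k \<omega> = wdist_real (M (k - 1) \<omega>) (x k \<omega>) X"

lemma D_nonneg: "\<omega> \<in> space \<Omega> \<Longrightarrow> 0 \<le> D k \<omega>"
  unfolding D_def by (intro wdist_real_nonneg M_spd X_nonempty)

lemma D_measurable_past: "1 \<le> k \<Longrightarrow> D k \<in> borel_measurable (Fil (k - 1))"
  unfolding D_def[abs_def]
  by (intro measurable_wdist_real M_measurable x_measurable X_nonempty)
    (auto intro: M_spd simp: space_sample_filtration[OF prob_\<Omega> iid])

lemma D_measurable: "1 \<le> k \<Longrightarrow> D k \<in> borel_measurable \<Omega>"
  by (rule measurable_from_subalg[OF subalgebra_sample_filtration[OF prob_\<Omega> iid] D_measurable_past])

lemma D_integrable: assumes "1 \<le> k" shows "integrable \<Omega> (\<lambda>\<omega>. (D k \<omega>)\<^sup>2)"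
proof -
  obtain y0 where y0: "y0 \<in> X" using X_nonempty by auto
  obtain b where b: "\<And>u. u \<in> U \<Longrightarrow> norm u \<le> b" using U by (auto simp: bounded_iff)
  have "AE \<omega> in \<Omega>. norm ((D k \<omega>)\<^sup>2) \<le> ((b + norm y0) / \<mu>inf)\<^sup>2"
    using norm_equiv U_contains AE_space
  proof eventually_elim
    case (elim \<omega>)
    have "\<mu>inf * wnorm (M (k - 1) \<omega>) (x k \<omega> - y0) \<le> norm (x k \<omega> - y0)" using elim by blast
    also have "\<dots> \<le> b + norm y0" using b[of "x k \<omega>"] elim assms norm_triangle_ineq4[of "x k \<omega>" y0] by fastforce
    finally have "wnorm (M (k - 1) \<omega>) (x k \<omega> - y0) \<le> (b + norm y0) / \<mu>inf" using \<mu>inf by (simp add: field_simps)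
    moreover have "D k \<omega> \<le> wnorm (M (k - 1) \<omega>) (x k \<omega> - y0)"
      unfolding D_def by (rule wdist_real_le[OF M_spd X_nonempty y0]) (use elim in simp)
    ultimately have "(D k \<omega>)\<^sup>2 \<le> ((b + norm y0) / \<mu>inf)\<^sup>2"
      using D_nonneg elim by (intro power_mono) auto
    then show ?case by simp
  qed
  then show ?thesis using D_measurable[OF assms] by (intro integrable_const_bound) auto
qed

text \<open>The exceptional set must not depend on \<open>y\<close> and \<open>z\<close>, which are chosen afterwards as functions of the outcome.\<close>

lemma realized_descent:
  assumes k: "1 \<le> k"
  defines "lb \<equiv> \<lambda>\<omega>. 1 / real m * (\<Sum>i=1..m. Lbar U (S k i \<omega>))"
  defines "hb \<equiv> \<lambda>y \<omega>. 1 / real m * (\<Sum>i=1..m. h y (S k i \<omega>))"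
  shows "AE \<omega> in \<Omega>. \<forall>y\<in>X. \<forall>z\<in>U. \<forall>d. norm (z - x k \<omega>) \<le> d \<longrightarrow>
    (1 + (2 * c1 - \<tau>) * \<alpha> k) * (wdist_real (M k \<omega>) (exact_iterate S m g r M \<alpha> x k \<omega>) X)\<^sup>2
    \<le> (1 + \<eta> * \<alpha> k) * (wnorm (M k \<omega>) (y - x k \<omega>))\<^sup>2 + (\<alpha> k)\<^sup>2 * (Linf * (lb \<omega> + \<kappa>))\<^sup>2
      + 2 * \<alpha> k * ((hb y \<omega> - F y) - (hb z \<omega> - F z) + d * (lb \<omega> + \<kappa>))"
    and "AE \<omega> in \<Omega>. D (Suc k) \<omega> \<le> wdist_real (M k \<omega>) (exact_iterate S m g r M \<alpha> x k \<omega>) X + \<epsilon> k"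
proof -
  let ?good = "\<lambda>s. (\<forall>x\<in>V. \<forall>y\<in>V. g x x s = h x s \<and> \<bar>g x y s - h y s\<bar> \<le> \<eta>bar / 2 * (norm (y - x))\<^sup>2)
     \<and> (\<forall>x\<in>V. weakly_convex \<tau>bar (\<lambda>y. ereal (g x y s) + r y))
     \<and> (\<forall>x\<in>U. \<forall>y\<in>U. \<bar>g x x s - g x y s\<bar> \<le> Lbar U s * norm (x - y))
     \<and> (\<forall>x\<in>U. \<forall>y\<in>U. \<bar>h x s - h y s\<bar> \<le> Lbar U s * norm (x - y)) \<and> 0 \<le> Lbar U s"
  have "AE s in P. ?good s"
    using models_good h_lipschitz AE_space by eventually_elim (use Lbar(2) in blast)
  then have "AE \<omega> in \<Omega>. ?good (S k i \<omega>)" if "i \<in> {1..m}" for i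
    using sample_AE[OF prob_\<Omega> iid k that] by blast
  then have good: "AE \<omega> in \<Omega>. \<forall>i\<in>{1..m}. ?good (S k i \<omega>)"
    by (intro AE_finite_allI) auto
  let ?w = "exact_iterate S m g r M \<alpha> x k"
  show "AE \<omega> in \<Omega>. \<forall>y\<in>X. \<forall>z\<in>U. \<forall>d. norm (z - x k \<omega>) \<le> d \<longrightarrow>
    (1 + (2 * c1 - \<tau>) * \<alpha> k) * (wdist_real (M k \<omega>) (?w \<omega>) X)\<^sup>2
    \<le> (1 + \<eta> * \<alpha> k) * (wnorm (M k \<omega>) (y - x k \<omega>))\<^sup>2 + (\<alpha> k)\<^sup>2 * (Linf * (lb \<omega> + \<kappa>))\<^sup>2
      + 2 * \<alpha> k * ((hb y \<omega> - F y) - (hb z \<omega> - F z) + d * (lb \<omega> + \<kappa>))"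
    using good norm_equiv U_contains AE_space
  proof eventually_elim
    case (elim \<omega>)
    have w: "?w \<omega> = prox (M k \<omega>) (\<alpha> k) (\<lambda>y. ereal (1 / real m * (\<Sum>i=1..m. g (x k \<omega>) y (S k i \<omega>))) + r y) (x k \<omega>)"
      by (simp add: exact_iterate_def minibatch_model_def[abs_def])
    have xw: "x k \<omega> \<in> U" "?w \<omega> \<in> U" using elim k by auto
    have xV: "x k \<omega> \<in> V" using xw U by auto
    note good = elim(1)
    show ?case
    proof (intro ballI allI impI)
      fix y z d assume y: "y \<in> X" and z: "z \<in> U" and d: "norm (z - x k \<omega>) \<le> d"
      have yV: "y \<in> V" using y X_subset by auto
      show "(1 + (2 * c1 - \<tau>) * \<alpha> k) * (wdist_real (M k \<omega>) (?w \<omega>) X)\<^sup>2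
        \<le> (1 + \<eta> * \<alpha> k) * (wnorm (M k \<omega>) (y - x k \<omega>))\<^sup>2 + (\<alpha> k)\<^sup>2 * (Linf * (lb \<omega> + \<kappa>))\<^sup>2
          + 2 * \<alpha> k * ((hb y \<omega> - F y) - (hb z \<omega> - F z) + d * (lb \<omega> + \<kappa>))"
        unfolding lb_def hb_def
      proof (rule model_step_descent[where g = "g (x k \<omega>)" and S = "\<lambda>i. S k i \<omega>" and l = "Lbar U" and h = h and F = F
            and m = m and r = r and hb = "\<lambda>y. 1 / real m * (\<Sum>i=1..m. h y (S k i \<omega>))",
            OF refl w refl refl])
        show "spd_map (M k \<omega>)" by (rule M_spd) (use elim in simp)
        show "0 < \<alpha> k" "\<tau> * \<alpha> k < 1" "1 \<le> m" using step_pos \<tau>\<alpha> k m_pos by auto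
        show "0 \<le> \<tau>bar" "\<tau> = Linf\<^sup>2 * \<tau>bar" "\<eta> = Linf\<^sup>2 * \<eta>bar" "0 \<le> \<eta>bar" "0 < \<mu>inf" "\<mu>inf\<^sup>2 * cbar = c1" "0 \<le> cbar"
          using \<tau>bar_nonneg tau eta \<eta>bar_nonneg \<mu>inf c1 cbar_pos by auto
        show "norm v \<le> Linf * wnorm (M k \<omega>) v" "\<mu>inf * wnorm (M k \<omega>) v \<le> norm v" for v using elim by auto
        show "0 < Linf" using Linf by simp
        show "y \<in> X" "r y \<noteq> \<infinity>" by (fact y r_optimal[OF y])+
        show "ereal (F y) + r y + ereal (cbar * (infdist (?w \<omega>) X)\<^sup>2) \<le> ereal (F (?w \<omega>)) + r (?w \<omega>)"
          by (rule optimal_growth[OF y])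
        show "F (?w \<omega>) - F (x k \<omega>) \<le> \<kappa> * norm (?w \<omega> - x k \<omega>)" by (rule F_lipschitz) (fact xw)+
        show "F (x k \<omega>) - F z \<le> \<kappa> * norm (z - x k \<omega>)"
          using F_lipschitz[OF xw(1) z] by (simp add: norm_minus_commute)
        show "0 \<le> \<kappa>" by (rule \<kappa>_nonneg)
        show "norm (z - x k \<omega>) \<le> d" by (rule d)
        fix i assume i: "i \<in> {1..m}"
        show "weakly_convex \<tau>bar (\<lambda>y. ereal (g (x k \<omega>) y (S k i \<omega>)) + r y)" using good i xV by blast
        show "g (x k \<omega>) (x k \<omega>) (S k i \<omega>) = h (x k \<omega>) (S k i \<omega>)" using good i xV by blast
        have "\<bar>g (x k \<omega>) y (S k i \<omega>) - h y (S k i \<omega>)\<bar> \<le> \<eta>bar / 2 * (norm (y - x k \<omega>))\<^sup>2" using good i xV yV by blast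
        then show "g (x k \<omega>) y (S k i \<omega>) \<le> h y (S k i \<omega>) + \<eta>bar / 2 * (norm (y - x k \<omega>))\<^sup>2" by linarith
        have "\<bar>g (x k \<omega>) (x k \<omega>) (S k i \<omega>) - g (x k \<omega>) (?w \<omega>) (S k i \<omega>)\<bar> \<le> Lbar U (S k i \<omega>) * norm (x k \<omega> - ?w \<omega>)"
          using good i xw by blast
        then show "g (x k \<omega>) (x k \<omega>) (S k i \<omega>) - g (x k \<omega>) (?w \<omega>) (S k i \<omega>) \<le> Lbar U (S k i \<omega>) * norm (x k \<omega> - ?w \<omega>)"
          by linarith
        have "\<bar>h z (S k i \<omega>) - h (x k \<omega>) (S k i \<omega>)\<bar> \<le> Lbar U (S k i \<omega>) * norm (z - x k \<omega>)"
          using good i xw z by blast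
        then show "h z (S k i \<omega>) - h (x k \<omega>) (S k i \<omega>) \<le> Lbar U (S k i \<omega>) * norm (z - x k \<omega>)" by linarith
        show "0 \<le> Lbar U (S k i \<omega>)" using good i by blast
      qed
    qed
  qed
  have "AE \<omega> in \<Omega>. \<forall>k\<ge>1. x k \<omega> \<in> V \<and>
        inexact_prox_step (M k \<omega>) (\<alpha> k) (\<epsilon> k) \<tau>
          (minibatch_model g r m (\<lambda>i. S k i \<omega>) (x k \<omega>)) (x k \<omega>) (x (Suc k) \<omega>)"
    using run by (simp add: ispPPA_run_def)
  then show "AE \<omega> in \<Omega>. D (Suc k) \<omega> \<le> wdist_real (M k \<omega>) (?w \<omega>) X + \<epsilon> k"
    using good norm_equiv AE_space
  proof eventually_elim
    case (elim \<omega>)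
    define p where "p = (\<lambda>y. ereal (1 / real m * (\<Sum>i=1..m. g (x k \<omega>) y (S k i \<omega>))) + r y)"
    have p: "minibatch_model g r m (\<lambda>i. S k i \<omega>) (x k \<omega>) = p"
      by (simp add: p_def minibatch_model_def[abs_def])
    have xV: "x k \<omega> \<in> V" using elim(1) k by blast
    have wc: "weakly_convex \<tau>bar (\<lambda>y. ereal (g (x k \<omega>) y (S k i \<omega>)) + r y)" if "i \<in> {1..m}" for i
      using elim(2) that xV by blast
    note av = wc m_pos p_def
    note spd = M_spd[OF elim(4), of k]
    have a: "0 < \<alpha> k" "0 \<le> \<epsilon> k" using step_pos k by auto
    have nl: "norm v \<le> Linf * wnorm (M k \<omega>) v" for v using elim by auto
    have sc: "strongly_convex_wrt ((1 - \<tau> * \<alpha> k) / \<alpha> k) (M k \<omega>) (prox_objective (M k \<omega>) (\<alpha> k) p (x k \<omega>))"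
      by (rule prox_objective_strongly_convex[OF spd a(1) \<tau>bar_nonneg tau average_weak_convexity[OF av] nl])
    have "inexact_prox_step (M k \<omega>) (\<alpha> k) (\<epsilon> k) \<tau> p (x k \<omega>) (x (Suc k) \<omega>)"
      using elim(1) k unfolding p[symmetric] by blast
    then have "wnorm (M k \<omega>) (x (Suc k) \<omega> - prox (M k \<omega>) (\<alpha> k) p (x k \<omega>)) \<le> \<epsilon> k"
      using inexact_prox_step_close[OF spd a(1) \<tau>\<alpha>[OF k] sc average_lower_semicont[OF av] average_not_MInfty(2)[OF av]
          average_effdom[OF av] _ a(2)] by blast
    then have "wnorm (M k \<omega>) (x (Suc k) \<omega> - ?w \<omega>) \<le> \<epsilon> k"
      by (simp add: exact_iterate_def p)
    then show ?case
      using wdist_real_triangle[OF spd X_nonempty, of "x (Suc k) \<omega>" "?w \<omega>"] by (simp add: D_def)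
  qed
qed

lemma expected_change_of_preconditioner:
  assumes k: "1 \<le> k" and B: "B \<in> sets (Fil (k - 1))"
  shows "(LINT \<omega>|\<Omega>. indicator B \<omega> * (wnorm (M k \<omega>) v)\<^sup>2)
      \<le> (\<rho> k)\<^sup>2 * (LINT \<omega>|\<Omega>. indicator B \<omega> * (wnorm (M (k - 1) \<omega>) v)\<^sup>2)"
proof -
  have sub: "subalgebra \<Omega> (Fil j)" for j by (rule subalgebra_sample_filtration[OF prob_\<Omega> iid])
  have bnd: "AE \<omega> in \<Omega>. \<forall>v. \<mu>inf * wnorm (M j \<omega>) v \<le> norm v" for j
    using norm_equiv by eventually_elim auto
  have ratio: "AE \<omega> in \<Omega>. real_cond_exp \<Omega> (Fil (k - 1))
      (\<lambda>\<omega>'. (wnorm (M k \<omega>') v)\<^sup>2 / (wnorm (M (k - 1) \<omega>') v)\<^sup>2) \<omega> \<le> (\<rho> k)\<^sup>2" if "v \<noteq> 0"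
  proof -
    have "AE \<omega> in \<Omega>. (let q = real_cond_exp \<Omega> (Fil (k - 1))
          (\<lambda>\<omega>'. (wnorm (M k \<omega>') v)\<^sup>2 / (wnorm (M (k - 1) \<omega>') v)\<^sup>2) \<omega> in 1 / (\<rho> k)\<^sup>2 \<le> q \<and> q \<le> (\<rho> k)\<^sup>2)"
      using precond k that unfolding preconditioner_condition_def by blast
    then show ?thesis by eventually_elim (simp add: Let_def)
  qed
  show ?thesis
    by (rule preconditioner_change[OF prob_\<Omega> sub B M_spd M_spd M_measurable
          measurable_from_subalg[OF sub M_measurable] \<mu>inf(1) bnd bnd ratio])
qed

lemma wnorm_M_integrable:
  assumes B: "B \<in> sets (Fil j)"
  shows "integrable \<Omega> (\<lambda>\<omega>. indicator B \<omega> * (wnorm (M k \<omega>) v)\<^sup>2)"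
proof (rule integrable_indicator_wnorm[OF prob_\<Omega>])
  have sub: "subalgebra \<Omega> (Fil j)" for j by (rule subalgebra_sample_filtration[OF prob_\<Omega> iid])
  show "B \<in> sets \<Omega>" using B sub by (auto simp: subalgebra_def)
  show "(\<lambda>\<omega>. M k \<omega> v) \<in> borel_measurable \<Omega>" for v
    by (rule measurable_from_subalg[OF sub M_measurable])
  show "AE \<omega> in \<Omega>. \<forall>v. \<mu>inf * wnorm (M k \<omega>) v \<le> norm v"
    using norm_equiv by eventually_elim auto
qed (use M_spd \<mu>inf in auto)

definition "noise = rho_const P (\<lambda>s. Linf * Lbar U s) m * (Linf * LFbar U)\<^sup>2"

lemma noise_nonneg: "0 \<le> noise"
  by (simp add: noise_def rho_const_def)

lemma lipschitz_second_moment: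
  assumes k: "1 \<le> k"
  defines "l2 \<equiv> \<lambda>\<omega>. (Linf * (1 / real m * (\<Sum>i=1..m. Lbar U (S k i \<omega>)) + \<kappa>))\<^sup>2"
  shows "integrable \<Omega> l2" and "(LINT \<omega>|\<Omega>. l2 \<omega>) \<le> noise"
proof -
  have q: "(\<lambda>s. Linf * Lbar U s) \<in> borel_measurable P" "integrable P (\<lambda>s. (Linf * Lbar U s)\<^sup>2)"
    using Lbar by (auto simp: power_mult_distrib)
  have l2: "l2 = (\<lambda>\<omega>. (1 / real m * (\<Sum>i=1..m. Linf * Lbar U (S k i \<omega>)) + (LINT s|P. Linf * Lbar U s))\<^sup>2)"
    by (simp add: l2_def \<kappa>_def sum_distrib_left[symmetric] distrib_left mult_ac)
  have "sqrt (LINT s|P. (Linf * Lbar U s)\<^sup>2) = Linf * sqrt (LINT s|P. (Lbar U s)\<^sup>2)"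
    using Linf by (simp add: power_mult_distrib real_sqrt_mult)
  also have "\<dots> \<le> Linf * LFbar U" using Lbar(4) Linf by (intro mult_left_mono) auto
  finally have B: "sqrt (LINT s|P. (Linf * Lbar U s)\<^sup>2) \<le> Linf * LFbar U" .
  have q0: "0 \<le> Linf * Lbar U s" if "s \<in> space P" for s using Lbar(2)[OF that] Linf by simp
  note mom = minibatch_lipschitz_moment[OF prob_\<Omega> iid k m_pos prob_P q q0 Lf_pos B]
  show "integrable \<Omega> l2" "(LINT \<omega>|\<Omega>. l2 \<omega>) \<le> noise"
    unfolding l2 noise_def using mom by blast+
qed

text \<open>For fixed accuracy \<open>d\<close> the comparison points depend on an index \<open>J\<close> with finitely many values, known
  before the minibatch \<open>k\<close> is drawn. Writing everything as a finite sum over the events \<open>J = j\<close> makes the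
  expectation of the loss differences vanish term by term, and allows the metric of \<open>M k\<close> to be exchanged for that of
  \<open>M (k - 1)\<close> term by term.\<close>

lemma expected_descent_approx:
  assumes k: "1 \<le> k" and \<theta>: "0 < \<theta>" and K: "0 < 1 + (2 * c1 - \<tau>) * \<alpha> k" and d: "0 < d"
  shows "(LINT \<omega>|\<Omega>. (D (Suc k) \<omega>)\<^sup>2)
    \<le> (1 + \<theta>) / (1 + (2 * c1 - \<tau>) * \<alpha> k)
        * ((1 + \<eta> * \<alpha> k) * ((1 + d) * ((\<rho> k)\<^sup>2 * ((1 + d) * (LINT \<omega>|\<Omega>. (D k \<omega>)\<^sup>2)
              + d * (1 + d) * (1 + 1 / \<mu>inf)\<^sup>2)) + d * (1 + d) * (1 / \<mu>inf)\<^sup>2)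
          + (\<alpha> k)\<^sup>2 * noise + 2 * \<alpha> k * (d * (2 * \<kappa>)))
      + (1 + 1 / \<theta>) * (\<epsilon> k)\<^sup>2"
proof -
  let ?G = "Fil (k - 1)" and ?K = "1 + (2 * c1 - \<tau>) * \<alpha> k"
  have space: "space ?G = space \<Omega>" by (rule space_sample_filtration[OF prob_\<Omega> iid])
  have sub: "subalgebra \<Omega> ?G" by (rule subalgebra_sample_filtration[OF prob_\<Omega> iid])
  have \<alpha>: "0 < \<alpha> k" "0 \<le> \<epsilon> k" using step_pos k by auto
  have Linf0: "0 < Linf" using Linf by simp
  have spdG: "spd_map (M (k - 1) \<omega>)" if "\<omega> \<in> space ?G" for \<omega> using M_spd that space by simp
  obtain N :: nat and z y and J :: "'w \<Rightarrow> nat" where J: "J \<in> measurable ?G (count_space UNIV)"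
    and zy: "\<forall>j<N. z j \<in> U \<and> y j \<in> X"
    and sel: "\<forall>\<omega>\<in>space ?G. x k \<omega> \<in> U \<longrightarrow>
       (\<forall>v. \<mu>inf * wnorm (M (k - 1) \<omega>) v \<le> norm v \<and> norm v \<le> Linf * wnorm (M (k - 1) \<omega>) v)
      \<longrightarrow> J \<omega> < N \<and> norm (z (J \<omega>) - x k \<omega>) \<le> d
        \<and> wnorm (M (k - 1) \<omega>) (x k \<omega> - y (J \<omega>)) \<le> wdist_real (M (k - 1) \<omega>) (x k \<omega>) X + d"
    by (rule finite_near_projection[OF spdG M_measurable x_measurable[OF k] U(1) X_nonempty d \<mu>inf(1) Linf0],
        assumption, (rule that; assumption))
  define B where "B j = J -` {j} \<inter> space \<Omega>" for j
  have B: "B j \<in> sets ?G" for j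
    using measurable_sets[OF J, of "{j}", unfolded space] by (simp add: B_def)
  have select: "(\<Sum>j<N. indicator (B j) \<omega> * a j) = (a (J \<omega>) :: real)" if "\<omega> \<in> space \<Omega>" "J \<omega> < N" for \<omega> a
  proof -
    have "(\<Sum>j<N. indicator (B j) \<omega> * a j) = (\<Sum>j<N. if j = J \<omega> then a j else 0)"
      using that by (intro sum.cong) (auto simp: B_def indicator_def)
    then show ?thesis using that by simp
  qed
  define W where "W C \<omega> = (\<Sum>j<N. indicator (B j) \<omega> * (wnorm (C \<omega>) (y j - z j))\<^sup>2)" for C :: "'w \<Rightarrow> 'a \<Rightarrow> 'a" and \<omega>
  have intW: "integrable \<Omega> (W (M k))"
    unfolding W_def[abs_def]
    by (intro Bochner_Integration.integrable_sum wnorm_M_integrable[OF B])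
  have intW0: "integrable \<Omega> (W (M (k - 1)))"
    unfolding W_def[abs_def] by (intro Bochner_Integration.integrable_sum wnorm_M_integrable[OF B])
  have W_le: "(LINT \<omega>|\<Omega>. W (M k) \<omega>) \<le> (\<rho> k)\<^sup>2 * (LINT \<omega>|\<Omega>. W (M (k - 1)) \<omega>)"
  proof -
    have "(LINT \<omega>|\<Omega>. W (M k) \<omega>) = (\<Sum>j<N. LINT \<omega>|\<Omega>. indicator (B j) \<omega> * (wnorm (M k \<omega>) (y j - z j))\<^sup>2)"
      unfolding W_def by (intro Bochner_Integration.integral_sum wnorm_M_integrable[OF B])
    also have "\<dots> \<le> (\<Sum>j<N. (\<rho> k)\<^sup>2 * (LINT \<omega>|\<Omega>. indicator (B j) \<omega> * (wnorm (M (k - 1) \<omega>) (y j - z j))\<^sup>2))"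
      by (intro sum_mono expected_change_of_preconditioner k B)
    also have "\<dots> = (\<rho> k)\<^sup>2 * (LINT \<omega>|\<Omega>. W (M (k - 1)) \<omega>)"
      unfolding W_def by (subst Bochner_Integration.integral_sum) (auto intro: wnorm_M_integrable[OF B] simp: sum_distrib_left)
    finally show ?thesis .
  qed
  define q where "q j s = (h (y j) s - F (y j)) - (h (z j) s - F (z j))" for j s
  interpret P: prob_space P by (rule prob_P)
  have q: "integrable P (q j)" "(LINT s|P. q j s) = 0" for j
    unfolding q_def[abs_def] using h_integrable by (auto simp: F_eq P.prob_space)
  define E where "E \<omega> = (\<Sum>j<N. 1 / real m * (\<Sum>i=1..m. indicator (B j) \<omega> * q j (S k i \<omega>)))" for \<omega>
  have past: "integrable \<Omega> (\<lambda>\<omega>. indicator (B j) \<omega> * q j (S k i \<omega>))"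
    "(LINT \<omega>|\<Omega>. indicator (B j) \<omega> * q j (S k i \<omega>)) = 0" if "i \<in> {1..m}" for i j
    using past_independent_of_sample[OF prob_\<Omega> iid B that q(1), of j j] k q(2) by auto
  have intE: "integrable \<Omega> E"
    unfolding E_def[abs_def] by (intro Bochner_Integration.integrable_sum integrable_mult_right past)
  have E0: "(LINT \<omega>|\<Omega>. E \<omega>) = 0"
  proof -
    have "(LINT \<omega>|\<Omega>. E \<omega>) = (\<Sum>j<N. LINT \<omega>|\<Omega>. 1 / real m * (\<Sum>i=1..m. indicator (B j) \<omega> * q j (S k i \<omega>)))"
      unfolding E_def by (intro Bochner_Integration.integral_sum Bochner_Integration.integrable_sum integrable_mult_right past)
    also have "\<dots> = (\<Sum>j<N. 1 / real m * (\<Sum>i=1..m. LINT \<omega>|\<Omega>. indicator (B j) \<omega> * q j (S k i \<omega>)))"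
      by (simp only: integral_mult_right_zero Bochner_Integration.integral_sum[OF past(1)])
    also have "\<dots> = 0" using past(2) by simp
    finally show ?thesis .
  qed
  define lb where "lb \<omega> = 1 / real m * (\<Sum>i=1..m. Lbar U (S k i \<omega>))" for \<omega>
  have lb: "integrable \<Omega> lb" "(LINT \<omega>|\<Omega>. lb \<omega>) = \<kappa>"
    using minibatch_second_moment(2,3)[OF prob_\<Omega> iid k m_pos prob_P Lbar(1,3)] by (simp_all add: lb_def[abs_def] \<kappa>_def)
  define l2 where "l2 \<omega> = (Linf * (lb \<omega> + \<kappa>))\<^sup>2" for \<omega>
  have l2: "integrable \<Omega> l2" "(LINT \<omega>|\<Omega>. l2 \<omega>) \<le> noise"
    using lipschitz_second_moment[OF k] by (simp_all add: l2_def[abs_def] lb_def)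
  define rhs where "rhs \<omega> = (1 + \<eta> * \<alpha> k) * ((1 + d) * W (M k) \<omega> + d * (1 + d) * (1 / \<mu>inf)\<^sup>2)
      + (\<alpha> k)\<^sup>2 * l2 \<omega> + 2 * \<alpha> k * (E \<omega> + d * (lb \<omega> + \<kappa>))" for \<omega>
  have split_sq: "(a + d * b)\<^sup>2 \<le> (1 + d) * a\<^sup>2 + d * (1 + d) * b\<^sup>2" for a b
  proof -
    have "(1 + 1 / d) * (d * b)\<^sup>2 = d * (1 + d) * b\<^sup>2"
      using d by (simp add: power2_eq_square field_simps)
    then show ?thesis using power2_add_le_weighted[OF d, of a "d * b"] by simp
  qed
  have AE1: "AE \<omega> in \<Omega>. (D (Suc k) \<omega>)\<^sup>2 \<le> (1 + \<theta>) / ?K * rhs \<omega> + (1 + 1 / \<theta>) * (\<epsilon> k)\<^sup>2"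
    using realized_descent[OF k] norm_equiv U_contains AE_space
  proof eventually_elim
    case (elim \<omega>)
    let ?w = "exact_iterate S m g r M \<alpha> x k \<omega>" and ?N = "wnorm (M k \<omega>)" and ?y = "y (J \<omega>)" and ?z = "z (J \<omega>)"
    note spd = M_spd[OF elim(5)]
    have xU: "x k \<omega> \<in> U" using elim k by auto
    have J: "J \<omega> < N" "norm (?z - x k \<omega>) \<le> d"
      using sel elim(3,5) xU space by auto
    have yz: "?y \<in> X" "?z \<in> U" using zy J(1) by auto
    have hq: "(1 / real m * (\<Sum>i=1..m. h ?y (S k i \<omega>)) - F ?y) - (1 / real m * (\<Sum>i=1..m. h ?z (S k i \<omega>)) - F ?z)
        = 1 / real m * (\<Sum>i=1..m. q (J \<omega>) (S k i \<omega>))"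
      using m_pos by (simp add: q_def sum_subtractf sum.distrib field_simps)
    have "E \<omega> = (\<Sum>j<N. indicator (B j) \<omega> * (1 / real m * (\<Sum>i=1..m. q j (S k i \<omega>))))"
    proof -
      have "b * (\<Sum>i=1..m. a * v i) = a * (b * (\<Sum>i=1..m. v i))" for a b :: real and v
        by (simp add: sum_distrib_left mult_ac)
      then show ?thesis unfolding E_def by (simp only:)
    qed
    also have "\<dots> = 1 / real m * (\<Sum>i=1..m. q (J \<omega>) (S k i \<omega>))" by (rule select[OF elim(5) J(1)])
    finally have E: "E \<omega> = 1 / real m * (\<Sum>i=1..m. q (J \<omega>) (S k i \<omega>))" .
    have W: "W (M k) \<omega> = (?N (?y - ?z))\<^sup>2"
      unfolding W_def by (rule select[OF elim(5) J(1)])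
    have "?K * (wdist_real (M k \<omega>) ?w X)\<^sup>2 \<le> (1 + \<eta> * \<alpha> k) * (?N (?y - x k \<omega>))\<^sup>2 + (\<alpha> k)\<^sup>2 * l2 \<omega>
        + 2 * \<alpha> k * (E \<omega> + d * (lb \<omega> + \<kappa>))"
      using elim(1) yz J(2) unfolding E hq[symmetric] l2_def lb_def by blast
    also have "\<dots> \<le> rhs \<omega>"
    proof -
      have "\<mu>inf * ?N (?z - x k \<omega>) \<le> d" using elim(3) J(2) order_trans by blast
      then have "?N (?z - x k \<omega>) \<le> d * (1 / \<mu>inf)" using \<mu>inf by (simp add: field_simps)
      then have "?N (?y - x k \<omega>) \<le> ?N (?y - ?z) + d * (1 / \<mu>inf)"
        using wnorm_triangle_diff[OF spd, of k ?y "x k \<omega>" ?z] by linarith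
      then have "(?N (?y - x k \<omega>))\<^sup>2 \<le> (?N (?y - ?z) + d * (1 / \<mu>inf))\<^sup>2"
        using spd by (intro power_mono) auto
      also have "\<dots> \<le> (1 + d) * W (M k) \<omega> + d * (1 + d) * (1 / \<mu>inf)\<^sup>2"
        unfolding W by (rule split_sq)
      finally have "(1 + \<eta> * \<alpha> k) * (?N (?y - x k \<omega>))\<^sup>2
          \<le> (1 + \<eta> * \<alpha> k) * ((1 + d) * W (M k) \<omega> + d * (1 + d) * (1 / \<mu>inf)\<^sup>2)"
        using \<eta>_nonneg \<alpha> by (intro mult_left_mono) auto
      then show ?thesis unfolding rhs_def by linarith
    qed
    finally have w: "(wdist_real (M k \<omega>) ?w X)\<^sup>2 \<le> rhs \<omega> / ?K" using K by (simp add: pos_le_divide_eq mult.commute)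
    have "(D (Suc k) \<omega>)\<^sup>2 \<le> (wdist_real (M k \<omega>) ?w X + \<epsilon> k)\<^sup>2"
      using elim(2) D_nonneg[OF elim(5)] by (intro power_mono) auto
    also have "\<dots> \<le> (1 + \<theta>) * (wdist_real (M k \<omega>) ?w X)\<^sup>2 + (1 + 1 / \<theta>) * (\<epsilon> k)\<^sup>2"
      by (rule power2_add_le_weighted[OF \<theta>])
    also have "\<dots> \<le> (1 + \<theta>) * (rhs \<omega> / ?K) + (1 + 1 / \<theta>) * (\<epsilon> k)\<^sup>2"
      using w \<theta> by (intro add_right_mono mult_left_mono) auto
    finally show ?case by simp
  qed
  have AE2: "AE \<omega> in \<Omega>. W (M (k - 1)) \<omega> \<le> (1 + d) * (D k \<omega>)\<^sup>2 + d * (1 + d) * (1 + 1 / \<mu>inf)\<^sup>2"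
    using norm_equiv U_contains AE_space
  proof eventually_elim
    case (elim \<omega>)
    let ?N = "wnorm (M (k - 1) \<omega>)" and ?y = "y (J \<omega>)" and ?z = "z (J \<omega>)"
    note spd = M_spd[OF elim(3)]
    have xU: "x k \<omega> \<in> U" using elim k by auto
    have J: "J \<omega> < N" "norm (?z - x k \<omega>) \<le> d" "?N (x k \<omega> - ?y) \<le> D k \<omega> + d"
      using sel elim(1,3) xU space by (auto simp: D_def)
    have W: "W (M (k - 1)) \<omega> = (?N (?y - ?z))\<^sup>2"
      unfolding W_def by (rule select[OF elim(3) J(1)])
    have "\<mu>inf * ?N (?z - x k \<omega>) \<le> d" using elim(1) J(2) order_trans by blast
    then have "?N (?z - x k \<omega>) \<le> d * (1 / \<mu>inf)" using \<mu>inf by (simp add: field_simps)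
    moreover have "?N (?y - ?z) \<le> ?N (x k \<omega> - ?y) + ?N (?z - x k \<omega>)"
      using wnorm_triangle_diff[OF spd, of "k - 1" ?y ?z "x k \<omega>"] wnorm_commute[OF spd, of "k - 1"] by metis
    ultimately have "?N (?y - ?z) \<le> D k \<omega> + d * (1 + 1 / \<mu>inf)" using J(3) by (simp add: distrib_left)
    then have "(?N (?y - ?z))\<^sup>2 \<le> (D k \<omega> + d * (1 + 1 / \<mu>inf))\<^sup>2" using spd by (intro power_mono) auto
    also have "\<dots> \<le> (1 + d) * (D k \<omega>)\<^sup>2 + d * (1 + d) * (1 + 1 / \<mu>inf)\<^sup>2" by (rule split_sq)
    finally show ?case unfolding W .
  qed
  have int_rhs: "integrable \<Omega> rhs"
    unfolding rhs_def[abs_def] using intW l2 intE lb by auto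
  have "(LINT \<omega>|\<Omega>. (D (Suc k) \<omega>)\<^sup>2) \<le> (LINT \<omega>|\<Omega>. (1 + \<theta>) / ?K * rhs \<omega> + (1 + 1 / \<theta>) * (\<epsilon> k)\<^sup>2)"
    using AE1 int_rhs by (intro integral_mono_AE D_integrable) auto
  also have "\<dots> = (1 + \<theta>) / ?K * (LINT \<omega>|\<Omega>. rhs \<omega>) + (1 + 1 / \<theta>) * (\<epsilon> k)\<^sup>2"
    using int_rhs by (simp add: prob_space)
  also have "(LINT \<omega>|\<Omega>. rhs \<omega>) = (1 + \<eta> * \<alpha> k) * ((1 + d) * (LINT \<omega>|\<Omega>. W (M k) \<omega>) + d * (1 + d) * (1 / \<mu>inf)\<^sup>2)
      + (\<alpha> k)\<^sup>2 * (LINT \<omega>|\<Omega>. l2 \<omega>) + 2 * \<alpha> k * (d * (2 * \<kappa>))"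
    unfolding rhs_def using intW l2(1) intE lb E0 by (simp add: prob_space)
  also have "(1 + \<theta>) / ?K * \<dots> \<le> (1 + \<theta>) / ?K * ((1 + \<eta> * \<alpha> k) * ((1 + d) * ((\<rho> k)\<^sup>2 * ((1 + d) * (LINT \<omega>|\<Omega>. (D k \<omega>)\<^sup>2)
              + d * (1 + d) * (1 + 1 / \<mu>inf)\<^sup>2)) + d * (1 + d) * (1 / \<mu>inf)\<^sup>2)
          + (\<alpha> k)\<^sup>2 * noise + 2 * \<alpha> k * (d * (2 * \<kappa>)))"
  proof -
    have "(LINT \<omega>|\<Omega>. W (M (k - 1)) \<omega>) \<le> (LINT \<omega>|\<Omega>. (1 + d) * (D k \<omega>)\<^sup>2 + d * (1 + d) * (1 + 1 / \<mu>inf)\<^sup>2)"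
      using AE2 D_integrable[OF k] by (intro integral_mono_AE intW0) auto
    also have "\<dots> = (1 + d) * (LINT \<omega>|\<Omega>. (D k \<omega>)\<^sup>2) + d * (1 + d) * (1 + 1 / \<mu>inf)\<^sup>2"
      using D_integrable[OF k] by (simp add: prob_space)
    finally have "(\<rho> k)\<^sup>2 * (LINT \<omega>|\<Omega>. W (M (k - 1)) \<omega>)
        \<le> (\<rho> k)\<^sup>2 * ((1 + d) * (LINT \<omega>|\<Omega>. (D k \<omega>)\<^sup>2) + d * (1 + d) * (1 + 1 / \<mu>inf)\<^sup>2)"
      by (intro mult_left_mono) auto
    then have "(LINT \<omega>|\<Omega>. W (M k) \<omega>)
        \<le> (\<rho> k)\<^sup>2 * ((1 + d) * (LINT \<omega>|\<Omega>. (D k \<omega>)\<^sup>2) + d * (1 + d) * (1 + 1 / \<mu>inf)\<^sup>2)"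
      using W_le by linarith
    then show ?thesis
      using \<theta> K d \<eta>_nonneg \<alpha> l2(2) by (intro mult_left_mono add_mono order_refl) auto
  qed
  finally show ?thesis by simp
qed

lemma expected_descent:
  assumes k: "1 \<le> k" and \<theta>: "0 < \<theta>" and K: "0 < 1 + (2 * c1 - \<tau>) * \<alpha> k"
  shows "(LINT \<omega>|\<Omega>. (D (Suc k) \<omega>)\<^sup>2)
    \<le> (1 + \<theta>) / (1 + (2 * c1 - \<tau>) * \<alpha> k)
        * ((1 + \<eta> * \<alpha> k) * ((\<rho> k)\<^sup>2 * (LINT \<omega>|\<Omega>. (D k \<omega>)\<^sup>2)) + (\<alpha> k)\<^sup>2 * noise)
      + (1 + 1 / \<theta>) * (\<epsilon> k)\<^sup>2"
    (is "?lhs \<le> ?rhs")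
proof -
  let ?f = "\<lambda>d. (1 + \<theta>) / (1 + (2 * c1 - \<tau>) * \<alpha> k)
        * ((1 + \<eta> * \<alpha> k) * ((1 + d) * ((\<rho> k)\<^sup>2 * ((1 + d) * (LINT \<omega>|\<Omega>. (D k \<omega>)\<^sup>2)
              + d * (1 + d) * (1 + 1 / \<mu>inf)\<^sup>2)) + d * (1 + d) * (1 / \<mu>inf)\<^sup>2)
          + (\<alpha> k)\<^sup>2 * noise + 2 * \<alpha> k * (d * (2 * \<kappa>)))
      + (1 + 1 / \<theta>) * (\<epsilon> k)\<^sup>2"
  have "(?f \<longlongrightarrow> ?f 0) (at_right 0)" by (intro tendsto_intros)
  moreover have "\<forall>\<^sub>F d in at_right 0. ?lhs \<le> ?f d"
    using eventually_at_right_less[of "0::real"]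
    by eventually_elim (rule expected_descent_approx[OF assms])
  ultimately have "?lhs \<le> ?f 0" by (intro tendsto_lowerbound) auto
  then show ?thesis by simp
qed

end

section \<open>The recursion for the scaled squared distance\<close>

text \<open>The exact step contracts by \<open>1 / (1 + b)\<close>. The weight \<open>\<theta>\<close> is chosen so that \<open>1 + \<theta> = (1 + b) / (1 + s * b / 2)\<close>:
  the contraction drops to \<open>1 / (1 + s * b / 2)\<close> and the accuracy error is multiplied by
  \<open>1 + 1 / \<theta>\<close>, of order \<open>1 / a\<close>.\<close>

lemma young_step_arith:
  fixes a \<eta> e s Y R \<gamma> :: real
  assumes a: "0 < a" and \<eta>: "0 \<le> \<eta>" and e: "0 < e" and s: "0 < s" "s < 2" and R: "0 \<le> R"
  defines "b \<equiv> e * a / (1 + \<eta> * a)"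
  defines "\<theta> \<equiv> b * (1 - s / 2) / (1 + s * b / 2)"
  shows "0 < \<theta>"
    and "(1 + \<theta>) / (1 + (\<eta> + e) * a) * ((1 + \<eta> * a) * Y + a\<^sup>2 * R) + (1 + 1 / \<theta>) * (\<gamma>\<^sup>2 * a ^ 3)
      \<le> (Y + (R + (1 + (\<eta> + e) * a) * (2 * (1 + \<eta> * a) + s * e * a) / ((2 - s) * e * (1 + \<eta> * a)) * \<gamma>\<^sup>2) * a\<^sup>2)
        / (1 + s * b / 2)"
proof -
  let ?h = "1 + \<eta> * a" and ?q = "1 + s * b / 2" and ?K = "1 + (\<eta> + e) * a"
  have h: "1 \<le> ?h" using a \<eta> by simp
  have b: "0 < b" unfolding b_def using e a h by (intro divide_pos_pos mult_pos_pos) linarith+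
  have q: "0 < ?q" using b s by (simp add: add_pos_pos)
  have K: "?K = ?h * (1 + b)"
    unfolding b_def using h by (simp add: field_simps)
  show \<theta>: "0 < \<theta>" unfolding \<theta>_def using b s q by simp
  have t1: "1 + \<theta> = (1 + b) / ?q"
    unfolding \<theta>_def using q by (simp add: add_divide_eq_iff) (simp add: algebra_simps)
  have "1 + 1 / \<theta> = (1 + \<theta>) / \<theta>" using \<theta> by (simp add: add_divide_distrib)
  also have "\<dots> = (1 + b) / (b * (1 - s / 2))"
    unfolding t1 unfolding \<theta>_def using q by simp
  finally have t2: "1 + 1 / \<theta> = (1 + b) / (b * (1 - s / 2))" .
  have b1: "0 < 1 + b" using b by simp
  have "(1 + \<theta>) / ?K = 1 / (?h * ?q)"
    unfolding t1 K using b1 by simp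
  then have "(1 + \<theta>) / ?K * (?h * Y + a\<^sup>2 * R) = (Y + a\<^sup>2 * R / ?h) / ?q"
    using h by (simp add: add_divide_distrib)
  also have "\<dots> \<le> (Y + a\<^sup>2 * R) / ?q"
  proof (intro divide_right_mono add_left_mono)
    have "a\<^sup>2 * R / ?h \<le> a\<^sup>2 * R / 1" using h R by (intro divide_left_mono) auto
    then show "a\<^sup>2 * R / ?h \<le> a\<^sup>2 * R" by simp
  qed (use q in simp)
  finally have 1: "(1 + \<theta>) / ?K * (?h * Y + a\<^sup>2 * R) \<le> (Y + a\<^sup>2 * R) / ?q" .
  have "(1 + b) / (b * (1 - s / 2)) * a = 2 * ?K / ((2 - s) * e)"
  proof -
    have "b * ?h = e * a" unfolding b_def using h by simp
    then have "a = b * ?h / e" using e by simp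
    then have "(1 + b) / (b * (1 - s / 2)) * a = (1 + b) / (b * (1 - s / 2)) * (b * ?h / e)" by simp
    also have "\<dots> = 2 * (?h * (1 + b)) / ((2 - s) * e)"
      using b s e by (simp add: divide_simps)
    finally show ?thesis unfolding K .
  qed
  moreover have "v * (\<gamma>\<^sup>2 * a ^ 3) = v * a * (\<gamma>\<^sup>2 * a\<^sup>2)" for v
    by (simp add: power3_eq_cube power2_eq_square)
  ultimately have "(1 + 1 / \<theta>) * (\<gamma>\<^sup>2 * a ^ 3) = 2 * ?K / ((2 - s) * e) * (\<gamma>\<^sup>2 * a\<^sup>2)"
    unfolding t2 by (simp only:)
  also have "\<dots> = (?K * (2 * ?h + s * e * a) / ((2 - s) * e * ?h) * \<gamma>\<^sup>2 * a\<^sup>2) / ?q"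
  proof -
    have "2 * ?h + s * e * a = 2 * ?h * ?q" unfolding b_def using h by (simp add: field_simps)
    moreover have "A * (2 * w * v) / (c * w) = 2 * A / c * v" if "w \<noteq> 0" for A w v c :: real
      using that by simp
    ultimately have "?K * (2 * ?h + s * e * a) / ((2 - s) * e * ?h) = 2 * ?K / ((2 - s) * e) * ?q"
      using h by (metis not_one_le_zero)
    then show ?thesis using q by simp
  qed
  finally have 2: "(1 + 1 / \<theta>) * (\<gamma>\<^sup>2 * a ^ 3)
      = (?K * (2 * ?h + s * e * a) / ((2 - s) * e * ?h) * \<gamma>\<^sup>2 * a\<^sup>2) / ?q" .
  show "(1 + \<theta>) / ?K * (?h * Y + a\<^sup>2 * R) + (1 + 1 / \<theta>) * (\<gamma>\<^sup>2 * a ^ 3)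
      \<le> (Y + (R + ?K * (2 * ?h + s * e * a) / ((2 - s) * e * ?h) * \<gamma>\<^sup>2) * a\<^sup>2) / ?q"
  proof -
    have "(Y + (R + t) * a\<^sup>2) / ?q = (Y + a\<^sup>2 * R) / ?q + t * a\<^sup>2 / ?q" for t
      by (simp add: add_divide_distrib[symmetric] algebra_simps)
    then show ?thesis unfolding 2 using 1 by simp
  qed
qed

text \<open>After division by \<open>1 + \<eta> * a\<close> the step enters only through \<open>a\<close> and \<open>a / (1 + \<eta> * a)\<close>, both increasing in \<open>a\<close>.\<close>

lemma accuracy_constant_mono:
  fixes a a' \<eta> e s :: real
  assumes a: "0 \<le> a" "a \<le> a'" and \<eta>: "0 \<le> \<eta>" and e: "0 < e" and s: "0 < s" "s < 2"
  shows "(1 + (\<eta> + e) * a) * (2 * (1 + \<eta> * a) + s * e * a) / ((2 - s) * e * (1 + \<eta> * a))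
    \<le> (1 + (\<eta> + e) * a') * (2 * (1 + \<eta> * a') + s * e * a') / ((2 - s) * e * (1 + \<eta> * a'))"
proof -
  have h: "0 < 1 + \<eta> * v" if "0 \<le> v" for v using that \<eta> by (simp add: add_pos_nonneg)
  have form: "(1 + (\<eta> + e) * v) * (2 * (1 + \<eta> * v) + s * e * v) / ((2 - s) * e * (1 + \<eta> * v))
      = (1 + (\<eta> + e) * v) * (2 + s * e * (v / (1 + \<eta> * v))) / ((2 - s) * e)" if "0 \<le> v" for v
  proof -
    have "(2 * w + s * e * v) / w = 2 + s * e * (v / w)" if "0 < w" for w
      using that by (simp add: add_divide_distrib)
    from this[OF h[OF that]]
    have "(2 * (1 + \<eta> * v) + s * e * v) / (1 + \<eta> * v) = 2 + s * e * (v / (1 + \<eta> * v))" .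
    moreover have "(A * B) / (C * w) = A * (B / w) / C" for A B C w :: real
      by (simp add: mult.commute)
    ultimately show ?thesis by (simp only:)
  qed
  have "a * (1 + \<eta> * a') \<le> a' * (1 + \<eta> * a)" using a by (simp add: algebra_simps)
  then have "a / (1 + \<eta> * a) \<le> a' / (1 + \<eta> * a')" using h[of a] h[of a'] a by (simp add: divide_simps mult.commute)
  then have "2 + s * e * (a / (1 + \<eta> * a)) \<le> 2 + s * e * (a' / (1 + \<eta> * a'))"
    using s e by (intro add_left_mono mult_left_mono) auto
  moreover have "1 + (\<eta> + e) * a \<le> 1 + (\<eta> + e) * a'" using a \<eta> e by (intro add_left_mono mult_left_mono) auto
  moreover have "0 \<le> a / (1 + \<eta> * a)" "0 \<le> (\<eta> + e) * a'" using h[of a] a \<eta> e by auto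
  ultimately have "(1 + (\<eta> + e) * a) * (2 + s * e * (a / (1 + \<eta> * a))) \<le> (1 + (\<eta> + e) * a') * (2 + s * e * (a' / (1 + \<eta> * a')))"
    using s e by (intro mult_mono add_nonneg_nonneg mult_nonneg_nonneg[of "s * e"]) auto
  then show ?thesis using form[of a] form[of a'] a s e by (simp add: divide_right_mono)
qed

context ispPPA_setting
begin

lemma \<rho>_ge_1: "1 \<le> \<rho> k"
  using precond by (cases "k = 0") (auto simp: preconditioner_condition_def)

lemma partial_product_le: "1 \<le> (\<Prod>i<k. \<rho> i)" "(\<Prod>i<k. \<rho> i) \<le> \<nu>inf"
proof -
  have inc: "incseq (\<lambda>k. \<Prod>i<k. \<rho> i)"
  proof (rule incseq_SucI)
    fix k
    have "0 \<le> (\<Prod>i<k. \<rho> i)" using \<rho>_ge_1 by (intro prod_nonneg) (auto intro: order_trans[OF zero_le_one])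
    from mult_left_mono[OF \<rho>_ge_1[of k] this] show "(\<Prod>i<k. \<rho> i) \<le> (\<Prod>i<Suc k. \<rho> i)" by simp
  qed
  then show "1 \<le> (\<Prod>i<k. \<rho> i)" using incseqD[OF inc, of 0 k] by simp
  have "(\<lambda>k. \<Prod>i<k. \<rho> i) \<longlonglongrightarrow> \<nu>inf" using precond by (simp add: preconditioner_condition_def)
  then show "(\<Prod>i<k. \<rho> i) \<le> \<nu>inf" by (rule incseq_le[OF inc])
qed

text \<open>Dividing by the partial products removes the factors \<open>(\<rho> k)\<^sup>2\<close> from the recursion.\<close>

definition "scaled k = (LINT \<omega>|\<Omega>. (D k \<omega>)\<^sup>2) / (\<Prod>i<k. \<rho> i)\<^sup>2"

lemma scaled_nonneg: "0 \<le> scaled k"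
  unfolding scaled_def by (intro divide_nonneg_nonneg Bochner_Integration.integral_nonneg) auto

lemma scaled_one: "scaled 1 = (infdist x1 X)\<^sup>2"
proof -
  have "(LINT \<omega>|\<Omega>. (D 1 \<omega>)\<^sup>2) = (LINT \<omega>|\<Omega>. (infdist x1 X)\<^sup>2)"
  proof (rule Bochner_Integration.integral_cong[OF refl])
    fix \<omega> assume "\<omega> \<in> space \<Omega>"
    then have "x 1 \<omega> = x1" "M 0 \<omega> = id"
      using run precond by (auto simp: ispPPA_run_def preconditioner_condition_def)
    then show "(D 1 \<omega>)\<^sup>2 = (infdist x1 X)\<^sup>2" by (simp add: D_def wdist_real_id[OF X_nonempty])
  qed
  moreover have "\<rho> 0 = 1" using precond by (simp add: preconditioner_condition_def)
  ultimately show ?thesis by (simp add: scaled_def prob_space)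
qed

lemma expected_distance_le_scaled:
  assumes k: "1 \<le> k"
  shows "(LINT \<omega>|\<Omega>. (infdist (x k \<omega>) X)\<^sup>2) \<le> (\<nu>inf * Linf)\<^sup>2 * scaled k"
proof -
  let ?\<nu> = "\<Prod>i<k. \<rho> i"
  have "(LINT \<omega>|\<Omega>. (infdist (x k \<omega>) X)\<^sup>2) \<le> (LINT \<omega>|\<Omega>. Linf\<^sup>2 * (D k \<omega>)\<^sup>2)"
  proof (rule integral_mono_AE')
    show "integrable \<Omega> (\<lambda>\<omega>. Linf\<^sup>2 * (D k \<omega>)\<^sup>2)" using D_integrable[OF k] by simp
    show "AE \<omega> in \<Omega>. (infdist (x k \<omega>) X)\<^sup>2 \<le> Linf\<^sup>2 * (D k \<omega>)\<^sup>2"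
      using norm_equiv AE_space
    proof eventually_elim
      case (elim \<omega>)
      have "infdist (x k \<omega>) X \<le> Linf * D k \<omega>"
        unfolding D_def using elim Linf by (intro infdist_le_wdist_real[OF M_spd X_nonempty]) auto
      then have "(infdist (x k \<omega>) X)\<^sup>2 \<le> (Linf * D k \<omega>)\<^sup>2" by (intro power_mono infdist_nonneg)
      then show ?case by (simp add: power_mult_distrib)
    qed
  qed simp
  also have "\<dots> = Linf\<^sup>2 * (?\<nu>\<^sup>2 * scaled k)"
    using partial_product_le(1)[of k] by (simp add: scaled_def del: prod_zero_iff)
  also have "\<dots> \<le> Linf\<^sup>2 * (\<nu>inf\<^sup>2 * scaled k)"
    using partial_product_le[of k] scaled_nonneg by (intro mult_left_mono mult_right_mono power_mono) auto
  finally show ?thesis by (simp add: power_mult_distrib mult_ac)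
qed

lemma scaled_recursion:
  assumes k: "1 \<le> k" and s: "0 < s" "s < 2" and e: "0 < e" "2 * c1 - \<tau> = \<eta> + e"
    and \<alpha>: "\<alpha> k \<le> u" and rate: "q * \<alpha> k \<le> s * (e * \<alpha> k / (1 + \<eta> * \<alpha> k)) / 2" "0 \<le> q"
    and \<epsilon>: "(\<epsilon> k)\<^sup>2 = \<gamma>\<^sup>2 * (\<alpha> k) ^ 3"
    and C: "C = noise + (1 + (\<eta> + e) * u) * (2 * (1 + \<eta> * u) + s * e * u) / ((2 - s) * e * (1 + \<eta> * u)) * \<gamma>\<^sup>2"
  shows "scaled (Suc k) \<le> (scaled k + C * (\<alpha> k)\<^sup>2) / (1 + q * \<alpha> k)"
proof -
  let ?a = "\<alpha> k" and ?E = "\<lambda>k. LINT \<omega>|\<Omega>. (D k \<omega>)\<^sup>2" and ?\<nu> = "\<Prod>i<k. \<rho> i"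
  define b where "b = e * ?a / (1 + \<eta> * ?a)"
  define \<theta> where "\<theta> = b * (1 - s / 2) / (1 + s * b / 2)"
  define T where "T a = (1 + (\<eta> + e) * a) * (2 * (1 + \<eta> * a) + s * e * a) / ((2 - s) * e * (1 + \<eta> * a)) * \<gamma>\<^sup>2" for a
  have a: "0 < ?a" using step_pos k by auto
  note ar = young_step_arith[OF a \<eta>_nonneg e(1) s noise_nonneg, folded b_def, folded \<theta>_def]
  have K: "0 < 1 + (\<eta> + e) * ?a" using a \<eta>_nonneg e by (simp add: add_pos_nonneg)
  have \<rho>: "1 \<le> \<rho> k" by (rule \<rho>_ge_1)
  have E0: "0 \<le> ?E j" for j by (intro Bochner_Integration.integral_nonneg) auto
  have qpos: "0 < 1 + q * ?a" using rate(2) a by (simp add: add_pos_nonneg)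
  have C0: "noise + T ?a \<le> C" "0 \<le> noise + T ?a"
  proof -
    have "T ?a \<le> T u"
      unfolding T_def using a by (intro mult_right_mono accuracy_constant_mono \<alpha> \<eta>_nonneg e(1) s) auto
    then show "noise + T ?a \<le> C" unfolding C T_def[of u, symmetric] by simp
    have "0 \<le> T ?a"
      unfolding T_def using K a s e(1) \<eta>_nonneg
      by (intro mult_nonneg_nonneg divide_nonneg_nonneg add_nonneg_nonneg) auto
    then show "0 \<le> noise + T ?a" using noise_nonneg by simp
  qed
  have "?E (Suc k) \<le> (1 + \<theta>) / (1 + (\<eta> + e) * ?a) * ((1 + \<eta> * ?a) * ((\<rho> k)\<^sup>2 * ?E k) + ?a\<^sup>2 * noise)
      + (1 + 1 / \<theta>) * (\<gamma>\<^sup>2 * ?a ^ 3)"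
    using expected_descent[OF k ar(1)] K unfolding e(2) \<epsilon> by simp
  also have "\<dots> \<le> ((\<rho> k)\<^sup>2 * ?E k + (noise + T ?a) * ?a\<^sup>2) / (1 + s * b / 2)"
    unfolding T_def by (rule ar(2))
  also have "\<dots> \<le> ((\<rho> k)\<^sup>2 * ?E k + (\<rho> k)\<^sup>2 * (C * ?a\<^sup>2)) / (1 + q * ?a)"
  proof (rule frac_le)
    have "(noise + T ?a) * ?a\<^sup>2 \<le> C * ?a\<^sup>2" using C0 by (intro mult_right_mono) auto
    also have "\<dots> \<le> (\<rho> k)\<^sup>2 * (C * ?a\<^sup>2)"
      using mult_right_mono[of 1 "(\<rho> k)\<^sup>2" "C * ?a\<^sup>2"] \<rho> C0 by simp
    finally show "(\<rho> k)\<^sup>2 * ?E k + (noise + T ?a) * ?a\<^sup>2 \<le> (\<rho> k)\<^sup>2 * ?E k + (\<rho> k)\<^sup>2 * (C * ?a\<^sup>2)" by simp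
    show "1 + q * ?a \<le> 1 + s * b / 2" using rate by (simp add: b_def)
    show "0 \<le> (\<rho> k)\<^sup>2 * ?E k + (\<rho> k)\<^sup>2 * (C * ?a\<^sup>2)" using E0 C0 by simp
  qed (rule qpos)
  finally have main: "?E (Suc k) \<le> (\<rho> k)\<^sup>2 * (?E k + C * ?a\<^sup>2) / (1 + q * ?a)" by (simp add: distrib_left)
  have \<nu>: "1 \<le> ?\<nu>" by (rule partial_product_le)
  have "scaled (Suc k) = ?E (Suc k) / (?\<nu> * \<rho> k)\<^sup>2" by (simp add: scaled_def)
  also have "\<dots> \<le> ((\<rho> k)\<^sup>2 * (?E k + C * ?a\<^sup>2) / (1 + q * ?a)) / (?\<nu> * \<rho> k)\<^sup>2"
    using main by (intro divide_right_mono) auto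
  also have "\<dots> = (?E k / ?\<nu>\<^sup>2 + C * ?a\<^sup>2 / ?\<nu>\<^sup>2) / (1 + q * ?a)"
    using \<rho> \<nu> by (simp add: power_mult_distrib add_divide_distrib mult.commute)
  also have "\<dots> \<le> (scaled k + C * ?a\<^sup>2) / (1 + q * ?a)"
  proof (intro divide_right_mono add_mono)
    have "v / w \<le> v" if "0 \<le> v" "1 \<le> w" for v w :: real
      using that mult_left_mono[of 1 w v] by (simp add: divide_le_eq)
    then show "C * ?a\<^sup>2 / ?\<nu>\<^sup>2 \<le> C * ?a\<^sup>2" using C0 \<nu> by (simp add: one_le_power)
  qed (use qpos in \<open>auto simp: scaled_def\<close>)
  finally show ?thesis .
qed

end

section \<open>Solving the recursion\<close>

text \<open>The function \<^term>\<open>varsigma b\<close> is the antiderivative of \<open>t powr (b - 1)\<close> that vanishes at \<open>1\<close>; it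
  enters through comparison of sums with integrals.\<close>

lemma varsigma_has_derivative:
  assumes "0 < t"
  shows "(varsigma b has_real_derivative t powr (b - 1)) (at t)"
proof (cases "b = 0")
  case True
  have "(ln has_real_derivative inverse t) (at t)"
    using assms by (intro DERIV_ln)
  then show ?thesis
    using True assms by (simp add: varsigma_def[abs_def] powr_minus)
next
  case False
  have "((\<lambda>t. (t powr b - 1) / b) has_real_derivative t powr (b - 1)) (at t)"
    using assms False by (auto intro!: derivative_eq_intros)
  then show ?thesis
    using False by (simp add: varsigma_def[abs_def])
qed

lemma varsigma_mean_value:
  assumes "0 < a" "a < c"
  obtains z where "a < z" "z < c" "varsigma b c - varsigma b a = (c - a) * z powr (b - 1)"
proof -
  have "\<And>t. a \<le> t \<Longrightarrow> t \<le> c \<Longrightarrow> DERIV (varsigma b) t :> t powr (b - 1)"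
    using assms by (intro varsigma_has_derivative) auto
  from MVT2[OF assms(2) this] show ?thesis
    using that by auto
qed

lemma varsigma_mono:
  assumes "0 < a" "a \<le> c"
  shows "varsigma b a \<le> varsigma b c"
proof (cases "a = c")
  case False
  then obtain z where "a < z" "varsigma b c - varsigma b a = (c - a) * z powr (b - 1)"
    using varsigma_mean_value[of a c b] assms by auto
  moreover have "0 \<le> (c - a) * z powr (b - 1)"
    using assms by simp
  ultimately show ?thesis
    by simp
qed simp

lemma varsigma_one [simp]: "varsigma b 1 = 0"
  by (simp add: varsigma_def)

lemma varsigma_mono_order:
  assumes "b \<le> c" "0 < t" "t \<le> 1"
  shows "varsigma b t \<le> varsigma c t"
proof -
  have "varsigma c 1 - varsigma b 1 \<le> varsigma c t - varsigma b t"
  proof (rule DERIV_nonpos_imp_nonincreasing[OF assms(3)])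
    fix x assume x: "t \<le> x" "x \<le> 1"
    then have "DERIV (\<lambda>x. varsigma c x - varsigma b x) x :> x powr (c - 1) - x powr (b - 1)"
      using assms by (intro DERIV_diff varsigma_has_derivative) auto
    moreover have "x powr (c - 1) \<le> x powr (b - 1)"
      using x assms by (intro powr_mono') auto
    ultimately show "\<exists>y. DERIV (\<lambda>x. varsigma c x - varsigma b x) x :> y \<and> y \<le> 0"
      by auto
  qed
  then show ?thesis by simp
qed

lemma sum_powr_le_varsigma:
  assumes "0 \<le> c" "1 \<le> n"
  shows "(\<Sum>j=2..n. real j powr (- c)) \<le> varsigma (1 - c) (real n)"
  using assms(2)
proof (induction n rule: dec_induct)
  case base
  show ?case by simp
next
  case (step n)
  obtain z where z: "real n < z" "z < real n + 1"
    "varsigma (1 - c) (real n + 1) - varsigma (1 - c) (real n) = z powr (- c)"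
    using varsigma_mean_value[of "real n" "real n + 1" "1 - c"] step by auto
  have "(real n + 1) powr (- c) \<le> z powr (- c)"
    using z step assms by (intro powr_mono2') auto
  then show ?case
    using step z by (simp add: add.commute)
qed

lemma varsigma_le_sum_powr:
  assumes "0 \<le> c"
  shows "varsigma (1 - c) (real n + 1) \<le> (\<Sum>j=1..n. real j powr (- c))"
proof (induction n)
  case (Suc n)
  obtain z where z: "real n + 1 < z" "z < real n + 2"
    "varsigma (1 - c) (real n + 2) - varsigma (1 - c) (real n + 1) = z powr (- c)"
    using varsigma_mean_value[of "real n + 1" "real n + 2" "1 - c"] by auto
  have "z powr (- c) \<le> (real n + 1) powr (- c)"
    using z assms by (intro powr_mono2') auto
  then show ?case
    using Suc z by (simp add: add.commute add.left_commute)
qed simp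

lemma one_minus_exp_ratio_mono:
  fixes \<kappa> t u :: real
  assumes "0 < \<kappa>" "0 < t" "t \<le> u"
  shows "t * (1 - exp (- (\<kappa> * u))) \<le> u * (1 - exp (- (\<kappa> * t)))"
proof -
  \<comment> \<open>convexity of the exponential: \<open>t\<close> lies between \<open>0\<close> and \<open>u\<close>\<close>
  have "convex_on UNIV (exp :: real \<Rightarrow> real)"
    by (intro f''_ge0_imp_convex[where f' = exp and f'' = exp]) (auto intro!: derivative_eq_intros)
  then have "exp ((1 - t / u) *\<^sub>R 0 + (t / u) *\<^sub>R (- (\<kappa> * u)))
      \<le> (1 - t / u) * exp 0 + (t / u) * exp (- (\<kappa> * u))"
    using assms by (intro convex_onD) auto
  then have "exp (- (\<kappa> * t)) \<le> 1 - t / u * (1 - exp (- (\<kappa> * u)))"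
    using assms by (simp add: algebra_simps)
  then have "t / u * (1 - exp (- (\<kappa> * u))) \<le> 1 - exp (- (\<kappa> * t))"
    by simp
  then show ?thesis
    using assms by (simp add: field_simps)
qed

lemma inverse_le_exp_neg:
  fixes q a u :: real
  assumes "0 < q" "0 \<le> a" "a \<le> u"
  shows "1 / (1 + q * a) \<le> exp (- (q / (1 + q * u) * a))"
proof -
  have qa: "0 \<le> q * a" "q * a \<le> q * u"
    using assms by (auto intro: mult_left_mono)
  have "1 / (1 + q * a) = 1 + (- (q * a / (1 + q * a)))"
    using qa by (simp add: field_simps)
  also have "\<dots> \<le> exp (- (q * a / (1 + q * a)))"
    by (rule exp_ge_add_one_self)
  also have "\<dots> \<le> exp (- (q / (1 + q * u) * a))"
    using qa by (simp add: frac_le)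
  finally show ?thesis .
qed

lemma contraction_unroll:
  fixes d \<alpha> :: "nat \<Rightarrow> real"
  assumes rec: "\<And>k. 1 \<le> k \<Longrightarrow> d (Suc k) \<le> (d k + C * (\<alpha> k)\<^sup>2) / (1 + q * \<alpha> k)"
    and q: "0 < q" and \<alpha>: "\<And>k. 1 \<le> k \<Longrightarrow> 0 \<le> \<alpha> k \<and> \<alpha> k \<le> u"
    and d: "\<And>k. 1 \<le> k \<Longrightarrow> 0 \<le> d k" and C: "0 \<le> C" and \<kappa>: "\<kappa> = q / (1 + q * u)"
  shows "d (Suc n) \<le> exp (- (\<kappa> * (\<Sum>j=1..n. \<alpha> j))) * d 1
    + C * (\<Sum>i=1..n. (\<alpha> i)\<^sup>2 * exp (- (\<kappa> * (\<Sum>j=i..n. \<alpha> j))))"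
proof (induction n)
  case (Suc n)
  let ?E = "exp (- (\<kappa> * \<alpha> (Suc n)))"
  have "d (Suc (Suc n)) \<le> (d (Suc n) + C * (\<alpha> (Suc n))\<^sup>2) * (1 / (1 + q * \<alpha> (Suc n)))"
    using rec[of "Suc n"] by simp
  also have "\<dots> \<le> (d (Suc n) + C * (\<alpha> (Suc n))\<^sup>2) * ?E"
    using inverse_le_exp_neg[OF q, of "\<alpha> (Suc n)" u] \<alpha>[of "Suc n"] d[of "Suc n"] C
    unfolding \<kappa> by (intro mult_left_mono) auto
  also have "\<dots> \<le> (exp (- (\<kappa> * (\<Sum>j=1..n. \<alpha> j))) * d 1
    + C * (\<Sum>i=1..n. (\<alpha> i)\<^sup>2 * exp (- (\<kappa> * (\<Sum>j=i..n. \<alpha> j)))) + C * (\<alpha> (Suc n))\<^sup>2) * ?E"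
    using Suc by (intro mult_right_mono) auto
  also have "\<dots> = exp (- (\<kappa> * (\<Sum>j=1..n. \<alpha> j))) * ?E * d 1
    + C * (\<Sum>i=1..n. (\<alpha> i)\<^sup>2 * (exp (- (\<kappa> * (\<Sum>j=i..n. \<alpha> j))) * ?E)) + C * ((\<alpha> (Suc n))\<^sup>2 * ?E)"
    by (simp add: algebra_simps sum_distrib_left sum_distrib_right)
  also have "\<dots> = exp (- (\<kappa> * (\<Sum>j=1..Suc n. \<alpha> j))) * d 1
    + C * (\<Sum>i=1..n. (\<alpha> i)\<^sup>2 * exp (- (\<kappa> * (\<Sum>j=i..Suc n. \<alpha> j)))) + C * ((\<alpha> (Suc n))\<^sup>2 * ?E)"
    by (simp add: exp_add[symmetric] algebra_simps)
  also have "\<dots> = exp (- (\<kappa> * (\<Sum>j=1..Suc n. \<alpha> j))) * d 1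
    + C * (\<Sum>i=1..Suc n. (\<alpha> i)\<^sup>2 * exp (- (\<kappa> * (\<Sum>j=i..Suc n. \<alpha> j))))"
    by (simp add: algebra_simps)
  finally show ?case .
qed simp

text \<open>Each \<open>\<alpha> i\<close> is at most a constant multiple of \<open>1 - exp (- \<kappa> * \<alpha> i)\<close>, so every summand is bounded by a multiple of
  an increment of \<open>exp (- \<kappa> * (\<Sum>j=i..n. \<alpha> j))\<close>, and these increments telescope to at most one.\<close>

lemma recent_noise_bound:
  fixes \<alpha> :: "nat \<Rightarrow> real"
  assumes \<alpha>: "\<And>k. 1 \<le> k \<Longrightarrow> 0 < \<alpha> k \<and> \<alpha> k \<le> u" and \<kappa>: "0 < \<kappa>"
  shows "(\<Sum>i=1..n. \<alpha> i * exp (- (\<kappa> * (\<Sum>j=i..n. \<alpha> j)))) \<le> u / (1 - exp (- (\<kappa> * u)))"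
proof -
  have u: "0 < u"
    using \<alpha>[of 1] by simp
  have D: "0 < 1 - exp (- (\<kappa> * u))"
    using \<kappa> u by simp
  let ?T = "u / (1 - exp (- (\<kappa> * u)))"
  let ?e = "\<lambda>i. exp (- (\<kappa> * (\<Sum>j=i..n. \<alpha> j)))"
  have "\<alpha> i * ?e i \<le> ?T * (?e (Suc i) - ?e i)" if "i \<in> {1..n}" for i
  proof -
    have S: "(\<Sum>j=i..n. \<alpha> j) = \<alpha> i + (\<Sum>j=Suc i..n. \<alpha> j)"
      using that by (simp add: sum.atLeast_Suc_atMost)
    have ei: "?e i = exp (- (\<kappa> * \<alpha> i)) * ?e (Suc i)"
      unfolding S by (simp add: exp_add[symmetric] algebra_simps)
    have a: "\<alpha> i \<le> ?T * (1 - exp (- (\<kappa> * \<alpha> i)))"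
      using one_minus_exp_ratio_mono[OF \<kappa>, of "\<alpha> i" u] \<alpha>[of i] that D
      by (simp add: field_simps)
    have "0 < \<alpha> i" using \<alpha>[of i] that by simp
    have "?e i \<le> ?e (Suc i)"
      unfolding ei using \<kappa> \<open>0 < \<alpha> i\<close> by simp
    then have "\<alpha> i * ?e i \<le> \<alpha> i * ?e (Suc i)"
      using \<open>0 < \<alpha> i\<close> by (intro mult_left_mono) auto
    also have "\<dots> \<le> ?T * (1 - exp (- (\<kappa> * \<alpha> i))) * ?e (Suc i)"
      using a by (intro mult_right_mono) auto
    also have "\<dots> = ?T * (?e (Suc i) - ?e i)"
      unfolding ei by (simp only: right_diff_distrib left_diff_distrib mult_1 mult_1_right mult.assoc)
    finally show ?thesis .
  qed
  then have "(\<Sum>i=1..n. \<alpha> i * ?e i) \<le> (\<Sum>i=1..n. ?T * (?e (Suc i) - ?e i))"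
    by (rule sum_mono)
  also have "\<dots> = ?T * (\<Sum>i=1..n. ?e (Suc i) - ?e i)"
    by (simp add: sum_distrib_left)
  also have "(\<Sum>i=1..n. ?e (Suc i) - ?e i) = ?e (Suc n) - ?e 1"
    by (subst sum_Suc_diff) auto
  also have "?T * \<dots> \<le> ?T * 1"
    using D u by (intro mult_left_mono) auto
  finally show ?thesis by simp
qed

lemma powr_neg_shift:
  assumes "1 \<le> i" "0 \<le> b"
  shows "real i powr (- b) \<le> 2 powr b * (real i + 1) powr (- b)"
proof -
  have "real i powr (- b) \<le> ((real i + 1) / 2) powr (- b)"
    using assms by (intro powr_mono2') auto
  also have "\<dots> = 2 powr b * (real i + 1) powr (- b)"
    by (simp add: powr_divide powr_minus field_simps)
  finally show ?thesis .
qed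

text \<open>Noise injected before time \<open>k / 2\<close> is followed by at least \<open>k / 2\<close> steps of size at least \<open>l * k powr - \<beta>\<close> and is
  damped accordingly. For later noise, one factor \<open>\<alpha> i\<close> is of order \<open>k powr - \<beta>\<close> and the remaining sum is bounded by
  \<open>recent_noise_bound\<close>. Powers of \<open>i\<close> are compared with powers of \<open>i + 1\<close>, at the cost of \<open>4 powr \<beta>\<close>, so that
  the sums start at \<open>2\<close> and stay below the integral from \<open>1\<close>.\<close>

lemma recursion_rate_subharmonic:
  fixes d \<alpha> :: "nat \<Rightarrow> real"
  assumes rec: "\<And>k. 1 \<le> k \<Longrightarrow> d (Suc k) \<le> (d k + C * (\<alpha> k)\<^sup>2) / (1 + q * \<alpha> k)"
    and q: "0 < q" and C: "0 \<le> C" and d: "\<And>k. 1 \<le> k \<Longrightarrow> 0 \<le> d k"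
    and l: "0 < l" and \<beta>: "0 < \<beta>" "\<beta> \<le> 1"
    and step: "\<And>k. 1 \<le> k \<Longrightarrow> l * real k powr (- \<beta>) \<le> \<alpha> k \<and> \<alpha> k \<le> u * real k powr (- \<beta>)"
    and k: "1 \<le> k"
  shows "d k \<le> exp (- (q * l / (1 + q * u) * varsigma (1 - \<beta>) (real k))) * d 1
      + C * 4 powr \<beta> * (u\<^sup>2 / (1 - exp (- (q * u / (1 + q * u))))) * (1 / real k powr \<beta>)
      + C * 4 powr \<beta> * u\<^sup>2 * exp (- (q * l / (2 * (1 + q * u)) * real k powr (1 - \<beta>)))
          * varsigma (1 - 2 * \<beta>) (real k / 2)"
proof -
  define \<kappa> where "\<kappa> = q / (1 + q * u)"
  have lu: "l \<le> u" using step[of 1] by simp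
  then have u: "0 < u" using l by simp
  have \<kappa>: "0 < \<kappa>" unfolding \<kappa>_def using q u by (simp add: add_pos_pos)
  have \<alpha>: "0 < \<alpha> k \<and> \<alpha> k \<le> u" if "1 \<le> k" for k
  proof -
    have "0 < l * real k powr (- \<beta>)" using l that by simp
    moreover have "real k powr (- \<beta>) \<le> 1" 
      using that \<beta> powr_mono[of "- \<beta>" 0 "real k"] by simp
    then have "u * real k powr (- \<beta>) \<le> u" using u by (simp add: mult_left_le)
    ultimately show ?thesis using step[OF that] by linarith
  qed
  have e1: "q * l / (1 + q * u) = \<kappa> * l" "q * u / (1 + q * u) = \<kappa> * u"
    "q * l / (2 * (1 + q * u)) = \<kappa> * l / 2"
    unfolding \<kappa>_def by (auto simp: field_simps)
  have den: "0 < 1 - exp (- (\<kappa> * u))" "1 - exp (- (\<kappa> * u)) \<le> 1" using \<kappa> u by auto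
  let ?goal = "d k \<le> exp (- (\<kappa> * l * varsigma (1 - \<beta>) (real k))) * d 1
      + C * 4 powr \<beta> * (u\<^sup>2 / (1 - exp (- (\<kappa> * u)))) * (1 / real k powr \<beta>)
      + C * 4 powr \<beta> * u\<^sup>2 * exp (- (\<kappa> * l / 2 * real k powr (1 - \<beta>)))
          * varsigma (1 - 2 * \<beta>) (real k / 2)"
  have ?goal
  proof (cases "k = 1")
    case True
    \<comment> \<open>here \<open>varsigma (1 - 2 * \<beta>) (1 / 2)\<close> is negative, but it is at least \<open>- 1\<close>\<close>
    have int: "- varsigma (1 - 2 * \<beta>) (1 / 2) \<le> 1"
      using varsigma_mono_order[of "- 1" "1 - 2 * \<beta>" "1 / 2"] \<beta> by (simp add: varsigma_def powr_minus)
    let ?a = "exp (- (\<kappa> * l / 2))"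
    have "?a * - varsigma (1 - 2 * \<beta>) (1 / 2) \<le> 1 * 1"
      by (rule mult_mono) (use int \<kappa> l varsigma_mono[of "1/2" 1 "1 - 2 * \<beta>"] in auto)
    also have "1 * 1 \<le> 1 / (1 - exp (- (\<kappa> * u)))"
      using den by simp
    finally have "C * 4 powr \<beta> * u\<^sup>2 * (?a * - varsigma (1 - 2 * \<beta>) (1 / 2))
        \<le> C * 4 powr \<beta> * u\<^sup>2 * (1 / (1 - exp (- (\<kappa> * u))))"
      using C by (intro mult_left_mono) auto
    then show ?thesis using True by (simp add: algebra_simps)
  next
    case False
    then obtain n where n: "k = Suc n" "1 \<le> n" using k by (cases k) auto
    let ?S = "\<lambda>i. \<Sum>j=i..n. \<alpha> j"
    let ?J1 = "{i\<in>{1..n}. 2 * (i + 1) \<le> k}" and ?J2 = "{i\<in>{1..n}. \<not> 2 * (i + 1) \<le> k}"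
    have rk: "real k = real n + 1" using n by simp
    have first: "exp (- (\<kappa> * ?S 1)) \<le> exp (- (\<kappa> * l * varsigma (1 - \<beta>) (real k)))"
    proof -
      have "l * varsigma (1 - \<beta>) (real k) \<le> l * (\<Sum>j=1..n. real j powr (- \<beta>))"
        unfolding rk using varsigma_le_sum_powr[of \<beta> n] \<beta> l by (intro mult_left_mono) auto
      also have "\<dots> \<le> ?S 1"
        unfolding sum_distrib_left using step by (intro sum_mono) auto
      finally show ?thesis using \<kappa> by (simp add: mult.assoc)
    qed
    have J2: "(\<Sum>i\<in>?J2. (\<alpha> i)\<^sup>2 * exp (- (\<kappa> * ?S i)))
        \<le> 4 powr \<beta> * (u\<^sup>2 / (1 - exp (- (\<kappa> * u)))) * (1 / real k powr \<beta>)"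
    proof -
      have b: "\<alpha> i \<le> u * 4 powr \<beta> * (1 / real k powr \<beta>)" if "i \<in> ?J2" for i
      proof -
        have "\<alpha> i \<le> u * real i powr (- \<beta>)" using step that by auto
        also have "\<dots> \<le> u * (2 powr \<beta> * (real i + 1) powr (- \<beta>))"
          using powr_neg_shift[of i \<beta>] that \<beta> u by (intro mult_left_mono) auto
        also have "\<dots> \<le> u * (2 powr \<beta> * (real k / 2) powr (- \<beta>))"
          using that \<beta> u k by (intro mult_left_mono powr_mono2') auto
        also have "\<dots> = u * (2 powr \<beta> * 2 powr \<beta>) * (1 / real k powr \<beta>)"
          by (simp add: powr_divide powr_minus field_simps)
        also have "2 powr \<beta> * 2 powr \<beta> = (4::real) powr \<beta>"
          by (simp add: powr_mult[symmetric])
        finally show ?thesis .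
      qed
      have "(\<Sum>i\<in>?J2. (\<alpha> i)\<^sup>2 * exp (- (\<kappa> * ?S i)))
          \<le> (\<Sum>i\<in>?J2. (u * 4 powr \<beta> * (1 / real k powr \<beta>)) * (\<alpha> i * exp (- (\<kappa> * ?S i))))"
      proof (rule sum_mono)
        fix i assume i: "i \<in> ?J2"
        have "\<alpha> i * (\<alpha> i * exp (- (\<kappa> * ?S i)))
            \<le> (u * 4 powr \<beta> * (1 / real k powr \<beta>)) * (\<alpha> i * exp (- (\<kappa> * ?S i)))"
          using b[OF i] \<alpha>[of i] i by (intro mult_right_mono) auto
        then show "(\<alpha> i)\<^sup>2 * exp (- (\<kappa> * ?S i))
            \<le> (u * 4 powr \<beta> * (1 / real k powr \<beta>)) * (\<alpha> i * exp (- (\<kappa> * ?S i)))"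
          by (simp add: power2_eq_square mult.assoc)
      qed
      also have "\<dots> \<le> (\<Sum>i=1..n. (u * 4 powr \<beta> * (1 / real k powr \<beta>)) * (\<alpha> i * exp (- (\<kappa> * ?S i))))"
        using \<alpha> u by (intro sum_mono2) (auto intro!: mult_nonneg_nonneg simp: less_imp_le)
      also have "\<dots> = (u * 4 powr \<beta> * (1 / real k powr \<beta>)) * (\<Sum>i=1..n. \<alpha> i * exp (- (\<kappa> * ?S i)))"
        by (simp add: sum_distrib_left)
      also have "\<dots> \<le> (u * 4 powr \<beta> * (1 / real k powr \<beta>)) * (u / (1 - exp (- (\<kappa> * u))))"
        using recent_noise_bound[of \<alpha> u \<kappa> n] \<alpha> \<kappa> u by (intro mult_left_mono) auto
      finally show ?thesis by (simp add: power2_eq_square mult_ac)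
    qed
    have J1: "(\<Sum>i\<in>?J1. (\<alpha> i)\<^sup>2 * exp (- (\<kappa> * ?S i)))
        \<le> 4 powr \<beta> * u\<^sup>2 * exp (- (\<kappa> * l / 2 * real k powr (1 - \<beta>))) * varsigma (1 - 2 * \<beta>) (real k / 2)"
    proof -
      let ?c = "4 powr \<beta> * u\<^sup>2 * exp (- (\<kappa> * l / 2 * real k powr (1 - \<beta>)))"
      have "(\<alpha> i)\<^sup>2 * exp (- (\<kappa> * ?S i)) \<le> ?c * real (i + 1) powr (- (2 * \<beta>))" if i: "i \<in> ?J1" for i
      proof -
        have "\<alpha> i \<le> u * real i powr (- \<beta>)" using step that by auto
        also have "\<dots> \<le> u * (2 powr \<beta> * (real i + 1) powr (- \<beta>))"
          using powr_neg_shift[of i \<beta>] that \<beta> u by (intro mult_left_mono) auto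
        finally have "(\<alpha> i)\<^sup>2 \<le> (u * (2 powr \<beta> * (real i + 1) powr (- \<beta>)))\<^sup>2"
          using \<alpha>[of i] that by (intro power_mono) auto
        also have "\<dots> = u\<^sup>2 * (2 powr \<beta> * 2 powr \<beta>) * ((real i + 1) powr (- \<beta>) * (real i + 1) powr (- \<beta>))"
          by (simp add: power2_eq_square mult_ac)
        also have "2 powr \<beta> * 2 powr \<beta> = (4::real) powr \<beta>"
          by (simp add: powr_mult[symmetric])
        also have "(real i + 1) powr (- \<beta>) * (real i + 1) powr (- \<beta>) = real (i + 1) powr (- (2 * \<beta>))"
          by (simp add: powr_add[symmetric] add.commute)
        finally have a2: "(\<alpha> i)\<^sup>2 \<le> u\<^sup>2 * 4 powr \<beta> * real (i + 1) powr (- (2 * \<beta>))" .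
        have "l / 2 * real k powr (1 - \<beta>) = (real k / 2) * (l * real k powr (- \<beta>))"
          using k by (simp add: powr_diff powr_minus field_simps)
        also have "\<dots> \<le> real (card {i..n}) * (l * real k powr (- \<beta>))"
          using i n l by (intro mult_right_mono) auto
        also have "\<dots> = (\<Sum>j=i..n. l * real k powr (- \<beta>))" by simp
        also have "\<dots> \<le> ?S i"
        proof (rule sum_mono)
          fix j assume j: "j \<in> {i..n}"
          have "l * real k powr (- \<beta>) \<le> l * real j powr (- \<beta>)"
            using j i n \<beta> l by (intro mult_left_mono powr_mono2') auto
          also have "\<dots> \<le> \<alpha> j" using step j i by auto
          finally show "l * real k powr (- \<beta>) \<le> \<alpha> j" .
        qed
        finally have "\<kappa> * (l / 2 * real k powr (1 - \<beta>)) \<le> \<kappa> * ?S i"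
          using \<kappa> by (intro mult_left_mono) auto
        then have ex: "exp (- (\<kappa> * ?S i)) \<le> exp (- (\<kappa> * l / 2 * real k powr (1 - \<beta>)))"
          by simp
        show ?thesis
          using mult_mono[OF a2 ex] by (simp add: mult_ac)
      qed
      then have "(\<Sum>i\<in>?J1. (\<alpha> i)\<^sup>2 * exp (- (\<kappa> * ?S i))) \<le> (\<Sum>i\<in>?J1. ?c * real (i + 1) powr (- (2 * \<beta>)))"
        by (rule sum_mono)
      also have "\<dots> = ?c * (\<Sum>i\<in>?J1. real (i + 1) powr (- (2 * \<beta>)))"
        by (simp add: sum_distrib_left)
      also have "(\<Sum>i\<in>?J1. real (i + 1) powr (- (2 * \<beta>))) = (\<Sum>j\<in>{2..k div 2}. real j powr (- (2 * \<beta>)))"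
        by (rule sum.reindex_bij_witness[of _ "\<lambda>j. j - 1" Suc]) (use n in auto)
      also have "?c * \<dots> \<le> ?c * varsigma (1 - 2 * \<beta>) (real (k div 2))"
        using sum_powr_le_varsigma[of "2 * \<beta>" "k div 2"] \<beta> n by (intro mult_left_mono) auto
      also have "\<dots> \<le> ?c * varsigma (1 - 2 * \<beta>) (real k / 2)"
        using n by (intro mult_left_mono varsigma_mono) auto
      finally show ?thesis .
    qed
    have "{1..n} = ?J1 \<union> ?J2" by auto
    then have split: "(\<Sum>i=1..n. (\<alpha> i)\<^sup>2 * exp (- (\<kappa> * ?S i)))
      = (\<Sum>i\<in>?J1. (\<alpha> i)\<^sup>2 * exp (- (\<kappa> * ?S i))) + (\<Sum>i\<in>?J2. (\<alpha> i)\<^sup>2 * exp (- (\<kappa> * ?S i)))"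
      by (metis (no_types, lifting) sum.union_disjoint finite_atLeastAtMost finite_Un disjoint_iff mem_Collect_eq)
    have "d k \<le> exp (- (\<kappa> * ?S 1)) * d 1 + C * (\<Sum>i=1..n. (\<alpha> i)\<^sup>2 * exp (- (\<kappa> * ?S i)))"
      unfolding n(1) using \<alpha> less_imp_le by (intro contraction_unroll[where q = q and u = u] rec q d C \<kappa>_def) auto
    also have "\<dots> \<le> exp (- (\<kappa> * l * varsigma (1 - \<beta>) (real k))) * d 1
        + C * (4 powr \<beta> * u\<^sup>2 * exp (- (\<kappa> * l / 2 * real k powr (1 - \<beta>))) * varsigma (1 - 2 * \<beta>) (real k / 2)
          + 4 powr \<beta> * (u\<^sup>2 / (1 - exp (- (\<kappa> * u)))) * (1 / real k powr \<beta>))"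
      unfolding split using first d[of 1] C J1 J2 by (intro add_mono mult_left_mono mult_right_mono) auto
    finally show ?thesis by (simp add: algebra_simps)
  qed
  then show ?thesis unfolding e1 .
qed

lemma ln_add_one_ge_pade:
  assumes "0 \<le> (x::real)"
  shows "2 * x / (2 + x) \<le> ln (1 + x)"
proof -
  have "ln (1 + 0) - 2 * 0 / (2 + 0) \<le> ln (1 + x) - 2 * x / (2 + x)"
  proof (rule DERIV_nonneg_imp_nondecreasing[OF assms])
    fix t :: real assume t: "0 \<le> t" "t \<le> x"
    have "DERIV (\<lambda>t. ln (1 + t) - 2 * t / (2 + t)) t :> 1 / (1 + t) - (2 * (2 + t) - 2 * t) / ((2 + t) * (2 + t))"
    proof (rule DERIV_diff)
      show "DERIV (\<lambda>t. ln (1 + t)) t :> 1 / (1 + t)"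
        using t by (auto intro!: derivative_eq_intros)
      have "DERIV (\<lambda>t. 2 * t) t :> 2" "DERIV (\<lambda>t. 2 + t) t :> 1"
        by (auto intro!: derivative_eq_intros)
      from DERIV_divide[OF this] show "DERIV (\<lambda>t. 2 * t / (2 + t)) t :> (2 * (2 + t) - 2 * t) / ((2 + t) * (2 + t))"
        using t by simp
    qed
    moreover have "1 / (1 + t) - (2 * (2 + t) - 2 * t) / ((2 + t) * (2 + t)) = t\<^sup>2 / ((1 + t) * (2 + t)\<^sup>2)"
      using t by (simp add: divide_simps power2_eq_square) (simp add: algebra_simps)
    ultimately show "\<exists>y. DERIV (\<lambda>t. ln (1 + t) - 2 * t / (2 + t)) t :> y \<and> 0 \<le> y"
      using t by (intro exI[of _ "t\<^sup>2 / ((1 + t) * (2 + t)\<^sup>2)"] conjI) auto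
  qed
  then show ?thesis by simp
qed

text \<open>Take logarithms, with \<open>2 * x / (2 + x) \<le> ln (1 + x)\<close> at \<open>x = p / j\<close>; replacing \<open>2 * j + p\<close> by \<open>(2 + p) * j\<close>,
  which is sharp at \<open>j = 1\<close>, makes the bound proportional to \<open>1 / j\<close> and yields the exponent \<open>e\<close>.\<close>

lemma contraction_factor_ge_powr:
  fixes p :: real
  assumes "0 < p" "1 \<le> j" and e: "e = 2 * p / (2 + p)"
  shows "(1 + 1 / real j) powr e \<le> 1 + p / real j"
proof -
  have j: "0 < real j" "1 \<le> real j" using assms by auto
  have e0: "0 \<le> e" unfolding e using assms by simp
  have "e * ln (1 + 1 / real j) \<le> e * (1 / real j)"
    using e0 j by (intro mult_left_mono ln_add_one_self_le_self) auto
  also have "\<dots> = 2 * p / ((2 + p) * real j)"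
    unfolding e by simp
  also have "\<dots> \<le> 2 * p / (2 * real j + p)"
  proof (rule divide_left_mono)
    show "2 * real j + p \<le> (2 + p) * real j"
      using mult_left_mono[of 1 "real j" p] assms j by (simp add: algebra_simps)
    show "0 < (2 + p) * real j * (2 * real j + p)"
      using assms j by (intro mult_pos_pos add_pos_pos) auto
  qed (use assms in auto)
  also have "\<dots> = 2 * (p / real j) / (2 + p / real j)"
    using j assms by (simp add: field_simps)
  also have "\<dots> \<le> ln (1 + p / real j)"
    using ln_add_one_ge_pade[of "p / real j"] j assms by simp
  finally have "exp (e * ln (1 + 1 / real j)) \<le> exp (ln (1 + p / real j))"
    by simp
  moreover have "0 < 1 + p / real j" "0 < 1 + 1 / real j"
    using assms j by (auto intro: add_pos_pos)
  ultimately show ?thesis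
    by (simp add: powr_def)
qed

text \<open>Induction from \<open>k = 2\<close>, so that the first contraction factor \<open>1 / (1 + q * l)\<close> is kept exactly. The factor \<open>4\<close>
  absorbs \<open>2 powr e\<close> in the first term and \<open>(k + 1)\<^sup>2 / k\<^sup>2\<close> in the noise.\<close>

lemma recursion_rate_harmonic:
  fixes d \<alpha> :: "nat \<Rightarrow> real"
  assumes rec: "\<And>k. 1 \<le> k \<Longrightarrow> d (Suc k) \<le> (d k + C * (\<alpha> k)\<^sup>2) / (1 + q * \<alpha> k)"
    and q: "0 < q" and C: "0 \<le> C" and d: "\<And>k. 1 \<le> k \<Longrightarrow> 0 \<le> d k" and l: "0 < l"
    and step: "\<And>k. 1 \<le> k \<Longrightarrow> l / real k \<le> \<alpha> k \<and> \<alpha> k \<le> u / real k"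
    and k: "2 \<le> k" and e: "e = 2 * (q * l) / (2 + q * l)"
  shows "d k \<le> 4 * d 1 / (1 + q * l) * real k powr (- e)
      + 4 * C * u\<^sup>2 * (real k powr (- e) * varsigma (e - 1) (real k))"
proof -
  let ?p = "q * l"
  have p: "0 < ?p" using q l by simp
  have e02: "0 < e" "e < 2" unfolding e using p by (auto simp: field_simps)
  have e_le: "2 powr e \<le> (4::real)" using powr_mono[of e 2 "2::real"] e02 by simp
  have step_le: "d (Suc k) \<le> (d k + C * u\<^sup>2 / (real k)\<^sup>2) / (1 + ?p / real k)" if "1 \<le> k" for k
  proof -
    have k: "0 < real k" using that by simp
    have a: "0 \<le> \<alpha> k" using step[OF that] k l by (meson divide_nonneg_pos less_imp_le order_trans)
    have "(\<alpha> k)\<^sup>2 \<le> (u / real k)\<^sup>2" using step[OF that] a by (intro power_mono) auto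
    then have n: "d k + C * (\<alpha> k)\<^sup>2 \<le> d k + C * u\<^sup>2 / (real k)\<^sup>2"
      using mult_left_mono[OF _ C] by (fastforce simp: power_divide)
    have "?p / real k \<le> q * \<alpha> k" using step[OF that] q k by (simp add: field_simps)
    then have "(d k + C * (\<alpha> k)\<^sup>2) / (1 + q * \<alpha> k) \<le> (d k + C * u\<^sup>2 / (real k)\<^sup>2) / (1 + ?p / real k)"
      using n d[OF that] C p k by (intro frac_le) (auto intro!: add_pos_nonneg)
    then show ?thesis using rec[OF that] by linarith
  qed
  let ?A = "2 powr e * d 1 / (1 + ?p)"
  have main: "d k \<le> real k powr (- e) * (?A + 4 * C * u\<^sup>2 * (\<Sum>j=2..k. real j powr (- (2 - e))))"
    using k
  proof (induction k rule: dec_induct)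
    case base
    have "d 2 \<le> (d 1 + C * u\<^sup>2) / (1 + ?p)" using step_le[of 1] by (simp add: numeral_2_eq_2)
    also have "\<dots> \<le> d 1 / (1 + ?p) + C * u\<^sup>2"
    proof -
      have "C * u\<^sup>2 / (1 + ?p) \<le> C * u\<^sup>2 / 1"
        using p C by (intro divide_left_mono) auto
      then show ?thesis by (simp add: add_divide_distrib)
    qed
    also have "\<dots> = 2 powr (- e) * (?A + 4 * C * u\<^sup>2 * (2 powr (- (2 - e))))"
    proof -
      have "2 powr (- e) * 2 powr e = (1::real)" "2 powr (- e) * 2 powr (- (2 - e)) = (2::real) powr (- 2)"
        by (simp_all add: powr_add[symmetric])
      moreover have "(2::real) powr (- 2) = 1 / 4"
        by (simp add: powr_minus)
      moreover have "2 powr (- e) * (?A + 4 * C * u\<^sup>2 * (2 powr (- (2 - e))))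
          = (2 powr (- e) * 2 powr e) * (d 1 / (1 + ?p)) + 4 * C * u\<^sup>2 * (2 powr (- e) * 2 powr (- (2 - e)))"
        by (simp add: algebra_simps)
      ultimately show ?thesis by (simp only:)
    qed
    finally show ?case by simp
  next
    case (step k)
    have k: "1 \<le> k" "0 < real k" using step by auto
    let ?S = "\<lambda>k. \<Sum>j=2..k. real j powr (- (2 - e))"
    have "d (Suc k) \<le> d k / (1 + ?p / real k) + C * u\<^sup>2 / (real k)\<^sup>2 / (1 + ?p / real k)"
      using step_le[OF k(1)] by (simp add: add_divide_distrib)
    also have "\<dots> \<le> real (Suc k) powr (- e) * (?A + 4 * C * u\<^sup>2 * ?S k) + 4 * C * u\<^sup>2 * (1 / (real (Suc k))\<^sup>2)"
    proof (rule add_mono)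
      have pos: "0 < 1 + ?p / real k" "0 < (1 + 1 / real k) powr e"
        using p k by (auto simp: add_pos_pos[THEN less_imp_neq, symmetric] intro: add_pos_pos)
      have "d k / (1 + ?p / real k) \<le> d k / (1 + 1 / real k) powr e"
        using contraction_factor_ge_powr[OF p k(1) e] d[OF k(1)] k p
        by (intro divide_left_mono mult_pos_pos pos) auto
      also have "\<dots> \<le> (real k powr (- e) * (?A + 4 * C * u\<^sup>2 * ?S k)) / (1 + 1 / real k) powr e"
        using step by (intro divide_right_mono) auto
      also have "\<dots> = real k powr (- e) / (1 + 1 / real k) powr e * (?A + 4 * C * u\<^sup>2 * ?S k)"
        by simp
      also have "real k powr (- e) / (1 + 1 / real k) powr e = real (Suc k) powr (- e)"
      proof -
        have "1 + 1 / real k = real (Suc k) / real k" using k by (simp add: field_simps)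
        then show ?thesis using k by (simp add: powr_divide powr_minus field_simps)
      qed
      finally show "d k / (1 + ?p / real k) \<le> real (Suc k) powr (- e) * (?A + 4 * C * u\<^sup>2 * ?S k)" .
      have "C * u\<^sup>2 / (real k)\<^sup>2 / (1 + ?p / real k) \<le> C * u\<^sup>2 / (real k)\<^sup>2 / 1"
        using p k C by (intro divide_left_mono) (auto intro: add_pos_pos)
      also have "\<dots> \<le> C * u\<^sup>2 * (4 / (real (Suc k))\<^sup>2)"
      proof -
        have "(real (Suc k))\<^sup>2 \<le> (2 * real k)\<^sup>2" using k by (intro power_mono) auto
        then have "1 / (real k)\<^sup>2 \<le> 4 / (real (Suc k))\<^sup>2"
          using k by (simp add: divide_simps power_mult_distrib)
        then have "C * u\<^sup>2 * (1 / (real k)\<^sup>2) \<le> C * u\<^sup>2 * (4 / (real (Suc k))\<^sup>2)"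
          using C by (intro mult_left_mono) auto
        then show ?thesis by simp
      qed
      finally show "C * u\<^sup>2 / (real k)\<^sup>2 / (1 + ?p / real k) \<le> 4 * C * u\<^sup>2 * (1 / (real (Suc k))\<^sup>2)"
        by (simp add: mult_ac)
    qed
    also have "1 / (real (Suc k))\<^sup>2 = real (Suc k) powr (- 2)"
      by (simp add: powr_minus divide_inverse)
    also have "\<dots> = real (Suc k) powr (- e) * real (Suc k) powr (- (2 - e))"
      by (simp add: powr_add[symmetric])
    also have "real (Suc k) powr (- e) * (?A + 4 * C * u\<^sup>2 * ?S k)
        + 4 * C * u\<^sup>2 * (real (Suc k) powr (- e) * real (Suc k) powr (- (2 - e)))
      = real (Suc k) powr (- e) * (?A + 4 * C * u\<^sup>2 * (?S k + real (Suc k) powr (- (2 - e))))"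
      by (simp only: distrib_left mult.assoc mult.left_commute add.assoc)
    also have "?S k + real (Suc k) powr (- (2 - e)) = ?S (Suc k)"
      using step by simp
    finally show ?case .
  qed
  also have "\<dots> \<le> real k powr (- e) * (4 * d 1 / (1 + ?p) + 4 * C * u\<^sup>2 * varsigma (e - 1) (real k))"
  proof (intro mult_left_mono add_mono)
    show "?A \<le> 4 * d 1 / (1 + ?p)"
      using e_le d[of 1] p by (intro divide_right_mono mult_right_mono) auto
    show "(\<Sum>j=2..k. real j powr (- (2 - e))) \<le> varsigma (e - 1) (real k)"
      using sum_powr_le_varsigma[of "2 - e" k] e02 k by simp
  qed (use C in auto)
  finally show ?thesis by (simp add: algebra_simps)
qed

text \<open>The three regimes are the signs of \<open>e - 1\<close>: the weighted noise \<open>j powr (e - 2)\<close> has a convergent sum, a logarithmic one,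
  or one that grows like \<open>k powr (e - 1)\<close>.\<close>

lemma powr_neg_times_varsigma_le:
  assumes "1 \<le> k" "0 < p" and e: "e = 2 * p / (2 + p)"
  shows "p < 2 \<Longrightarrow> real k powr (- e) * varsigma (e - 1) (real k) \<le> (2 + p) / (2 - p) * real k powr (- e)"
    and "p = 2 \<Longrightarrow> real k powr (- e) * varsigma (e - 1) (real k) = ln (real k) / real k"
    and "2 < p \<Longrightarrow> real k powr (- e) * varsigma (e - 1) (real k) \<le> (2 + p) / (p - 2) * (1 / real k)"
proof -
  have e1: "e - 1 = (p - 2) / (2 + p)" unfolding e using assms by (simp add: field_simps)
  {
    assume p: "p < 2"
    have "varsigma (e - 1) (real k) = (real k powr (e - 1) - 1) / (e - 1)"
      using p assms by (simp add: varsigma_def e1)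
    also have "\<dots> = (1 - real k powr (e - 1)) * (1 / (1 - e))"
      by (metis minus_diff_eq minus_divide_divide times_divide_eq_right mult_1_right)
    also have "1 / (1 - e) = (2 + p) / (2 - p)"
      unfolding e using p assms by (simp add: field_simps)
    also have "(1 - real k powr (e - 1)) * ((2 + p) / (2 - p)) \<le> 1 * ((2 + p) / (2 - p))" using p assms by (intro mult_right_mono) auto
    finally have "real k powr (- e) * varsigma (e - 1) (real k) \<le> real k powr (- e) * ((2 + p) / (2 - p))"
      by (intro mult_left_mono) auto
    then show "real k powr (- e) * varsigma (e - 1) (real k) \<le> (2 + p) / (2 - p) * real k powr (- e)"
      by (simp add: mult.commute)
  next
    assume "p = 2"
    then have "e = 1" unfolding e by simp
    then show "real k powr (- e) * varsigma (e - 1) (real k) = ln (real k) / real k"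
      using assms by (simp add: varsigma_def powr_minus divide_simps)
  next
    assume p: "2 < p"
    have "real k powr (- e) * varsigma (e - 1) (real k)
        = (real k powr (- e) * real k powr (e - 1) - real k powr (- e)) * (1 / (e - 1))"
      using p assms by (simp add: varsigma_def e1 right_diff_distrib)
    also have "1 / (e - 1) = (2 + p) / (p - 2)"
      using e1 by simp
    also have "real k powr (- e) * real k powr (e - 1) = real k powr (- 1)"
      by (simp add: powr_add[symmetric])
    also have "\<dots> = 1 / real k"
      using assms by (simp add: powr_minus divide_simps)
    also have "(1 / real k - real k powr (- e)) * ((2 + p) / (p - 2)) \<le> (1 / real k) * ((2 + p) / (p - 2))"
      using p by (intro mult_right_mono) auto
    finally show "real k powr (- e) * varsigma (e - 1) (real k) \<le> (2 + p) / (p - 2) * (1 / real k)"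
      by (simp add: mult.commute)
  }
qed

section \<open>Convergence rates\<close>

theorem theorem2p13:
  fixes \<Omega> :: "'w measure" and P :: "'s measure"
    and f :: "real ^ 'n \<Rightarrow> 's \<Rightarrow> ereal" and r :: "real ^ 'n \<Rightarrow> ereal"
    and g :: "real ^ 'n \<Rightarrow> real ^ 'n \<Rightarrow> 's \<Rightarrow> real" and V U :: "(real ^ 'n) set"
    and \<phi> :: "real ^ 'n \<Rightarrow> ereal" and Xopt :: "(real ^ 'n) set"
    and S :: "nat \<Rightarrow> nat \<Rightarrow> 'w \<Rightarrow> 's" and m :: nat
    and M :: "nat \<Rightarrow> 'w \<Rightarrow> real ^ 'n \<Rightarrow> real ^ 'n" and x :: "nat \<Rightarrow> 'w \<Rightarrow> real ^ 'n" and x1 :: "real ^ 'n"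
    and \<alpha> \<epsilon> \<mu> L \<rho> :: "nat \<Rightarrow> real" and \<mu>inf Linf \<nu>inf :: real
    and Lbar :: "(real ^ 'n) set \<Rightarrow> 's \<Rightarrow> real" and LFbar :: "(real ^ 'n) set \<Rightarrow> real"
    and Lf :: "'s \<Rightarrow> real" and LF :: real
    and \<eta>bar \<tau>bar cbar1 \<eta> \<tau> c1 \<gamma> \<rho>bar \<alpha>l \<alpha>u \<beta> s c\<tau>\<eta> ctilde \<delta>1 :: real
    and Ctilde :: "real \<Rightarrow> real" and R :: "nat \<Rightarrow> real"
  assumes prob_\<Omega>: "prob_space \<Omega>" and prob_P: "prob_space P"
    and phi: "\<phi> = total_objective P f r" and Xopt: "Xopt = argmin_set \<phi>"
    and models: "model_functions P V r g"
    and accuracy: "model_accuracy P V f g \<eta>bar"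
    and precond: "preconditioner_condition \<Omega> (sample_filtration \<Omega> P S m) M \<mu> L \<rho> \<mu>inf Linf \<nu>inf"
    and regular: "regularity P V f r g \<tau>bar"
    and lipschitz: "local_lipschitz_models P V g Lbar LFbar"
    and growth: "quadratic_growth \<phi> cbar1"
    and Xopt_nonempty: "Xopt \<noteq> {}"
    and eta: "\<eta> = Linf\<^sup>2 * \<eta>bar" and tau: "\<tau> = Linf\<^sup>2 * \<tau>bar" and c1: "c1 = \<mu>inf\<^sup>2 * cbar1"
    and run: "ispPPA_run \<Omega> P S m V g r \<tau> M \<alpha> \<epsilon> x1 x"
    and gamma: "0 \<le> \<gamma>" and rhobar: "\<eta> + \<tau> < \<rho>bar"
    and alpha_l: "0 < \<alpha>l" "\<alpha>l < inverse \<rho>bar" and alpha_u: "0 < \<alpha>u" "\<alpha>u < inverse \<rho>bar"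
    and beta: "0 < \<beta>" "\<beta> \<le> 1"
    and stepsizes: "\<forall>k\<ge>1. \<alpha>l * real k powr (- \<beta>) \<le> \<alpha> k \<and> \<alpha> k \<le> \<alpha>u * real k powr (- \<beta>) \<and>
                       \<epsilon> k = \<gamma> * \<alpha> k powr (3 / 2)"
    and c_tau_eta: "c\<tau>\<eta> = c1 - (\<tau> + \<eta>) / 2"
    and c_tilde: "ctilde = \<rho>bar * c\<tau>\<eta> / (\<rho>bar + \<eta>)"
    and delta1: "\<delta>1 = (infdist x1 Xopt)\<^sup>2"
    and s: "0 < s" "s < 2"
    and c1_large: "(\<tau> + \<eta>) / 2 < c1"
    \<comment> \<open>the bounded-iterates event, and the set \<open>U\<close> containing all iterates and exact proximal points\<close>
    and event: "AE \<omega> in \<Omega>. bdd_above ((\<lambda>k. norm (x k \<omega>)) ` {1..})"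
    and U: "bounded U" "open U" "convex U" "U \<subseteq> V"
    and U_contains: "AE \<omega> in \<Omega>. \<forall>k\<ge>1. x k \<omega> \<in> U \<and> exact_iterate S m g r M \<alpha> x k \<omega> \<in> U"
    and Lf: "Lf = (\<lambda>sm. Linf * Lbar U sm)" and LF: "LF = Linf * LFbar U"
    and Lf_pos: "0 < (LINT sm|P. (Lf sm)\<^sup>2)"
    and C_tilde: "Ctilde = (\<lambda>a. rho_const P Lf m * LF\<^sup>2 +
          (1 + (2 * c1 - \<tau>) * a) * (2 * (1 + \<eta> * a) + s * (2 * c1 - \<tau> - \<eta>) * a)
            / ((2 - s) * (2 * c1 - \<tau> - \<eta>) * (1 + \<eta> * a)) * \<gamma>\<^sup>2)"
    and R: "R = (\<lambda>k.
          if c\<tau>\<eta> * \<alpha>l < 2 / s * (1 + \<eta> / \<rho>bar) then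
            (4 * \<delta>1 / (1 + s * ctilde * \<alpha>l)
               + 4 * Ctilde \<alpha>u * (2 + s * ctilde * \<alpha>l) * \<alpha>u\<^sup>2 / (2 - s * ctilde * \<alpha>l))
            * (1 / real k) powr (2 * s * ctilde * \<alpha>l / (2 + s * ctilde * \<alpha>l))
          else if c\<tau>\<eta> * \<alpha>l = 2 / s * (1 + \<eta> / \<rho>bar) then
            4 * \<delta>1 / 3 * (1 / real k) + 4 * Ctilde \<alpha>u * \<alpha>u\<^sup>2 * (ln (real k) / real k)
          else
            4 * \<delta>1 / (1 + s * ctilde * \<alpha>l)
              * (1 / real k) powr (2 * s * ctilde * \<alpha>l / (2 + s * ctilde * \<alpha>l))
            + 4 * Ctilde \<alpha>u * (2 + s * ctilde * \<alpha>l) * \<alpha>u\<^sup>2 / (s * ctilde * \<alpha>l - 2) * (1 / real k))"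
  shows "(\<beta> < 1 \<longrightarrow> (\<forall>k\<ge>1.
            (LINT \<omega>|\<Omega>. (infdist (x k \<omega>) Xopt)\<^sup>2)
            \<le> (\<nu>inf * Linf)\<^sup>2 *
               (exp (- (s * ctilde * \<alpha>l / (1 + s * ctilde * \<alpha>u) * varsigma (1 - \<beta>) (real k))) * \<delta>1
                + Ctilde \<alpha>u * 4 powr \<beta>
                    * (\<alpha>u\<^sup>2 / (1 - exp (- (s * ctilde * \<alpha>u / (1 + s * ctilde * \<alpha>u)))))
                    * (1 / real k powr \<beta>)
                + Ctilde \<alpha>u * 4 powr \<beta> * \<alpha>u\<^sup>2
                    * exp (- (s * ctilde * \<alpha>l / (2 * (1 + s * ctilde * \<alpha>u)) * real k powr (1 - \<beta>)))
                    * varsigma (1 - 2 * \<beta>) (real k / 2))))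
       \<comment> \<open>the side condition only drops \<open>k = 1\<close> with \<open>s * ctilde * \<alpha>l > 3\<close> (last case of \<open>R\<close>),
           where \<open>R 1\<close> can be smaller than \<open>\<delta>1\<close>\<close>
       \<and> (\<beta> = 1 \<longrightarrow> (\<forall>k\<ge>1. k \<ge> 2 \<or> s * ctilde * \<alpha>l \<le> 3 \<longrightarrow>
            (LINT \<omega>|\<Omega>. (infdist (x k \<omega>) Xopt)\<^sup>2) \<le> (\<nu>inf * Linf)\<^sup>2 * R k))"
proof -
  have rho0: "0 < \<rho>bar" using alpha_u by (metis inverse_positive_iff_positive less_trans)
  have lu: "\<alpha>l \<le> \<alpha>u" using stepsizes by fastforce
  have \<alpha>: "0 < \<alpha> k" "\<alpha> k \<le> \<alpha>u" if "1 \<le> k" for k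
  proof -
    have "0 < \<alpha>l * real k powr (- \<beta>)" using alpha_l that by simp
    then show "0 < \<alpha> k" using stepsizes that by fastforce
    have "real k powr (- \<beta>) \<le> 1" using that beta powr_mono[of "- \<beta>" 0 "real k"] by simp
    then have "\<alpha>u * real k powr (- \<beta>) \<le> \<alpha>u" using alpha_u by (simp add: mult_left_le)
    then show "\<alpha> k \<le> \<alpha>u" using stepsizes that by fastforce
  qed
  have step_bound: "(\<eta> + \<tau>) * \<alpha> k < 1" if "1 \<le> k" for k
  proof -
    have "(\<eta> + \<tau>) * \<alpha> k \<le> \<rho>bar * \<alpha> k" using rhobar \<alpha>[OF that] by (intro mult_right_mono) auto
    also have "\<dots> \<le> \<rho>bar * \<alpha>u" using rho0 \<alpha>[OF that] by simp
    also have "\<dots> < 1" using alpha_u rho0 by (simp add: field_simps)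
    finally show ?thesis .
  qed
  interpret ispPPA_setting \<Omega> P f r g V U Xopt S m M x x1 \<alpha> \<epsilon> \<mu> L \<rho> \<mu>inf Linf \<nu>inf Lbar LFbar
      \<eta>bar \<tau>bar cbar1 \<eta> \<tau> c1
  proof (rule ispPPA_setting.intro)
    show "0 < (LINT s|P. (Linf * Lbar U s)\<^sup>2)" using Lf_pos unfolding Lf .
    show "Xopt = argmin_set (total_objective P f r)" using Xopt phi by simp
    show "quadratic_growth (total_objective P f r) cbar1" using growth phi by simp
  qed (fact assms step_bound)+
  define e where "e = 2 * c1 - \<tau> - \<eta>"
  have e: "0 < e" "2 * c1 - \<tau> = \<eta> + e" "c\<tau>\<eta> = e / 2" using c1_large by (simp_all add: e_def c_tau_eta field_simps)
  define q where "q = s * ctilde"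
  have ct: "ctilde = \<rho>bar * (e / 2) / (\<rho>bar + \<eta>)" by (simp add: c_tilde e)
  have ct0: "0 < ctilde" unfolding ct using rho0 \<eta>_nonneg e by (intro divide_pos_pos mult_pos_pos add_pos_nonneg) auto
  have q0: "0 < q" using s ct0 by (simp add: q_def)
  have rate: "q * a \<le> s * (e * a / (1 + \<eta> * a)) / 2" if a: "0 < a" "a \<le> \<alpha>u" for a
  proof -
    have "\<rho>bar * \<alpha>u < 1" using alpha_u rho0 by (simp add: field_simps)
    then have "\<rho>bar * a \<le> 1"
      using mult_left_mono[OF a(2), of \<rho>bar] rho0 by linarith
    then have "\<rho>bar * (1 + \<eta> * a) \<le> \<rho>bar + \<eta>"
      using mult_left_mono[of "\<rho>bar * a" 1 \<eta>] \<eta>_nonneg by (simp add: algebra_simps)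
    moreover have pos: "0 < 1 + \<eta> * a" "0 < \<rho>bar + \<eta>" using a \<eta>_nonneg rho0 by (auto intro: add_pos_nonneg)
    ultimately have "\<rho>bar / (\<rho>bar + \<eta>) \<le> 1 / (1 + \<eta> * a)" by (simp add: field_simps)
    then have "(s * e * a / 2) * (\<rho>bar / (\<rho>bar + \<eta>)) \<le> (s * e * a / 2) * (1 / (1 + \<eta> * a))"
      using s e a by (intro mult_left_mono) auto
    then show ?thesis unfolding q_def ct by (simp add: mult_ac)
  qed
  have C: "Ctilde \<alpha>u = noise + (1 + (\<eta> + e) * \<alpha>u) * (2 * (1 + \<eta> * \<alpha>u) + s * e * \<alpha>u) / ((2 - s) * e * (1 + \<eta> * \<alpha>u)) * \<gamma>\<^sup>2"
    unfolding C_tilde noise_def Lf LF e_def by simp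
  have C0: "0 \<le> Ctilde \<alpha>u"
    unfolding C using noise_nonneg \<eta>_nonneg e s alpha_u
    by (intro add_nonneg_nonneg mult_nonneg_nonneg divide_nonneg_nonneg) auto
  have rec: "scaled (Suc k) \<le> (scaled k + Ctilde \<alpha>u * (\<alpha> k)\<^sup>2) / (1 + q * \<alpha> k)" if k: "1 \<le> k" for k
  proof (rule scaled_recursion[OF k s e(1,2) \<alpha>(2)[OF k] rate[OF \<alpha>[OF k]] less_imp_le[OF q0] _ C])
    have "(\<alpha> k powr (3 / 2))\<^sup>2 = \<alpha> k powr 3"
      by (simp add: power2_eq_square powr_add[symmetric])
    also have "\<dots> = \<alpha> k ^ 3" using \<alpha>[OF k] by simp
    finally show "(\<epsilon> k)\<^sup>2 = \<gamma>\<^sup>2 * \<alpha> k ^ 3" using stepsizes k by (simp add: power_mult_distrib)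
  qed
  have d1: "scaled 1 = \<delta>1" unfolding delta1 by (rule scaled_one)
  have nu: "1 \<le> (\<nu>inf * Linf)\<^sup>2"
    using partial_product_le[of 0] Linf mult_mono[of 1 \<nu>inf 1 Linf] by (simp add: one_le_power)
  have reduce: "(LINT \<omega>|\<Omega>. (infdist (x k \<omega>) Xopt)\<^sup>2) \<le> (\<nu>inf * Linf)\<^sup>2 * b" if "1 \<le> k" "scaled k \<le> b" for k b
    using expected_distance_le_scaled[OF that(1)] mult_left_mono[OF that(2), of "(\<nu>inf * Linf)\<^sup>2"] by simp
  have part1: "scaled k \<le> exp (- (s * ctilde * \<alpha>l / (1 + s * ctilde * \<alpha>u) * varsigma (1 - \<beta>) (real k))) * \<delta>1
                + Ctilde \<alpha>u * 4 powr \<beta>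
                    * (\<alpha>u\<^sup>2 / (1 - exp (- (s * ctilde * \<alpha>u / (1 + s * ctilde * \<alpha>u)))))
                    * (1 / real k powr \<beta>)
                + Ctilde \<alpha>u * 4 powr \<beta> * \<alpha>u\<^sup>2
                    * exp (- (s * ctilde * \<alpha>l / (2 * (1 + s * ctilde * \<alpha>u)) * real k powr (1 - \<beta>)))
                    * varsigma (1 - 2 * \<beta>) (real k / 2)" if k: "1 \<le> k" for k
    using recursion_rate_subharmonic[where d = scaled and \<alpha> = \<alpha> and q = q and l = \<alpha>l and u = \<alpha>u and C = "Ctilde \<alpha>u" and \<beta> = \<beta>,
        OF rec q0 C0 scaled_nonneg alpha_l(1) beta _ k] stepsizes
    unfolding d1 q_def by blast
  have part2: "scaled k \<le> R k" if \<beta>: "\<beta> = 1" and k: "1 \<le> k" "k \<ge> 2 \<or> s * ctilde * \<alpha>l \<le> 3" for k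
  proof -
    let ?p = "s * ctilde * \<alpha>l" and ?e = "2 * s * ctilde * \<alpha>l / (2 + s * ctilde * \<alpha>l)"
    have p: "0 < ?p" using s ct0 alpha_l by simp
    have pq: "?p = q * \<alpha>l" by (simp add: q_def)
    have e': "?e = 2 * (q * \<alpha>l) / (2 + q * \<alpha>l)" "?e = 2 * ?p / (2 + ?p)" by (simp_all add: q_def)
    have thr: "2 / s * (1 + \<eta> / \<rho>bar) = 2 * ((\<rho>bar + \<eta>) / (s * \<rho>bar))"
      using rho0 by (simp add: field_simps)
    have pos: "0 < (\<rho>bar + \<eta>) / (s * \<rho>bar)" using rho0 \<eta>_nonneg s by (simp add: add_pos_nonneg)
    have "c\<tau>\<eta> * \<alpha>l = ?p * ((\<rho>bar + \<eta>) / (s * \<rho>bar))"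
      unfolding c_tilde using rho0 \<eta>_nonneg s by (simp add: add_pos_nonneg[THEN less_imp_neq, symmetric])
    then have cases: "c\<tau>\<eta> * \<alpha>l < 2 / s * (1 + \<eta> / \<rho>bar) \<longleftrightarrow> ?p < 2" "c\<tau>\<eta> * \<alpha>l = 2 / s * (1 + \<eta> / \<rho>bar) \<longleftrightarrow> ?p = 2"
      unfolding thr using pos by (simp_all only: mult_less_cancel_right_pos mult_right_cancel[OF less_imp_neq[OF pos, symmetric]])
    have R_eq: "R k = (if ?p < 2 then (4 * \<delta>1 / (1 + ?p) + 4 * Ctilde \<alpha>u * (2 + ?p) * \<alpha>u\<^sup>2 / (2 - ?p)) * (1 / real k) powr ?e
          else if ?p = 2 then 4 * \<delta>1 / 3 * (1 / real k) + 4 * Ctilde \<alpha>u * \<alpha>u\<^sup>2 * (ln (real k) / real k)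
          else 4 * \<delta>1 / (1 + ?p) * (1 / real k) powr ?e
            + 4 * Ctilde \<alpha>u * (2 + ?p) * \<alpha>u\<^sup>2 / (?p - 2) * (1 / real k))"
      unfolding R cases ..
    have \<delta>0: "0 \<le> \<delta>1" by (simp add: delta1)
    show ?thesis
    proof (cases "k = 1")
      case True
      \<comment> \<open>the first term of \<open>R\<close> alone covers the initial error, since \<open>4 / (1 + p) \<ge> 1\<close> exactly for \<open>p \<le> 3\<close>\<close>
      then have p3: "?p \<le> 3" using k by simp
      have big: "\<delta>1 \<le> 4 * \<delta>1 / (1 + ?p)"
        using p p3 mult_left_mono[of "1 + ?p" 4 \<delta>1] \<delta>0 by (simp add: pos_le_divide_eq mult.commute)
      have "0 \<le> 4 * Ctilde \<alpha>u * (2 + ?p) * \<alpha>u\<^sup>2 / (2 - ?p)" if "?p < 2" using that p C0 by simp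
      moreover have "0 \<le> 4 * Ctilde \<alpha>u * (2 + ?p) * \<alpha>u\<^sup>2 / (?p - 2)" if "\<not> ?p < 2" using that p C0 by simp
      ultimately have "\<delta>1 \<le> R k"
        unfolding R_eq using big \<delta>0 by (auto simp: True)
      moreover have "scaled k = \<delta>1" using d1 unfolding True .
      ultimately show ?thesis by simp
    next
      case False
      then have k2: "2 \<le> k" using k by simp
      have pw: "(1 / real k) powr ?e = real k powr (- ?e)" using k2 by (simp add: powr_divide powr_minus field_simps)
      have "\<alpha>l / real j \<le> \<alpha> j \<and> \<alpha> j \<le> \<alpha>u / real j" if "1 \<le> j" for j
      proof -
        have "real j powr (- 1) = inverse (real j)" by (simp add: powr_minus)
        moreover have "\<alpha>l * real j powr (- 1) \<le> \<alpha> j \<and> \<alpha> j \<le> \<alpha>u * real j powr (- 1)"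
          using stepsizes that unfolding \<beta> by blast
        ultimately show ?thesis by (simp only: divide_inverse)
      qed
      from recursion_rate_harmonic[where d = scaled and \<alpha> = \<alpha> and q = q and l = \<alpha>l and u = \<alpha>u and C = "Ctilde \<alpha>u",
          OF rec q0 C0 scaled_nonneg alpha_l(1) this k2 e'(1)]
      have main: "scaled k \<le> 4 * \<delta>1 / (1 + ?p) * real k powr (- ?e)
          + 4 * Ctilde \<alpha>u * \<alpha>u\<^sup>2 * (real k powr (- ?e) * varsigma (?e - 1) (real k))"
        unfolding d1 pq by simp
      have c0: "0 \<le> 4 * Ctilde \<alpha>u * \<alpha>u\<^sup>2" using C0 by simp
      note le = powr_neg_times_varsigma_le[OF k(1) p e'(2)]
      consider "?p < 2" | "?p = 2" | "2 < ?p" by linarith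
      then show ?thesis
      proof cases
        case 1
        have "4 * C * a * ((2 + p) / (2 - p) * w) = 4 * C * (2 + p) * a / (2 - p) * w" for C a p w :: real
          by simp
        then show ?thesis unfolding R_eq pw if_P[OF 1] distrib_right
          using order_trans[OF main add_left_mono[OF mult_left_mono[OF le(1)[OF 1] c0]]] by (simp only:)
      next
        case 2
        have "?e = 1" using 2 e'(2) by simp
        then have "real k powr (- ?e) = 1 / real k" using k2 by (simp add: powr_minus divide_inverse)
        then have "4 * \<delta>1 / (1 + ?p) * real k powr (- ?e) = 4 * \<delta>1 / 3 * (1 / real k)" using 2 by simp
        then show ?thesis using main unfolding R_eq le(2)[OF 2] using 2 by simp
      next
        case 3
        have "4 * C * a * ((2 + p) / (p - 2) * w) = 4 * C * (2 + p) * a / (p - 2) * w" for C a p w :: real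
          by simp
        moreover have "\<not> ?p < 2" "?p \<noteq> 2" using 3 by simp_all
        ultimately show ?thesis unfolding R_eq pw
          using order_trans[OF main add_left_mono[OF mult_left_mono[OF le(3)[OF 3] c0]]] by (simp only: if_False)
      qed
    qed
  qed
  show ?thesis using reduce part1 part2 by blast
qed

end
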